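(* Let $\beta>0$ and $\tau_1,\tau_2>0$ be fixed, and for $i\in\{L,G,J\}$ let $X_n^{i,\beta}:=\log(\det W_n^{i,\beta})-\mu^i_{\beta,n}$. For every real sequence $y=y_n$ with $y=o(\sqrt{\log n})$ and each $i\in\{L,G,J\}$, as $n\to\infty$, $$\mathbb{P}\left[X_n^{i,\beta}\ge y\sqrt{\frac{2\log n}\beta}\right]=\mathbb{P}[\mathcal N(0,1)\ge y]\,(1+o(1)).$$
   Context: Random determinants. (L) $\det W_n^{L,\beta}=\prod_{k=1}^n\lambda_k$, where $(\lambda_1,\dots,\lambda_n)$ has density on $(0,\infty)^n$ proportional to $\prod_{j<k}|\lambda_k-\lambda_j|^\beta\prod_{k=1}^n\lambda_k^{\beta/2-1}e^{-\lambda_k/2}$ ($\beta$-Laguerre ensemble). (G) $\det W_n^{G,\beta}$ is a random variable distributed as $\prod_{k=2}^n\rho_k$ with $\rho_k$ independent, $\rho_k\sim\mathrm{Beta}\left(\frac\beta2(n-k+1),\frac\beta2(k-1)\right)$ ($\beta$-Uniform Gram ensemble). (J) With $n_1=\lfloor n\tau_1\rfloor$, $n_2=\lfloor n\tau_2\rfloor$, $m=\min(n_1,n_2)$, $M=\max(n_1,n_2)$: $\det W_n^{J,\beta}=\prod_{k=1}^m\lambda_k$, where $(\lambda_1,\dots,\lambda_m)$ has density on $(0,1)^m$ proportional to $\prod_{j<k}|\lambda_k-\lambda_j|^\beta\prod_{k=1}^m\lambda_k^{\beta/2-1}(1-\lambda_k)^{\frac\beta2(M-m+1)-1}$ ($\beta$-Jacobi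 ensemble). Centerings: $\mu^L_{\beta,n}=(\frac12-\frac1\beta)\log n-n+n\log(\beta n)$; $\mu^G_{\beta,n}=(\frac12-\frac1\beta)\log n-n+\frac1\beta$; $\mu^J_{\beta,n}=(\frac12-\frac1\beta)\log n+(\frac12-\frac1\beta)\log\left(\frac{\tau_1\tau_2}{\tau_1+\tau_2}\right)-\varepsilon(\lfloor n\tau_1\rfloor,\lfloor n\tau_2\rfloor)-\varepsilon(\lfloor n\tau_2\rfloor,\lfloor n\tau_1\rfloor)$ with $\varepsilon(x,y)=x\log(1+\frac yx)$. $\mathcal N(0,1)$ denotes a standard normal random variable. *)

theory Defs
  imports "HOL-Probability.Probability" "HOL-Library.Landau_Symbols"
begin

text \<open>The probability measure whose density with respect to \<open>N\<close> is proportional to \<open>f\<close>.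
  It is only meaningful if the integral of \<open>f\<close> is neither 0 nor infinite.\<close>

definition density_propto :: "'a measure \<Rightarrow> ('a \<Rightarrow> real) \<Rightarrow> 'a measure" where
  "density_propto N f = density N (\<lambda>x. ennreal (f x) / (\<integral>\<^sup>+ z. ennreal (f z) \<partial>N))"

text \<open>Lebesgue measure on \<open>\<real>\<^sup>n\<close>, vectors being indexed by \<open>{1..n}\<close>.\<close>

abbreviation lborel_n :: "nat \<Rightarrow> (nat \<Rightarrow> real) measure" where
  "lborel_n n \<equiv> Pi\<^sub>M {1..n} (\<lambda>_. lborel)"

definition vandermonde_abs :: "nat \<Rightarrow> (nat \<Rightarrow> real) \<Rightarrow> real" where
  "vandermonde_abs n x = (\<Prod>k\<in>{1..n}. \<Prod>j\<in>{1..<k}. \<bar>x k - x j\<bar>)"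

definition laguerre_ensemble :: "real \<Rightarrow> nat \<Rightarrow> (nat \<Rightarrow> real) measure" where
  "laguerre_ensemble \<beta> n = density_propto (lborel_n n) (\<lambda>x.
     vandermonde_abs n x powr \<beta> *
     (\<Prod>k\<in>{1..n}. x k powr (\<beta> / 2 - 1) * exp (- x k / 2) * indicator {0<..} (x k)))"

text \<open>Here \<open>m = min n\<^sub>1 n\<^sub>2\<close> is the number of eigenvalues and \<open>M = max n\<^sub>1 n\<^sub>2\<close>.\<close>

definition jacobi_ensemble :: "real \<Rightarrow> nat \<Rightarrow> nat \<Rightarrow> (nat \<Rightarrow> real) measure" where
  "jacobi_ensemble \<beta> m M = density_propto (lborel_n m) (\<lambda>x.
     vandermonde_abs m x powr \<beta> *
     (\<Prod>k\<in>{1..m}. x k powr (\<beta> / 2 - 1)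
        * (1 - x k) powr (\<beta> / 2 * (real M - real m + 1) - 1) * indicator {0<..<1} (x k)))"

definition beta_distribution :: "real \<Rightarrow> real \<Rightarrow> real measure" where
  "beta_distribution a b = density lborel (\<lambda>x. ennreal
     (x powr (a - 1) * (1 - x) powr (b - 1) / Beta a b * indicator {0<..<1} x))"

text \<open>The joint law of the independent variables \<open>\<rho>\<^sub>2, \<dots>, \<rho>\<^sub>n\<close>.\<close>

definition gram_factors :: "real \<Rightarrow> nat \<Rightarrow> (nat \<Rightarrow> real) measure" where
  "gram_factors \<beta> n = Pi\<^sub>M {2..n} (\<lambda>k.
     beta_distribution (\<beta> / 2 * (real n - real k + 1)) (\<beta> / 2 * (real k - 1)))"

datatype ensemble = Laguerre | Gram | Jacobi

text \<open>The law of \<open>det W\<^sub>n\<close> for each ensemble; \<open>\<tau>\<^sub>1\<close> and \<open>\<tau>\<^sub>2\<close> only matter for \<open>Jacobi\<close>.\<close>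

fun det_law :: "ensemble \<Rightarrow> real \<Rightarrow> real \<Rightarrow> real \<Rightarrow> nat \<Rightarrow> real measure" where
  "det_law Laguerre \<beta> \<tau>\<^sub>1 \<tau>\<^sub>2 n =
     distr (laguerre_ensemble \<beta> n) borel (\<lambda>x. \<Prod>k\<in>{1..n}. x k)"
| "det_law Gram \<beta> \<tau>\<^sub>1 \<tau>\<^sub>2 n =
     distr (gram_factors \<beta> n) borel (\<lambda>\<rho>. \<Prod>k\<in>{2..n}. \<rho> k)"
| "det_law Jacobi \<beta> \<tau>\<^sub>1 \<tau>\<^sub>2 n =
     (let n\<^sub>1 = nat \<lfloor>real n * \<tau>\<^sub>1\<rfloor>; n\<^sub>2 = nat \<lfloor>real n * \<tau>\<^sub>2\<rfloor>; m = min n\<^sub>1 n\<^sub>2; M = max n\<^sub>1 n\<^sub>2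
      in distr (jacobi_ensemble \<beta> m M) borel (\<lambda>x. \<Prod>k\<in>{1..m}. x k))"

definition eps :: "real \<Rightarrow> real \<Rightarrow> real" where
  "eps x y = x * ln (1 + y / x)"

fun centering :: "ensemble \<Rightarrow> real \<Rightarrow> real \<Rightarrow> real \<Rightarrow> nat \<Rightarrow> real" where
  "centering Laguerre \<beta> \<tau>\<^sub>1 \<tau>\<^sub>2 n =
     (1 / 2 - 1 / \<beta>) * ln (real n) - real n + real n * ln (\<beta> * real n)"
| "centering Gram \<beta> \<tau>\<^sub>1 \<tau>\<^sub>2 n =
     (1 / 2 - 1 / \<beta>) * ln (real n) - real n + 1 / \<beta>"
| "centering Jacobi \<beta> \<tau>\<^sub>1 \<tau>\<^sub>2 n =
     (1 / 2 - 1 / \<beta>) * ln (real n) + (1 / 2 - 1 / \<beta>) * ln (\<tau>\<^sub>1 * \<tau>\<^sub>2 / (\<tau>\<^sub>1 + \<tau>\<^sub>2))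
     - eps (of_int \<lfloor>real n * \<tau>\<^sub>1\<rfloor>) (of_int \<lfloor>real n * \<tau>\<^sub>2\<rfloor>)
     - eps (of_int \<lfloor>real n * \<tau>\<^sub>2\<rfloor>) (of_int \<lfloor>real n * \<tau>\<^sub>1\<rfloor>)"

text \<open>The law of \<open>X\<^sub>n = log (det W\<^sub>n) - \<mu>\<^sub>n\<close>. The determinant is positive almost surely, so the
  value of \<^const>\<open>ln\<close> on nonpositive reals is irrelevant.\<close>

definition X_law :: "ensemble \<Rightarrow> real \<Rightarrow> real \<Rightarrow> real \<Rightarrow> nat \<Rightarrow> real measure" where
  "X_law i \<beta> \<tau>\<^sub>1 \<tau>\<^sub>2 n =
     distr (det_law i \<beta> \<tau>\<^sub>1 \<tau>\<^sub>2 n) borel (\<lambda>d. ln d - centering i \<beta> \<tau>\<^sub>1 \<tau>\<^sub>2 n)"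

abbreviation std_normal_law :: "real measure" where
  "std_normal_law \<equiv> density lborel (\<lambda>x. ennreal (std_normal_density x))"

end

theory Submission
  imports Defs "HOL-Complex_Analysis.Complex_Analysis" "HOL-Real_Asymp.Real_Asymp"
begin

text \<open>
The moments of the determinants are explicit. Put \<open>\<gamma> = \<beta> / 2\<close>. In all three ensembles the
expectation of \<open>(det W\<^sub>n) powr s\<close> is a finite product of quotients \<open>\<Gamma> (w + s) / \<Gamma> w\<close> and of
their inverses, up to a power of 2, where \<open>w\<close> runs through multiples of \<open>\<gamma>\<close> (\<open>det_law_moments\<close>). For the Gram ensemble
this is the moment formula of the beta distribution. For the Laguerre and the Jacobi ensemble it
comes from Selberg's integral, of which only the dependence on the exponent \<open>a\<close> at the origin
enters. Integration by parts, following Aomoto, shows how the integral changes when \<open>a\<close> is replaced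
by \<open>a + 1\<close> (\<open>aomoto\<close>). The integral is a log-convex function of \<open>a\<close>, and as in the theorem of Bohr
and Mollerup this determines its quotients at any two exponents (\<open>selberg_quotient\<close>).

Stirling's expansion with remainder, \<open>log (\<Gamma> (w + z) / \<Gamma> w) = z * log w + (z\<^sup>2 - z) / (2 * w) +
O (\<bar>z\<bar> / w\<^sup>2)\<close>, can be summed over the multiples of \<open>\<gamma>\<close>. The linear terms produce the centering, up
to a bounded multiple of \<open>z\<close>, and the terms \<open>z\<^sup>2 / (2 * \<gamma> * k)\<close> produce a harmonic sum. Hence
\<open>E (exp (z * X\<^sub>n)) = exp (\<sigma>\<^sub>n\<^sup>2 * z\<^sup>2 / 2 + O (\<bar>z\<bar>))\<close> uniformly for complex \<open>z\<close> in a fixed disc, where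
\<open>\<sigma>\<^sub>n\<^sup>2 = 2 * log n / \<beta>\<close>; the moments give this for real \<open>z\<close>, and both sides are analytic
(\<open>X_law_near_gaussian\<close>).

This estimate alone implies the theorem (\<open>moderate_deviations\<close>). By passing to subsequences one may
assume that \<open>y\<^sub>n\<close> converges in the extended reals. If the limit is not \<open>\<infinity>\<close>, the central limit theorem
suffices. If \<open>y\<^sub>n\<close> tends to \<open>\<infinity>\<close>, the law is tilted by \<open>exp (s * x)\<close> with \<open>s = y\<^sub>n / \<sigma>\<^sub>n\<close>, which tends to
0 by hypothesis. The tilted law has mean close to \<open>y\<^sub>n * \<sigma>\<^sub>n\<close>, so that the tail begins in its centre, and
in the coordinate \<open>t = s * x - y\<^sub>n\<^sup>2\<close> it looks like a centred normal law of variance \<open>y\<^sub>n\<^sup>2\<close>. The tail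
probability becomes an integral of \<open>exp (- t)\<close> over \<open>t \<ge> 0\<close>, which lives on the scale 1, much finer
than \<open>y\<^sub>n\<close>. A local limit theorem is therefore required; it follows from the relative closeness of the
characteristic functions on compact sets by smoothing with the Fejer kernel (\<open>scaled_tail_tendsto\<close>).
The normal law satisfies the same hypotheses, so both tails have the same asymptotics and their
quotient tends to 1.
\<close>

section \<open>Smoothing with the Fejer kernel\<close>

text \<open>The window of a local limit theorem has to be smoothed by a kernel whose Fourier transform has
compact support, because characteristic functions are controlled on compact sets only. The kernel
is the Fourier transform of the triangle function; it equals \<open>2 * (1 - cos x) / x\<^sup>2\<close> away
from the origin, and is therefore nonnegative and integrable.\<close>

definition triangle :: "real \<Rightarrow> real" where
  "triangle v = max 0 (1 - \<bar>v\<bar>)"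

definition fejer :: "real \<Rightarrow> real" where
  "fejer x = (\<integral>v. triangle v * cos (v * x) \<partial>lborel)"

lemma triangle_measurable [measurable]: "triangle \<in> borel_measurable borel"
  unfolding triangle_def[abs_def] by measurable

lemma triangle_bounds: "0 \<le> triangle v" "triangle v \<le> 1"
  by (auto simp: triangle_def)

lemma triangle_zero: "\<bar>v\<bar> \<ge> 1 \<Longrightarrow> triangle v = 0"
  by (auto simp: triangle_def)

lemma integrable_triangle: "integrable lborel triangle"
proof (rule Bochner_Integration.integrable_bound)
  show "integrable lborel (indicator {-1..1} :: real \<Rightarrow> real)" by simp
  show "AE v in lborel. norm (triangle v) \<le> norm (indicator {-1..1} v :: real)"
    using triangle_bounds triangle_zero by (intro AE_I2) (auto simp: indicator_def)
qed measurable

lemma integrable_triangle_mult: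
  assumes [measurable]: "g \<in> borel_measurable borel" and "\<And>v. \<bar>g v\<bar> \<le> 1"
  shows "integrable lborel (\<lambda>v. triangle v * g v)"
  by (rule Bochner_Integration.integrable_bound[OF integrable_triangle])
     (use assms(2) triangle_bounds(1) in \<open>auto simp: abs_mult mult_left_le\<close>)

lemma fejer_eq:
  assumes "x \<noteq> 0"
  shows "fejer x = 2 * (1 - cos x) / x\<^sup>2"
proof -
  let ?F1 = "\<lambda>v. (1 - v) * sin (v * x) / x - cos (v * x) / x\<^sup>2"
  let ?F2 = "\<lambda>v. (1 + v) * sin (v * x) / x + cos (v * x) / x\<^sup>2"
  have 1: "has_bochner_integral lborel (\<lambda>v. (1 - v) * cos (v * x) * indicator {0..1} v) (?F1 1 - ?F1 0)"
    using assms by (intro has_bochner_integral_FTC_Icc_real)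
      (auto intro!: derivative_eq_intros continuous_intros simp: field_simps power2_eq_square)
  have 2: "has_bochner_integral lborel (\<lambda>v. (1 + v) * cos (v * x) * indicator {-1..0} v) (?F2 0 - ?F2 (-1))"
    using assms by (intro has_bochner_integral_FTC_Icc_real)
      (auto intro!: derivative_eq_intros continuous_intros simp: field_simps power2_eq_square)
  have "fejer x = (\<integral>v. (1 - v) * cos (v * x) * indicator {0..1} v + (1 + v) * cos (v * x) * indicator {-1..0} v \<partial>lborel)"
    unfolding fejer_def
  proof (rule integral_cong_AE)
    show "AE v in lborel. triangle v * cos (v * x) = (1 - v) * cos (v * x) * indicator {0..1} v + (1 + v) * cos (v * x) * indicator {-1..0} v"
      using AE_lborel_singleton[of 0] by eventually_elim (auto simp: triangle_def indicator_def)
  qed measurable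
  also have "\<dots> = (?F1 1 - ?F1 0) + (?F2 0 - ?F2 (-1))"
    using has_bochner_integral_add[OF 1 2] by (rule has_bochner_integral_integral_eq)
  also have "\<dots> = 2 * (1 - cos x) / x\<^sup>2" by (simp add: diff_divide_distrib add_divide_distrib)
  finally show ?thesis .
qed

lemma fejer_le_1: "fejer x \<le> 1"
proof -
  have "fejer x \<le> (\<integral>v. triangle v * cos (v * 0) \<partial>lborel)"
    unfolding fejer_def using triangle_bounds(1)
    by (intro integral_mono integrable_triangle_mult) (auto intro: mult_left_le)
  also have "\<dots> = (\<integral>v. (1 - v) * indicator {0..1} v + (1 + v) * indicator {-1..0} v \<partial>lborel)"
  proof (rule integral_cong_AE)
    show "AE v in lborel. triangle v * cos (v * 0) = (1 - v) * indicator {0..1} v + (1 + v) * indicator {-1..0} v"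
      using AE_lborel_singleton[of 0] by eventually_elim (auto simp: triangle_def indicator_def)
  qed measurable
  also have "\<dots> = ((1 - 1\<^sup>2 / 2) - (0 - 0\<^sup>2 / 2)) + ((0 + 0\<^sup>2 / 2) - (- 1 + (- 1)\<^sup>2 / 2))"
  proof (rule has_bochner_integral_integral_eq, rule has_bochner_integral_add)
    show "has_bochner_integral lborel (\<lambda>v::real. (1 - v) * indicator {0..1} v) ((1 - 1\<^sup>2 / 2) - (0 - 0\<^sup>2 / 2))"
      by (rule has_bochner_integral_FTC_Icc_real) (auto intro!: derivative_eq_intros)
    show "has_bochner_integral lborel (\<lambda>v::real. (1 + v) * indicator {-1..0} v) ((0 + 0\<^sup>2 / 2) - (- 1 + (- 1)\<^sup>2 / 2))"
      by (rule has_bochner_integral_FTC_Icc_real) (auto intro!: derivative_eq_intros)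
  qed
  finally show ?thesis by simp
qed

lemma fejer_measurable [measurable]: "fejer \<in> borel_measurable borel"
  unfolding fejer_def[abs_def] by measurable

lemma fejer_nonneg: "0 \<le> fejer x"
proof (cases "x = 0")
  case True
  then show ?thesis using triangle_bounds(1) by (auto simp: fejer_def intro!: integral_nonneg_AE)
next
  case False
  then show ?thesis by (simp add: fejer_eq)
qed

lemma integrable_fejer: "integrable lborel fejer"
proof (rule Bochner_Integration.integrable_bound)
  have "integrable lborel (\<lambda>x::real. inverse (1 + x\<^sup>2))"
    using integrable_inverse_1_plus_square by (simp add: set_integrable_def)
  then show "integrable lborel (\<lambda>x::real. 5 * inverse (1 + x\<^sup>2))" by simp
  show "AE x in lborel. norm (fejer x) \<le> norm (5 * inverse (1 + x\<^sup>2))"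
  proof (intro AE_I2)
    fix x :: real
    have "x\<^sup>2 * fejer x \<le> 4"
    proof (cases "x = 0")
      case False
      have eq: "x\<^sup>2 * fejer x = 2 * (1 - cos x)" using False by (simp add: fejer_eq)
      have "2 * (1 - cos x) \<le> 2 * (1 - (- 1))" by (intro mult_left_mono diff_left_mono) auto
      then show ?thesis unfolding eq by simp
    qed simp
    then have "fejer x * (1 + x\<^sup>2) \<le> 5" using fejer_le_1[of x] by (simp add: algebra_simps)
    moreover have "1 + x\<^sup>2 > 0" by (simp add: add_pos_nonneg)
    ultimately show "norm (fejer x) \<le> norm (5 * inverse (1 + x\<^sup>2))"
      using fejer_nonneg[of x] by (simp add: field_simps)
  qed
qed measurable

definition fejer_mass :: real where
  "fejer_mass = (\<integral>x. fejer x \<partial>lborel)"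

lemma fejer_mass_pos: "fejer_mass > 0"
proof -
  have "fejer_mass \<noteq> 0"
  proof
    assume "fejer_mass = 0"
    then have "AE x in lborel. fejer x = 0"
      using integral_nonneg_eq_0_iff_AE[OF integrable_fejer] fejer_nonneg by (simp add: fejer_mass_def)
    then have "AE x in lborel. x \<notin> {1..2::real}"
    proof eventually_elim
      case (elim x)
      show ?case
      proof
        assume x: "x \<in> {1..2}"
        then have "cos x < cos 0" by (intro cos_monotone_0_pi) (use pi_gt3 in auto)
        with x elim show False by (simp add: fejer_eq)
      qed
    qed
    then have "emeasure lborel {1..2::real} = 0"
      by (subst (asm) AE_iff_measurable[of "{1..2}"]) auto
    moreover have "emeasure lborel {1..2::real} = 1" by simp
    ultimately show False by simp
  qed
  moreover have "fejer_mass \<ge> 0" unfolding fejer_mass_def using fejer_nonneg by (intro integral_nonneg_AE) auto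
  ultimately show ?thesis by simp
qed

text \<open>The number \<open>1 / sqrt (2 * \<pi>)\<close>, in the form in which the kernel produces it.\<close>

definition tail_limit :: real where
  "tail_limit = sqrt (2 * pi) / fejer_mass"

lemma tail_limit_pos: "tail_limit > 0"
  using fejer_mass_pos by (simp add: tail_limit_def)

definition fejer_law :: "real measure" where
  "fejer_law = density lborel (\<lambda>x. ennreal (fejer x / fejer_mass))"

lemma real_distribution_fejer: "real_distribution fejer_law"
proof -
  have "emeasure fejer_law (space fejer_law) = (\<integral>\<^sup>+x. ennreal (fejer x / fejer_mass) \<partial>lborel)"
    unfolding fejer_law_def by (simp add: emeasure_density)
  also have "\<dots> = ennreal (\<integral>x. fejer x / fejer_mass \<partial>lborel)"
    using fejer_nonneg fejer_mass_pos integrable_fejer by (intro nn_integral_eq_integral) auto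
  also have "(\<integral>x. fejer x / fejer_mass \<partial>lborel) = 1"
    using fejer_mass_pos by (simp add: fejer_mass_def)
  finally have "prob_space fejer_law" by (intro prob_spaceI) simp
  then show ?thesis by (simp add: real_distribution_def real_distribution_axioms_def fejer_law_def)
qed

text \<open>Rescaling a Gaussian factor of width \<open>1 / r\<close> to a standard normal density: this turns Fourier
integrals into expectations of functions that become constant as \<open>r\<close> grows.\<close>

lemma gaussian_rescale:
  fixes g :: "real \<Rightarrow> real"
  assumes "r > 0"
  shows "r * (\<integral>v. g v * exp (- (r\<^sup>2 * v\<^sup>2 / 2)) \<partial>lborel)
     = sqrt (2 * pi) * (\<integral>w. g (w / r) * std_normal_density w \<partial>lborel)"
proof -
  have "(\<integral>v. g v * exp (- (r\<^sup>2 * v\<^sup>2 / 2)) \<partial>lborel)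
     = \<bar>1 / r\<bar> *\<^sub>R (\<integral>w. g (0 + 1 / r * w) * exp (- (r\<^sup>2 * (0 + 1 / r * w)\<^sup>2 / 2)) \<partial>lborel)"
    using assms by (intro lborel_integral_real_affine) simp
  also have "(\<lambda>w. g (0 + 1 / r * w) * exp (- (r\<^sup>2 * (0 + 1 / r * w)\<^sup>2 / 2)))
     = (\<lambda>w. sqrt (2 * pi) * (g (w / r) * std_normal_density w))"
    using assms by (auto simp: std_normal_density_def power_mult_distrib power_divide)
  finally show ?thesis using assms by simp
qed

text \<open>The test function to which tilting reduces tail probabilities.\<close>

definition exp_tail :: "real \<Rightarrow> real" where
  "exp_tail x = exp (- x) * indicator {0..} x"

lemma exp_tail_measurable [measurable]: "exp_tail \<in> borel_measurable borel"
  unfolding exp_tail_def[abs_def] by measurable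

lemma exp_tail_bounds: "0 \<le> exp_tail x" "exp_tail x \<le> 1"
  by (auto simp: exp_tail_def indicator_def)

lemma nn_integral_exp_tail: "(\<integral>\<^sup>+x. ennreal (exp_tail (x + c)) \<partial>lborel) = 1"
proof -
  have "(\<integral>\<^sup>+x. ennreal (exp_tail x) \<partial>lborel) = (\<integral>\<^sup>+x. ennreal (exp_tail (c + 1 * x)) \<partial>lborel)"
    by (subst nn_integral_real_affine[of _ 1 c]) auto
  moreover have "(\<integral>\<^sup>+x. ennreal (exp_tail x) \<partial>lborel) = ennreal (0 - - exp (- 0))"
  proof -
    have eq: "ennreal (exp_tail x) = ennreal (exp (- x)) * indicator {0..} x" for x
      by (simp add: exp_tail_def indicator_def)
    show ?thesis unfolding eq
  proof (rule nn_integral_FTC_atLeast)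
    show "((\<lambda>x. - exp (- x)) \<longlongrightarrow> 0) (at_top :: real filter)" by real_asymp
  qed (auto intro!: derivative_eq_intros)
  qed
  ultimately show ?thesis by (simp add: add.commute)
qed

lemma integrable_exp_tail: "integrable lborel (\<lambda>x. exp_tail (x + c))"
  and integral_exp_tail: "(\<integral>x. exp_tail (x + c) \<partial>lborel) = 1"
proof -
  show i: "integrable lborel (\<lambda>x. exp_tail (x + c))"
    by (rule integrableI_nonneg) (auto simp: exp_tail_bounds nn_integral_exp_tail)
  have "ennreal (\<integral>x. exp_tail (x + c) \<partial>lborel) = 1"
    using nn_integral_eq_integral[OF i] exp_tail_bounds nn_integral_exp_tail by simp
  then show "(\<integral>x. exp_tail (x + c) \<partial>lborel) = 1"
    by (metis ennreal_eq_1)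
qed

lemma fejer_concentration:
  assumes "\<eta> > 0"
  obtains R where "R > 0" "measure fejer_law {-R..R} > 1 - \<eta>"
proof -
  interpret K: real_distribution fejer_law by (rule real_distribution_fejer)
  have "(\<lambda>n. measure fejer_law {- real n..real n}) \<longlonglongrightarrow> measure fejer_law (\<Union>n. {- real n..real n})"
    by (rule K.finite_Lim_measure_incseq) (auto simp: incseq_def)
  also have "(\<Union>n. {- real n..real n}) = (UNIV :: real set)"
  proof (intro equalityI subsetI UNIV_I)
    fix x :: real
    obtain n :: nat where "\<bar>x\<bar> \<le> real n" using real_arch_simple by blast
    then show "x \<in> (\<Union>n. {- real n..real n})" by (auto intro!: exI[of _ n])
  qed
  also have "measure fejer_law UNIV = 1" using K.prob_space by simp
  finally have "\<forall>\<^sub>F n in sequentially. measure fejer_law {- real n..real n} > 1 - \<eta>"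
    using assms by (intro order_tendstoD) auto
  then have "\<forall>\<^sub>F n in sequentially. measure fejer_law {- real n..real n} > 1 - \<eta> \<and> n > 0"
    using eventually_gt_at_top[of 0] by eventually_elim simp
  then obtain n where "measure fejer_law {- real n..real n} > 1 - \<eta>" "n > 0"
    using eventually_happens' trivial_limit_sequentially by blast
  then show thesis by (intro that[of "real n"]) auto
qed

section \<open>A local limit theorem on the scale one\<close>

text \<open>
The laws \<open>\<mu> n\<close> resemble normal laws of standard deviation \<open>r n\<close>, and their mass near the origin is
wanted on the scale 1. The distance of the characteristic functions is therefore measured relative to
the Gaussian one, which is tiny except on a window of width \<open>1 / r n\<close>: an absolute error bound would
not survive multiplication by \<open>r n\<close>.
\<close>

locale local_scale =
  fixes \<mu> :: "nat \<Rightarrow> real measure" and r :: "nat \<Rightarrow> real"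
  assumes distr: "\<And>n. real_distribution (\<mu> n)"
    and r_pos: "\<And>n. r n > 0" and r_lim: "filterlim r at_top sequentially"
    and char_close: "\<And>B \<epsilon>. B > 0 \<Longrightarrow> \<epsilon> > 0 \<Longrightarrow> \<forall>\<^sub>F n in sequentially. \<forall>v. \<bar>v\<bar> \<le> B \<longrightarrow>
       norm (char (\<mu> n) v - of_real (exp (- ((r n)\<^sup>2 * v\<^sup>2 / 2)))) \<le> \<epsilon> * exp (- ((r n)\<^sup>2 * v\<^sup>2 / 2))"
begin

text \<open>The density at \<open>c\<close> of the convolution of \<open>\<mu> n\<close> with the Fejer law of width \<open>1 / A\<close>, multiplied by the
spread \<open>r n\<close>.\<close>

definition smoothed :: "real \<Rightarrow> nat \<Rightarrow> real \<Rightarrow> real" where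
  "smoothed A n c = r n * (A / fejer_mass) * (\<integral>x. fejer (A * (x - c)) \<partial>\<mu> n)"

text \<open>Parseval: as the kernel is the Fourier transform of a function supported in \<open>{-1..1}\<close>, its integral
against a law depends only on the characteristic function on \<open>{-A..A}\<close>.\<close>

lemma integral_fejer_char:
  "(\<integral>x. fejer (A * (x - c)) \<partial>\<mu> n)
   = (\<integral>v. triangle v * Re (exp (- \<i> * of_real (v * A * c)) * char (\<mu> n) (v * A)) \<partial>lborel)"
proof -
  interpret M: real_distribution "\<mu> n" by (rule distr)
  interpret P: pair_sigma_finite lborel "\<mu> n" ..
  let ?f = "\<lambda>v x. triangle v * cos (v * (A * (x - c)))"
  have int: "integrable (lborel \<Otimes>\<^sub>M \<mu> n) (case_prod ?f)"
  proof (rule P.Fubini_integrable)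
    show "case_prod ?f \<in> borel_measurable (lborel \<Otimes>\<^sub>M \<mu> n)" by measurable
    have i: "integrable (\<mu> n) (?f v)" for v
      by (rule M.integrable_const_bound[where B = 1])
         (use triangle_bounds in \<open>auto simp: abs_mult intro!: mult_le_one\<close>)
    then show "AE v in lborel. integrable (\<mu> n) (\<lambda>x. case_prod ?f (v, x))" by simp
    show "integrable lborel (\<lambda>v. \<integral>x. norm (case_prod ?f (v, x)) \<partial>\<mu> n)"
    proof (rule Bochner_Integration.integrable_bound[OF integrable_triangle])
      show "AE v in lborel. norm (\<integral>x. norm (case_prod ?f (v, x)) \<partial>\<mu> n) \<le> norm (triangle v)"
      proof (intro AE_I2)
        fix v
        have "(\<integral>x. norm (?f v x) \<partial>\<mu> n) \<le> (\<integral>x. triangle v \<partial>\<mu> n)"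
          using triangle_bounds(1) by (intro integral_mono integrable_norm i) (auto simp: abs_mult intro!: mult_left_le)
        moreover have "(\<integral>x. norm (?f v x) \<partial>\<mu> n) \<ge> 0" by simp
        ultimately show "norm (\<integral>x. norm (case_prod ?f (v, x)) \<partial>\<mu> n) \<le> norm (triangle v)"
          using M.prob_space triangle_bounds(1) by simp
      qed
    qed measurable
  qed
  have "(\<integral>x. fejer (A * (x - c)) \<partial>\<mu> n) = (\<integral>x. (\<integral>v. ?f v x \<partial>lborel) \<partial>\<mu> n)"
    by (simp add: fejer_def)
  also have "\<dots> = (\<integral>v. (\<integral>x. ?f v x \<partial>\<mu> n) \<partial>lborel)"
    by (rule P.Fubini_integral[OF int])
  also have "\<dots> = (\<integral>v. triangle v * Re (exp (- \<i> * of_real (v * A * c)) * char (\<mu> n) (v * A)) \<partial>lborel)"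
  proof (rule Bochner_Integration.integral_cong[OF refl])
    fix v
    have "(\<integral>x. ?f v x \<partial>\<mu> n) = triangle v * (\<integral>x. cos (v * (A * (x - c))) \<partial>\<mu> n)" by simp
    also have "(\<integral>x. cos (v * (A * (x - c))) \<partial>\<mu> n) = (\<integral>x. Re (exp (- \<i> * of_real (v * A * c)) * iexp ((v * A) * x)) \<partial>\<mu> n)"
    proof (rule Bochner_Integration.integral_cong[OF refl])
      fix x
      have "exp (- \<i> * of_real (v * A * c)) * iexp ((v * A) * x) = iexp (v * (A * (x - c)))"
        by (simp add: algebra_simps flip: exp_add)
      then show "cos (v * (A * (x - c))) = Re (exp (- \<i> * of_real (v * A * c)) * iexp ((v * A) * x))"
        by (simp only: Re_exp) (simp add: Re_exp)
    qed
    also have "\<dots> = Re (\<integral>x. exp (- \<i> * of_real (v * A * c)) * iexp ((v * A) * x) \<partial>\<mu> n)"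
      by (rule integral_Re) (auto intro!: integrable_mult_right M.integrable_iexp)
    also have "\<dots> = Re (exp (- \<i> * of_real (v * A * c)) * char (\<mu> n) (v * A))"
      by (simp add: char_def)
    finally show "(\<integral>x. ?f v x \<partial>\<mu> n) = triangle v * Re (exp (- \<i> * of_real (v * A * c)) * char (\<mu> n) (v * A))" .
  qed
  finally show ?thesis .
qed

lemma smoothed_nonneg: "A > 0 \<Longrightarrow> smoothed A n c \<ge> 0"
  unfolding smoothed_def using r_pos[of n] fejer_mass_pos fejer_nonneg
  by (intro mult_nonneg_nonneg integral_nonneg_AE) auto

text \<open>After multiplication by \<open>r n\<close>, a relative error \<open>\<epsilon>\<close> in the characteristic function costs at most
\<open>\<epsilon>\<close> times the mass of the Gaussian, which stays bounded. The bound is uniform in the position \<open>c\<close>; this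
is needed to handle the heavy tails of the kernel.\<close>

lemma smoothed_close:
  assumes A: "A > 0" and \<epsilon>: "\<epsilon> > 0"
  shows "\<forall>\<^sub>F n in sequentially. \<forall>c. \<bar>smoothed A n c
     - tail_limit * (\<integral>w. triangle (w / (r n * A)) * cos (w / (r n * A) * A * c) * std_normal_density w \<partial>lborel)\<bar> \<le> tail_limit * \<epsilon>"
  using char_close[OF A \<epsilon>]
proof eventually_elim
  case (elim n)
  show ?case
  proof
    fix c
    interpret M: real_distribution "\<mu> n" by (rule distr)
    let ?e = "\<lambda>v. exp (- ((r n * A)\<^sup>2 * v\<^sup>2 / 2))"
    let ?\<phi> = "\<lambda>v. exp (- \<i> * of_real (v * A * c)) * char (\<mu> n) (v * A)"
    have rA: "r n * A > 0" using r_pos[of n] A by simp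
    have e: "exp (- ((r n)\<^sup>2 * (v * A)\<^sup>2 / 2)) = ?e v" for v by (simp add: power_mult_distrib mult_ac)
    have [measurable]: "char (\<mu> n) \<in> borel_measurable borel"
      using M.isCont_char by (intro borel_measurable_continuous_onI) (auto intro: continuous_at_imp_continuous_on)
    have \<phi>1: "\<bar>Re (?\<phi> v)\<bar> \<le> 1" for v
    proof -
      have "norm (?\<phi> v) \<le> 1" using M.cmod_char_le_1[of "v * A"] by (simp add: norm_mult)
      then show ?thesis using abs_Re_le_cmod[of "?\<phi> v"] by linarith
    qed
    have i1: "integrable lborel (\<lambda>v. triangle v * Re (?\<phi> v))"
      by (rule integrable_triangle_mult[OF _ \<phi>1]) measurable
    have i2: "integrable lborel (\<lambda>v. triangle v * (cos (v * A * c) * ?e v))"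
      by (rule integrable_triangle_mult) (auto simp: abs_mult intro!: mult_le_one)
    have i3: "integrable lborel (\<lambda>v. triangle v * ?e v)"
      by (rule integrable_triangle_mult) auto
    have pt: "\<bar>triangle v * Re (?\<phi> v) - triangle v * (cos (v * A * c) * ?e v)\<bar> \<le> \<epsilon> * (triangle v * ?e v)" for v
    proof (cases "\<bar>v\<bar> \<le> 1")
      case True
      then have "\<bar>v * A\<bar> \<le> A" using A by (simp add: abs_mult)
      then have b: "norm (char (\<mu> n) (v * A) - of_real (?e v)) \<le> \<epsilon> * ?e v"
        using elim e by metis
      have "\<bar>Re (?\<phi> v) - cos (v * A * c) * ?e v\<bar> = \<bar>Re (exp (- \<i> * of_real (v * A * c)) * (char (\<mu> n) (v * A) - of_real (?e v)))\<bar>"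
        by (simp add: Re_exp Im_exp algebra_simps)
      also have "\<dots> \<le> norm (exp (- \<i> * of_real (v * A * c)) * (char (\<mu> n) (v * A) - of_real (?e v)))"
        by (rule abs_Re_le_cmod)
      also have "\<dots> \<le> \<epsilon> * ?e v" using b by (simp add: norm_mult)
      finally have "triangle v * \<bar>Re (?\<phi> v) - cos (v * A * c) * ?e v\<bar> \<le> triangle v * (\<epsilon> * ?e v)"
        using triangle_bounds(1) by (intro mult_left_mono)
      then show ?thesis using triangle_bounds(1)[of v] by (simp add: abs_mult mult_ac flip: right_diff_distrib)
    next
      case False
      then show ?thesis by (simp add: triangle_zero)
    qed
    have "\<bar>(\<integral>v. triangle v * Re (?\<phi> v) \<partial>lborel) - (\<integral>v. triangle v * (cos (v * A * c) * ?e v) \<partial>lborel)\<bar>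
        \<le> (\<integral>v. \<bar>triangle v * Re (?\<phi> v) - triangle v * (cos (v * A * c) * ?e v)\<bar> \<partial>lborel)"
      unfolding Bochner_Integration.integral_diff[OF i1 i2, symmetric] by (rule integral_abs_bound)
    also have "\<dots> \<le> (\<integral>v. \<epsilon> * (triangle v * ?e v) \<partial>lborel)"
      using i1 i2 i3 by (intro integral_mono pt) auto
    also have "\<dots> = \<epsilon> * (\<integral>v. triangle v * ?e v \<partial>lborel)" by simp
    finally have "(r n * A) * \<bar>(\<integral>v. triangle v * Re (?\<phi> v) \<partial>lborel) - (\<integral>v. triangle v * (cos (v * A * c) * ?e v) \<partial>lborel)\<bar>
       \<le> (r n * A) * (\<epsilon> * (\<integral>v. triangle v * ?e v \<partial>lborel))"
      using rA by (intro mult_left_mono) auto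
    also have "\<dots> = \<epsilon> * ((r n * A) * (\<integral>v. triangle v * ?e v \<partial>lborel))" by simp
    also have "(r n * A) * (\<integral>v. triangle v * ?e v \<partial>lborel) = sqrt (2 * pi) * (\<integral>w. triangle (w / (r n * A)) * std_normal_density w \<partial>lborel)"
      by (rule gaussian_rescale[OF rA])
    also have "(\<integral>w. triangle (w / (r n * A)) * std_normal_density w \<partial>lborel) \<le> (\<integral>w. std_normal_density w \<partial>lborel)"
    proof (rule integral_mono)
      show "integrable lborel (\<lambda>w. triangle (w / (r n * A)) * std_normal_density w)"
        by (rule Bochner_Integration.integrable_bound[OF integrable_normal_density[OF zero_less_one, of 0]])
           (use triangle_bounds in \<open>auto simp: abs_mult intro!: mult_left_le_one_le\<close>)
    qed (use triangle_bounds in \<open>auto intro!: mult_left_le_one_le\<close>)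
    also have "(\<integral>w. std_normal_density w \<partial>lborel) = 1" by simp
    finally have b: "(r n * A) * \<bar>(\<integral>v. triangle v * Re (?\<phi> v) \<partial>lborel) - (\<integral>v. triangle v * (cos (v * A * c) * ?e v) \<partial>lborel)\<bar>
       \<le> \<epsilon> * (sqrt (2 * pi) * 1)"
      using \<epsilon> by (simp add: mult_left_mono)
    have s: "smoothed A n c = (r n * A) / fejer_mass * (\<integral>v. triangle v * Re (?\<phi> v) \<partial>lborel)"
      by (simp add: smoothed_def integral_fejer_char)
    have g: "(r n * A) / fejer_mass * (\<integral>v. triangle v * (cos (v * A * c) * ?e v) \<partial>lborel)
       = tail_limit * (\<integral>w. triangle (w / (r n * A)) * cos (w / (r n * A) * A * c) * std_normal_density w \<partial>lborel)"
      using gaussian_rescale[OF rA, of "\<lambda>v. triangle v * cos (v * A * c)"] by (simp add: tail_limit_def mult.assoc)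
    have "\<bar>smoothed A n c - tail_limit * (\<integral>w. triangle (w / (r n * A)) * cos (w / (r n * A) * A * c) * std_normal_density w \<partial>lborel)\<bar>
      = (r n * A) * \<bar>(\<integral>v. triangle v * Re (?\<phi> v) \<partial>lborel) - (\<integral>v. triangle v * (cos (v * A * c) * ?e v) \<partial>lborel)\<bar> / fejer_mass"
      unfolding s g[symmetric] right_diff_distrib[symmetric] abs_mult using rA fejer_mass_pos by simp
    also have "\<dots> \<le> \<epsilon> * (sqrt (2 * pi) * 1) / fejer_mass"
      using b fejer_mass_pos by (intro divide_right_mono) auto
    finally show "\<bar>smoothed A n c - tail_limit * (\<integral>w. triangle (w / (r n * A)) * cos (w / (r n * A) * A * c) * std_normal_density w \<partial>lborel)\<bar> \<le> tail_limit * \<epsilon>"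
      by (simp add: tail_limit_def mult_ac)
  qed
qed

lemma gaussian_part_le:
  "\<bar>\<integral>w. triangle (w / R) * cos (w / R * A * c) * std_normal_density w \<partial>lborel\<bar> \<le> 1"
proof -
  have b: "\<bar>triangle (w / R) * cos (w / R * A * c)\<bar> \<le> 1" for w
    using triangle_bounds by (auto simp: abs_mult intro!: mult_le_one)
  let ?F = "\<lambda>w. triangle (w / R) * cos (w / R * A * c) * std_normal_density w"
  have le: "\<bar>?F w\<bar> \<le> std_normal_density w" for w
    using mult_right_mono[OF b[of w], of "std_normal_density w"] by (simp add: abs_mult)
  have "integrable lborel ?F"
    by (rule Bochner_Integration.integrable_bound[OF integrable_normal_density[OF zero_less_one, of 0]])
       (use le in auto)
  then have "(\<integral>w. \<bar>?F w\<bar> \<partial>lborel) \<le> (\<integral>w. std_normal_density w \<partial>lborel)"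
    by (intro integral_mono le) auto
  from order_trans[OF integral_abs_bound this] show ?thesis by simp
qed

lemma gaussian_part_tendsto:
  assumes "A > 0"
  shows "(\<lambda>n. \<integral>w. triangle (w / (r n * A)) * cos (w / (r n * A) * A * c) * std_normal_density w \<partial>lborel) \<longlonglongrightarrow> 1"
proof -
  have lim: "(\<lambda>n. w / (r n * A)) \<longlonglongrightarrow> 0" for w
  proof -
    have "filterlim (\<lambda>n. A * r n) at_top sequentially"
      using assms by (intro filterlim_tendsto_pos_mult_at_top[OF tendsto_const _ r_lim])
    then show ?thesis by (intro real_tendsto_divide_at_top[OF tendsto_const]) (simp add: mult.commute)
  qed
  have "(\<lambda>n. \<integral>w. triangle (w / (r n * A)) * cos (w / (r n * A) * A * c) * std_normal_density w \<partial>lborel)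
     \<longlonglongrightarrow> (\<integral>w. std_normal_density w \<partial>lborel)"
  proof (rule integral_dominated_convergence[where w = std_normal_density])
    show "AE w in lborel. (\<lambda>n. triangle (w / (r n * A)) * cos (w / (r n * A) * A * c) * std_normal_density w) \<longlonglongrightarrow> std_normal_density w"
    proof (intro AE_I2)
      fix w
      have "(\<lambda>n. max 0 (1 - \<bar>w / (r n * A)\<bar>) * cos (w / (r n * A) * A * c) * std_normal_density w)
         \<longlonglongrightarrow> max 0 (1 - \<bar>0\<bar>) * cos (0 * A * c) * std_normal_density w"
        by (intro tendsto_intros lim)
      then show "(\<lambda>n. triangle (w / (r n * A)) * cos (w / (r n * A) * A * c) * std_normal_density w) \<longlonglongrightarrow> std_normal_density w"
        by (simp add: triangle_def)
    qed
    show "AE w in lborel. norm (triangle (w / (r n * A)) * cos (w / (r n * A) * A * c) * std_normal_density w) \<le> std_normal_density w" for n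
      using triangle_bounds by (intro AE_I2) (auto simp: abs_mult intro!: mult_left_le_one_le mult_le_one)
  qed auto
  then show ?thesis by simp
qed

lemma smoothed_tendsto:
  assumes A: "A > 0"
  shows "(\<lambda>n. smoothed A n c) \<longlonglongrightarrow> tail_limit"
proof -
  let ?g = "\<lambda>n. tail_limit * (\<integral>w. triangle (w / (r n * A)) * cos (w / (r n * A) * A * c) * std_normal_density w \<partial>lborel)"
  have "(\<lambda>n. smoothed A n c - ?g n) \<longlonglongrightarrow> 0"
  proof (rule LIMSEQ_I)
    fix e :: real assume e: "e > 0"
    have "e / (2 * tail_limit) > 0" using e tail_limit_pos by simp
    from smoothed_close[OF A this]
    obtain N where N: "\<And>n. n \<ge> N \<Longrightarrow> \<bar>smoothed A n c - ?g n\<bar> \<le> tail_limit * (e / (2 * tail_limit))"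
      unfolding eventually_sequentially by blast
    have "tail_limit * (e / (2 * tail_limit)) < e" using tail_limit_pos e by simp
    then show "\<exists>N. \<forall>n\<ge>N. norm (smoothed A n c - ?g n - 0) < e"
      using N by (intro exI[of _ N]) (auto intro: le_less_trans)
  qed
  moreover have "?g \<longlonglongrightarrow> tail_limit * 1" by (intro tendsto_mult tendsto_const gaussian_part_tendsto A)
  ultimately have "(\<lambda>n. smoothed A n c - ?g n + ?g n) \<longlonglongrightarrow> 0 + tail_limit * 1" by (rule tendsto_add)
  then show ?thesis by simp
qed

lemma smoothed_bounded:
  assumes A: "A > 0"
  shows "\<forall>\<^sub>F n in sequentially. \<forall>c. smoothed A n c \<le> 2 * tail_limit"
  using smoothed_close[OF A zero_less_one]
proof eventually_elim
  case (elim n)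
  show ?case
  proof
    fix c
    let ?g = "\<integral>w. triangle (w / (r n * A)) * cos (w / (r n * A) * A * c) * std_normal_density w \<partial>lborel"
    have "tail_limit * ?g \<le> tail_limit * 1"
      using gaussian_part_le[of "r n * A" A c] tail_limit_pos by (intro mult_left_mono) auto
    moreover have "\<bar>smoothed A n c - tail_limit * ?g\<bar> \<le> tail_limit * 1" using elim by blast
    ultimately show "smoothed A n c \<le> 2 * tail_limit" by linarith
  qed
qed

text \<open>The integral of \<open>g\<close> against the smoothed law. It takes values in \<open>ennreal\<close>, so that the order of
integration can be exchanged freely.\<close>

definition blur :: "real \<Rightarrow> nat \<Rightarrow> (real \<Rightarrow> real) \<Rightarrow> ennreal" where
  "blur A n g = (\<integral>\<^sup>+x. \<integral>\<^sup>+t. ennreal (g (x - t / A)) \<partial>fejer_law \<partial>\<mu> n)"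

lemma blur_eq:
  assumes A: "A > 0" and [measurable]: "g \<in> borel_measurable borel" and g0: "\<And>x. g x \<ge> 0"
  shows "ennreal (r n) * blur A n g = (\<integral>\<^sup>+c. ennreal (g c * smoothed A n c) \<partial>lborel)"
proof -
  interpret M: real_distribution "\<mu> n" by (rule distr)
  interpret P: pair_sigma_finite lborel "\<mu> n" ..
  have inner: "(\<integral>\<^sup>+t. ennreal (g (x - t / A)) \<partial>fejer_law)
      = (\<integral>\<^sup>+c. ennreal (g c * (A / fejer_mass) * fejer (A * (x - c))) \<partial>lborel)" for x
  proof -
    have "(\<integral>\<^sup>+t. ennreal (g (x - t / A)) \<partial>fejer_law)
      = (\<integral>\<^sup>+t. ennreal (fejer t / fejer_mass) * ennreal (g (x - t / A)) \<partial>lborel)"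
      unfolding fejer_law_def by (intro nn_integral_density) auto
    also have "\<dots> = ennreal \<bar>- A\<bar> * (\<integral>\<^sup>+c. ennreal (fejer (A * x + - A * c) / fejer_mass) * ennreal (g (x - (A * x + - A * c) / A)) \<partial>lborel)"
      using A by (intro nn_integral_real_affine) auto
    also have "\<dots> = (\<integral>\<^sup>+c. ennreal (g c * (A / fejer_mass) * fejer (A * (x - c))) \<partial>lborel)"
    proof (subst nn_integral_cmult[symmetric])
      show "(\<integral>\<^sup>+c. ennreal \<bar>- A\<bar> * (ennreal (fejer (A * x + - A * c) / fejer_mass) * ennreal (g (x - (A * x + - A * c) / A))) \<partial>lborel)
        = (\<integral>\<^sup>+c. ennreal (g c * (A / fejer_mass) * fejer (A * (x - c))) \<partial>lborel)"
      proof (intro nn_integral_cong)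
        fix c
        have e1: "A * x + - A * c = A * (x - c)" by (simp add: algebra_simps)
        have e2: "x - A * (x - c) / A = c" using A by simp
        show "ennreal \<bar>- A\<bar> * (ennreal (fejer (A * x + - A * c) / fejer_mass) * ennreal (g (x - (A * x + - A * c) / A)))
          = ennreal (g c * (A / fejer_mass) * fejer (A * (x - c)))"
          unfolding e1 e2 using A g0[of c] fejer_nonneg[of "A * (x - c)"] fejer_mass_pos
          by (simp add: ennreal_mult[symmetric] mult_ac)
      qed
    qed auto
    finally show ?thesis .
  qed
  have "blur A n g = (\<integral>\<^sup>+x. \<integral>\<^sup>+c. ennreal (g c * (A / fejer_mass) * fejer (A * (x - c))) \<partial>lborel \<partial>\<mu> n)"
    unfolding blur_def inner ..
  also have "\<dots> = (\<integral>\<^sup>+c. \<integral>\<^sup>+x. ennreal (g c * (A / fejer_mass) * fejer (A * (x - c))) \<partial>\<mu> n \<partial>lborel)"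
    by (rule P.Fubini') measurable
  also have "ennreal (r n) * \<dots> = (\<integral>\<^sup>+c. ennreal (r n) * (\<integral>\<^sup>+x. ennreal (g c * (A / fejer_mass) * fejer (A * (x - c))) \<partial>\<mu> n) \<partial>lborel)"
    by (rule nn_integral_cmult[symmetric]) measurable
  also have "\<dots> = (\<integral>\<^sup>+c. ennreal (g c * smoothed A n c) \<partial>lborel)"
  proof (intro nn_integral_cong)
    fix c
    have int: "integrable (\<mu> n) (\<lambda>x. fejer (A * (x - c)))"
      by (rule M.integrable_const_bound[where B = 1]) (use fejer_nonneg fejer_le_1 in auto)
    have "(\<integral>\<^sup>+x. ennreal (g c * (A / fejer_mass) * fejer (A * (x - c))) \<partial>\<mu> n)
       = ennreal (\<integral>x. g c * (A / fejer_mass) * fejer (A * (x - c)) \<partial>\<mu> n)"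
      using int A fejer_mass_pos g0[of c] fejer_nonneg
      by (intro nn_integral_eq_integral integrable_mult_right) auto
    also have "ennreal (r n) * \<dots> = ennreal (r n * (\<integral>x. g c * (A / fejer_mass) * fejer (A * (x - c)) \<partial>\<mu> n))"
      using r_pos[of n] by (simp add: ennreal_mult'[symmetric])
    also have "r n * (\<integral>x. g c * (A / fejer_mass) * fejer (A * (x - c)) \<partial>\<mu> n) = g c * smoothed A n c"
      by (simp add: smoothed_def)
    finally show "ennreal (r n) * (\<integral>\<^sup>+x. ennreal (g c * (A / fejer_mass) * fejer (A * (x - c))) \<partial>\<mu> n)
      = ennreal (g c * smoothed A n c)" .
  qed
  finally show ?thesis .
qed

lemma smoothed_measurable [measurable]: "smoothed A n \<in> borel_measurable borel"
proof -
  interpret M: real_distribution "\<mu> n" by (rule distr)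
  show ?thesis unfolding smoothed_def[abs_def] by measurable
qed

lemma blur_le:
  assumes A: "A > 0"
  shows "\<forall>\<^sub>F n in sequentially. \<forall>g. g \<in> borel_measurable borel \<longrightarrow> (\<forall>x. g x \<ge> 0) \<longrightarrow>
     ennreal (r n) * blur A n g \<le> ennreal (2 * tail_limit) * (\<integral>\<^sup>+x. ennreal (g x) \<partial>lborel)"
  using smoothed_bounded[OF A]
proof eventually_elim
  case (elim n)
  show ?case
  proof (intro allI impI)
    fix g :: "real \<Rightarrow> real" assume g: "g \<in> borel_measurable borel" "\<forall>x. g x \<ge> 0"
    note [measurable] = g(1)
    have "ennreal (r n) * blur A n g \<le> (\<integral>\<^sup>+c. ennreal (2 * tail_limit) * ennreal (g c) \<partial>lborel)"
    proof (subst blur_eq[OF A])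
      show "(\<integral>\<^sup>+c. ennreal (g c * smoothed A n c) \<partial>lborel) \<le> (\<integral>\<^sup>+c. ennreal (2 * tail_limit) * ennreal (g c) \<partial>lborel)"
        using elim g tail_limit_pos
        by (intro nn_integral_mono) (auto simp: ennreal_mult[symmetric] mult.commute intro!: ennreal_leI mult_left_mono)
    qed (use g in auto)
    also have "\<dots> = ennreal (2 * tail_limit) * (\<integral>\<^sup>+x. ennreal (g x) \<partial>lborel)"
      by (rule nn_integral_cmult) measurable
    finally show "ennreal (r n) * blur A n g \<le> ennreal (2 * tail_limit) * (\<integral>\<^sup>+x. ennreal (g x) \<partial>lborel)" .
  qed
qed

lemma blur_tendsto:
  assumes A: "A > 0" and g: "integrable lborel g" "\<And>x. g x \<ge> 0"
  shows "(\<lambda>n. ennreal (r n) * blur A n g) \<longlonglongrightarrow> ennreal (tail_limit * (\<integral>x. g x \<partial>lborel))"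
proof -
  have [measurable]: "g \<in> borel_measurable borel" using borel_measurable_integrable[OF g(1)] by simp
  obtain N where N: "\<And>n c. n \<ge> N \<Longrightarrow> smoothed A n c \<le> 2 * tail_limit"
    using smoothed_bounded[OF A] unfolding eventually_sequentially by blast
  have bound: "norm (g c * smoothed A (n + N) c) \<le> g c * (2 * tail_limit)" for n c
    using N[of "n + N" c] g(2)[of c] smoothed_nonneg[OF A] by (auto simp: abs_mult intro!: mult_left_mono)
  have int: "integrable lborel (\<lambda>c. g c * (2 * tail_limit))" using g(1) by simp
  have "(\<lambda>n. \<integral>c. g c * smoothed A (n + N) c \<partial>lborel) \<longlonglongrightarrow> (\<integral>c. g c * tail_limit \<partial>lborel)"
  proof (rule integral_dominated_convergence[OF _ _ int])
    show "AE c in lborel. (\<lambda>n. g c * smoothed A (n + N) c) \<longlonglongrightarrow> g c * tail_limit"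
      by (intro AE_I2 tendsto_mult tendsto_const LIMSEQ_ignore_initial_segment smoothed_tendsto A)
  qed (use bound in auto)
  then have "(\<lambda>n. ennreal (\<integral>c. g c * smoothed A (n + N) c \<partial>lborel)) \<longlonglongrightarrow> ennreal (\<integral>c. g c * tail_limit \<partial>lborel)"
    by (rule tendsto_ennrealI)
  moreover have "ennreal (\<integral>c. g c * smoothed A (n + N) c \<partial>lborel) = ennreal (r (n + N)) * blur A (n + N) g" for n
  proof -
    have "integrable lborel (\<lambda>c. g c * smoothed A (n + N) c)"
      by (rule Bochner_Integration.integrable_bound[OF int]) (use bound g(2) tail_limit_pos in \<open>auto intro: order_trans\<close>)
    then show ?thesis using blur_eq[OF A _ g(2)] g(2) smoothed_nonneg[OF A]
      by (subst nn_integral_eq_integral[symmetric]) auto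
  qed
  ultimately have "(\<lambda>n. ennreal (r (n + N)) * blur A (n + N) g) \<longlonglongrightarrow> ennreal (\<integral>c. g c * tail_limit \<partial>lborel)" by simp
  then have "(\<lambda>n. ennreal (r n) * blur A n g) \<longlonglongrightarrow> ennreal (\<integral>c. g c * tail_limit \<partial>lborel)"
    by (rule LIMSEQ_offset)
  then show ?thesis by (simp add: mult.commute)
qed

definition tail_mean :: "nat \<Rightarrow> real \<Rightarrow> ennreal" where
  "tail_mean n c = (\<integral>\<^sup>+x. ennreal (exp_tail (x - c)) \<partial>\<mu> n)"

text \<open>Unsmoothing from above. The test function jumps at \<open>c\<close> and then decreases by a factor of at most
\<open>exp (2 * h)\<close> over a distance of \<open>2 * h\<close>. So it is dominated, up to this factor, by its blurred copy whose jump has been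
moved to the left by \<open>h\<close>, provided that the kernel variable stays in \<open>{- A * h..A * h}\<close>.\<close>

lemma tail_mean_upper:
  assumes A: "A > 0" and h: "h \<ge> 0"
  shows "ennreal (measure fejer_law {-(A * h)..A * h}) * tail_mean n c
     \<le> ennreal (exp (2 * h)) * blur A n (\<lambda>x. exp_tail (x + (h - c)))"
proof -
  interpret M: real_distribution "\<mu> n" by (rule distr)
  interpret K: real_distribution fejer_law by (rule real_distribution_fejer)
  let ?J = "{-(A * h)..A * h}"
  have "ennreal (measure fejer_law ?J) * ennreal (exp_tail (x - c))
      \<le> ennreal (exp (2 * h)) * (\<integral>\<^sup>+t. ennreal (exp_tail (x - t / A + (h - c))) \<partial>fejer_law)" for x
  proof -
    have "ennreal (measure fejer_law ?J) * ennreal (exp_tail (x - c))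
       = (\<integral>\<^sup>+t. ennreal (exp_tail (x - c)) * indicator ?J t \<partial>fejer_law)"
      by (subst nn_integral_cmult_indicator) (auto simp: K.emeasure_eq_measure mult.commute)
    also have "\<dots> \<le> (\<integral>\<^sup>+t. ennreal (exp (2 * h)) * ennreal (exp_tail (x - t / A + (h - c))) \<partial>fejer_law)"
    proof (intro nn_integral_mono)
      fix t
      show "ennreal (exp_tail (x - c)) * indicator ?J t \<le> ennreal (exp (2 * h)) * ennreal (exp_tail (x - t / A + (h - c)))"
      proof (cases "t \<in> ?J \<and> x - c \<ge> 0")
        case True
        then have t: "- h \<le> t / A" "t / A \<le> h" using A by (auto simp: field_simps)
        then have "x - t / A + (h - c) \<ge> 0" "- (x - c) \<le> 2 * h + - (x - t / A + (h - c))" using True by auto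
        then have "exp_tail (x - c) \<le> exp (2 * h) * exp_tail (x - t / A + (h - c))"
          using True by (simp add: exp_tail_def flip: exp_add)
        then show ?thesis using True exp_tail_bounds by (simp add: ennreal_leI flip: ennreal_mult)
      qed (auto simp: exp_tail_def)
    qed
    also have "\<dots> = ennreal (exp (2 * h)) * (\<integral>\<^sup>+t. ennreal (exp_tail (x - t / A + (h - c))) \<partial>fejer_law)"
      by (rule nn_integral_cmult) measurable
    finally show ?thesis .
  qed
  then have "(\<integral>\<^sup>+x. ennreal (measure fejer_law ?J) * ennreal (exp_tail (x - c)) \<partial>\<mu> n)
      \<le> (\<integral>\<^sup>+x. ennreal (exp (2 * h)) * (\<integral>\<^sup>+t. ennreal (exp_tail (x - t / A + (h - c))) \<partial>fejer_law) \<partial>\<mu> n)"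
    by (intro nn_integral_mono)
  also have "\<dots> = ennreal (exp (2 * h)) * blur A n (\<lambda>x. exp_tail (x + (h - c)))"
    unfolding blur_def by (rule nn_integral_cmult) measurable
  finally show ?thesis unfolding tail_mean_def by (subst (asm) nn_integral_cmult) auto
qed

text \<open>A bound uniform in \<open>c\<close>: it controls the part of the lower estimate in which the kernel variable is
large and the jump may be anywhere.\<close>

lemma tail_mean_bounded:
  assumes A: "A > 0" and h: "h \<ge> 0"
  shows "\<forall>\<^sub>F n in sequentially. \<forall>c. ennreal (measure fejer_law {-(A * h)..A * h}) * (ennreal (r n) * tail_mean n c)
     \<le> ennreal (exp (2 * h) * (2 * tail_limit))"
  using blur_le[OF A]
proof eventually_elim
  case (elim n)
  show ?case
  proof
    fix c
    have "ennreal (r n) * (ennreal (measure fejer_law {-(A * h)..A * h}) * tail_mean n c)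
       \<le> ennreal (r n) * (ennreal (exp (2 * h)) * blur A n (\<lambda>x. exp_tail (x + (h - c))))"
      by (intro mult_left_mono tail_mean_upper A h) simp
    also have "\<dots> = ennreal (exp (2 * h)) * (ennreal (r n) * blur A n (\<lambda>x. exp_tail (x + (h - c))))"
      by (simp add: mult_ac)
    also have "\<dots> \<le> ennreal (exp (2 * h)) * (ennreal (2 * tail_limit) * (\<integral>\<^sup>+x. ennreal (exp_tail (x + (h - c))) \<partial>lborel))"
      using elim exp_tail_bounds by (intro mult_left_mono) auto
    also have "\<dots> = ennreal (exp (2 * h) * (2 * tail_limit))"
      using tail_limit_pos by (simp add: nn_integral_exp_tail ennreal_mult)
    finally show "ennreal (measure fejer_law {-(A * h)..A * h}) * (ennreal (r n) * tail_mean n c)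
       \<le> ennreal (exp (2 * h) * (2 * tail_limit))" by (simp add: mult_ac)
  qed
qed

text \<open>Unsmoothing from below, with the jump moved to the right. Here the heavy tails of the kernel
contribute an error term, namely tail means at distant places.\<close>

lemma tail_mean_lower:
  assumes A: "A > 0" and h: "h \<ge> 0"
  shows "blur A n (\<lambda>x. exp_tail (x - h)) \<le> ennreal (exp (2 * h)) * tail_mean n 0
     + (\<integral>\<^sup>+t. tail_mean n (t / A + h) * indicator (- {-(A * h)..A * h}) t \<partial>fejer_law)"
proof -
  interpret M: real_distribution "\<mu> n" by (rule distr)
  interpret K: real_distribution fejer_law by (rule real_distribution_fejer)
  interpret P: pair_sigma_finite fejer_law "\<mu> n" ..
  let ?J = "{-(A * h)..A * h}"
  have "(\<integral>\<^sup>+t. ennreal (exp_tail (x - t / A - h)) \<partial>fejer_law)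
     \<le> ennreal (exp (2 * h)) * ennreal (exp_tail (x - 0)) + (\<integral>\<^sup>+t. ennreal (exp_tail (x - t / A - h)) * indicator (- ?J) t \<partial>fejer_law)" for x
  proof -
    have "(\<integral>\<^sup>+t. ennreal (exp_tail (x - t / A - h)) \<partial>fejer_law)
      \<le> (\<integral>\<^sup>+t. ennreal (exp (2 * h)) * ennreal (exp_tail (x - 0)) + ennreal (exp_tail (x - t / A - h)) * indicator (- ?J) t \<partial>fejer_law)"
    proof (intro nn_integral_mono)
      fix t
      show "ennreal (exp_tail (x - t / A - h))
        \<le> ennreal (exp (2 * h)) * ennreal (exp_tail (x - 0)) + ennreal (exp_tail (x - t / A - h)) * indicator (- ?J) t"
      proof (cases "t \<in> ?J \<and> x - t / A - h \<ge> 0")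
        case True
        then have t: "- h \<le> t / A" "t / A \<le> h" using A by (auto simp: field_simps)
        then have "x \<ge> 0" "- (x - t / A - h) \<le> 2 * h + - x" using True by auto
        then have "exp_tail (x - t / A - h) \<le> exp (2 * h) * exp_tail (x - 0)"
          using True by (simp add: exp_tail_def flip: exp_add)
        then show ?thesis using True exp_tail_bounds by (simp add: ennreal_leI flip: ennreal_mult)
      qed (auto simp: exp_tail_def)
    qed
    also have "\<dots> = (\<integral>\<^sup>+t. ennreal (exp (2 * h)) * ennreal (exp_tail (x - 0)) \<partial>fejer_law)
        + (\<integral>\<^sup>+t. ennreal (exp_tail (x - t / A - h)) * indicator (- ?J) t \<partial>fejer_law)"
      by (rule nn_integral_add) auto
    finally show ?thesis using K.emeasure_space_1 by (simp add: nn_integral_const)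
  qed
  then have "blur A n (\<lambda>x. exp_tail (x - h)) \<le> (\<integral>\<^sup>+x. ennreal (exp (2 * h)) * ennreal (exp_tail (x - 0))
      + (\<integral>\<^sup>+t. ennreal (exp_tail (x - t / A - h)) * indicator (- ?J) t \<partial>fejer_law) \<partial>\<mu> n)"
    unfolding blur_def by (intro nn_integral_mono)
  also have "\<dots> = (\<integral>\<^sup>+x. ennreal (exp (2 * h)) * ennreal (exp_tail (x - 0)) \<partial>\<mu> n)
      + (\<integral>\<^sup>+x. \<integral>\<^sup>+t. ennreal (exp_tail (x - t / A - h)) * indicator (- ?J) t \<partial>fejer_law \<partial>\<mu> n)"
    by (rule nn_integral_add) measurable
  also have "(\<integral>\<^sup>+x. ennreal (exp (2 * h)) * ennreal (exp_tail (x - 0)) \<partial>\<mu> n) = ennreal (exp (2 * h)) * tail_mean n 0"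
    unfolding tail_mean_def by (rule nn_integral_cmult) measurable
  also have "(\<integral>\<^sup>+x. \<integral>\<^sup>+t. ennreal (exp_tail (x - t / A - h)) * indicator (- ?J) t \<partial>fejer_law \<partial>\<mu> n)
      = (\<integral>\<^sup>+t. \<integral>\<^sup>+x. ennreal (exp_tail (x - t / A - h)) * indicator (- ?J) t \<partial>\<mu> n \<partial>fejer_law)"
    by (rule P.Fubini') measurable
  also have "\<dots> = (\<integral>\<^sup>+t. tail_mean n (t / A + h) * indicator (- ?J) t \<partial>fejer_law)"
    unfolding tail_mean_def by (intro nn_integral_cong) (simp add: nn_integral_multc diff_diff_eq)
  finally show ?thesis .
qed

lemma tail_mean_eq: "tail_mean n 0 = ennreal (\<integral>x. exp_tail x \<partial>\<mu> n)"
proof -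
  interpret M: real_distribution "\<mu> n" by (rule distr)
  have "integrable (\<mu> n) exp_tail"
    by (rule M.integrable_const_bound[where B = 1]) (auto simp: exp_tail_bounds)
  then show ?thesis
    unfolding tail_mean_def using exp_tail_bounds by (simp add: nn_integral_eq_integral)
qed

lemma scaled_tail_bounds:
  assumes \<eta>: "0 < \<eta>" "\<eta> < 1"
  shows "\<forall>\<^sub>F n in sequentially. r n * (\<integral>x. exp_tail x \<partial>\<mu> n) \<le> (1 + \<eta>) * (tail_limit + \<eta>) / (1 - \<eta>)"
    and "\<forall>\<^sub>F n in sequentially. (tail_limit - \<eta> - \<eta> * ((1 + \<eta>) * (2 * tail_limit) / (1 - \<eta>))) / (1 + \<eta>)
       \<le> r n * (\<integral>x. exp_tail x \<partial>\<mu> n)"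
proof -
  interpret K: real_distribution fejer_law by (rule real_distribution_fejer)
  \<comment> \<open>The shift \<open>h\<close> is chosen so that the factor \<open>exp (2 * h)\<close> equals \<open>1 + \<eta>\<close>, and then the width
    \<open>1 / A\<close> so that the kernel has mass at least \<open>1 - \<eta>\<close> within distance \<open>h\<close>.\<close>
  define h where "h = ln (1 + \<eta>) / 2"
  have h: "h > 0" "exp (2 * h) = 1 + \<eta>" using \<eta> by (auto simp: h_def)
  obtain R where R: "R > 0" "measure fejer_law {-R..R} > 1 - \<eta>" using fejer_concentration[OF \<eta>(1)] .
  define A where "A = R / h"
  have A: "A > 0" "A * h = R" using R h by (auto simp: A_def)
  define p where "p = measure fejer_law {-R..R}"
  have p: "1 - \<eta> < p" "p \<le> 1" "p > 0" using R \<eta> by (auto simp: p_def K.prob_le_1)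
  define F where "F n = r n * (\<integral>x. exp_tail x \<partial>\<mu> n)" for n
  have F0: "F n \<ge> 0" for n using r_pos[of n] exp_tail_bounds by (auto simp: F_def intro!: mult_nonneg_nonneg integral_nonneg_AE)
  have F_eq: "ennreal (r n) * tail_mean n 0 = ennreal (F n)" for n
    unfolding tail_mean_eq F_def using r_pos[of n] by (simp add: ennreal_mult'[symmetric])
  have lim: "(\<lambda>n. ennreal (r n) * blur A n (\<lambda>x. exp_tail (x + c))) \<longlonglongrightarrow> ennreal tail_limit" for c
    using blur_tendsto[OF A(1) integrable_exp_tail[of c]] exp_tail_bounds by (simp add: integral_exp_tail)
  have lev: "ennreal (tail_limit - \<eta>) < ennreal tail_limit" "ennreal tail_limit < ennreal (tail_limit + \<eta>)"
    using \<eta> tail_limit_pos by (auto simp: ennreal_lessI)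
  show "\<forall>\<^sub>F n in sequentially. r n * (\<integral>x. exp_tail x \<partial>\<mu> n) \<le> (1 + \<eta>) * (tail_limit + \<eta>) / (1 - \<eta>)"
    using order_tendstoD(2)[OF lim[of "h - 0"] lev(2)]
  proof eventually_elim
    case (elim n)
    have "ennreal (p * F n) = ennreal (r n) * (ennreal p * tail_mean n 0)"
      using p F0[of n] by (simp add: ennreal_mult F_eq[symmetric] mult_ac)
    also have "\<dots> \<le> ennreal (r n) * (ennreal (exp (2 * h)) * blur A n (\<lambda>x. exp_tail (x + (h - 0))))"
      using tail_mean_upper[OF A(1) less_imp_le[OF h(1)], of n 0]
      by (intro mult_left_mono) (auto simp: A(2) p_def)
    also have "\<dots> = ennreal (1 + \<eta>) * (ennreal (r n) * blur A n (\<lambda>x. exp_tail (x + (h - 0))))"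
      unfolding h(2) by (simp add: mult_ac)
    also have "\<dots> \<le> ennreal (1 + \<eta>) * ennreal (tail_limit + \<eta>)"
      using elim by (intro mult_left_mono) auto
    also have "\<dots> = ennreal ((1 + \<eta>) * (tail_limit + \<eta>))" using \<eta> tail_limit_pos by (simp add: ennreal_mult)
    finally have "p * F n \<le> (1 + \<eta>) * (tail_limit + \<eta>)" using \<eta> tail_limit_pos by (simp add: ennreal_le_iff)
    moreover have "(1 - \<eta>) * F n \<le> p * F n" using p F0[of n] by (intro mult_right_mono) auto
    ultimately show ?case unfolding F_def[symmetric] using \<eta> by (simp add: le_divide_eq mult.commute)
  qed
  show "\<forall>\<^sub>F n in sequentially. (tail_limit - \<eta> - \<eta> * ((1 + \<eta>) * (2 * tail_limit) / (1 - \<eta>))) / (1 + \<eta>)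
       \<le> r n * (\<integral>x. exp_tail x \<partial>\<mu> n)"
    using order_tendstoD(1)[OF lim[of "- h"] lev(1)] tail_mean_bounded[OF A(1) less_imp_le[OF h(1)]]
  proof eventually_elim
    case (elim n)
    define U where "U = (1 + \<eta>) * (2 * tail_limit) / p"
    have U0: "U \<ge> 0" "p * U = (1 + \<eta>) * (2 * tail_limit)" using \<eta> tail_limit_pos p by (simp_all add: U_def)
    have U_le: "ennreal (r n) * tail_mean n c \<le> ennreal U" for c
    proof -
      have "ennreal p * (ennreal (r n) * tail_mean n c) \<le> ennreal (p * U)"
        using elim(2) unfolding A(2) p_def[symmetric] h(2) U0(2) by blast
      also have "\<dots> = ennreal p * ennreal U" using p U0 by (intro ennreal_mult) auto
      finally show ?thesis using p by (subst (asm) ennreal_mult_le_mult_iff) auto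
    qed
    have rem: "ennreal (r n) * (\<integral>\<^sup>+t. tail_mean n (t / A + h) * indicator (- {-R..R}) t \<partial>fejer_law) \<le> ennreal (\<eta> * U)"
    proof -
      interpret M: real_distribution "\<mu> n" by (rule distr)
      have [measurable]: "(\<lambda>t. tail_mean n (t / A + h)) \<in> borel_measurable borel"
        unfolding tail_mean_def by measurable
      have "ennreal (r n) * (\<integral>\<^sup>+t. tail_mean n (t / A + h) * indicator (- {-R..R}) t \<partial>fejer_law)
         = (\<integral>\<^sup>+t. ennreal (r n) * (tail_mean n (t / A + h) * indicator (- {-R..R}) t) \<partial>fejer_law)"
        by (rule nn_integral_cmult[symmetric]) measurable
      also have "\<dots> \<le> (\<integral>\<^sup>+t. ennreal U * indicator (- {-R..R}) t \<partial>fejer_law)"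
        using U_le by (intro nn_integral_mono) (auto simp: indicator_def)
      also have "\<dots> = ennreal U * emeasure fejer_law (- {-R..R})"
        by (rule nn_integral_cmult_indicator) auto
      also have "emeasure fejer_law (- {-R..R}) = ennreal (1 - p)"
        using K.prob_compl[of "{-R..R}"] by (simp add: K.emeasure_eq_measure p_def Compl_eq_Diff_UNIV)
      also have "ennreal U * ennreal (1 - p) \<le> ennreal U * ennreal \<eta>"
        using p by (intro mult_left_mono ennreal_leI) auto
      also have "\<dots> = ennreal (\<eta> * U)" using \<eta> U0 by (subst ennreal_mult) (auto simp: mult.commute)
      finally show ?thesis .
    qed
    have "ennreal (tail_limit - \<eta>) \<le> ennreal (r n) * blur A n (\<lambda>x. exp_tail (x - h))"
      using elim(1) by simp
    also have "\<dots> \<le> ennreal (r n) * (ennreal (exp (2 * h)) * tail_mean n 0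
       + (\<integral>\<^sup>+t. tail_mean n (t / A + h) * indicator (- {-(A * h)..A * h}) t \<partial>fejer_law))"
      by (intro mult_left_mono tail_mean_lower A less_imp_le[OF h(1)]) simp
    also have "\<dots> = ennreal (1 + \<eta>) * (ennreal (r n) * tail_mean n 0)
       + ennreal (r n) * (\<integral>\<^sup>+t. tail_mean n (t / A + h) * indicator (- {-R..R}) t \<partial>fejer_law)"
      unfolding A(2) h(2) by (simp add: distrib_left mult_ac)
    also have "\<dots> \<le> ennreal (1 + \<eta>) * ennreal (F n) + ennreal (\<eta> * U)"
      unfolding F_eq by (intro add_left_mono rem)
    also have "\<dots> = ennreal ((1 + \<eta>) * F n + \<eta> * U)"
    proof -
      have "ennreal ((1 + \<eta>) * F n) = ennreal (1 + \<eta>) * ennreal (F n)"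
        using \<eta> F0[of n] by (intro ennreal_mult) auto
      then show ?thesis using \<eta> F0[of n] U0 by (subst ennreal_plus) auto
    qed
    finally have "tail_limit - \<eta> \<le> (1 + \<eta>) * F n + \<eta> * U"
      using \<eta> F0[of n] U0 by (subst (asm) ennreal_le_iff) (auto intro!: add_nonneg_nonneg mult_nonneg_nonneg)
    moreover have "U \<le> (1 + \<eta>) * (2 * tail_limit) / (1 - \<eta>)"
      unfolding U_def using \<eta> tail_limit_pos p by (intro divide_left_mono) auto
    then have "\<eta> * U \<le> \<eta> * ((1 + \<eta>) * (2 * tail_limit) / (1 - \<eta>))" using \<eta> by (intro mult_left_mono) auto
    ultimately have "tail_limit - \<eta> - \<eta> * ((1 + \<eta>) * (2 * tail_limit) / (1 - \<eta>)) \<le> F n * (1 + \<eta>)" by (simp add: mult.commute)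
    then show ?case unfolding F_def[symmetric] using \<eta> by (subst divide_le_eq) auto
  qed
qed

theorem scaled_tail_tendsto: "(\<lambda>n. r n * (\<integral>x. exp_tail x \<partial>\<mu> n)) \<longlonglongrightarrow> tail_limit"
proof (rule order_tendstoI)
  fix a assume a: "a < tail_limit"
  have "((\<lambda>\<eta>. (tail_limit - \<eta> - \<eta> * ((1 + \<eta>) * (2 * tail_limit) / (1 - \<eta>))) / (1 + \<eta>))
     \<longlongrightarrow> (tail_limit - 0 - 0 * ((1 + 0) * (2 * tail_limit) / (1 - 0))) / (1 + 0)) (at_right 0)"
    by (intro tendsto_intros) auto
  then have "\<forall>\<^sub>F \<eta> in at_right 0. (tail_limit - \<eta> - \<eta> * ((1 + \<eta>) * (2 * tail_limit) / (1 - \<eta>))) / (1 + \<eta>) > a"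
    using a by (intro order_tendstoD) auto
  then have "\<forall>\<^sub>F \<eta> in at_right 0. (tail_limit - \<eta> - \<eta> * ((1 + \<eta>) * (2 * tail_limit) / (1 - \<eta>))) / (1 + \<eta>) > a \<and> \<eta> \<in> {0<..<1}"
    using eventually_at_right_real[of 0 1, OF zero_less_one] by eventually_elim simp
  then obtain \<eta> where "(tail_limit - \<eta> - \<eta> * ((1 + \<eta>) * (2 * tail_limit) / (1 - \<eta>))) / (1 + \<eta>) > a" "0 < \<eta>" "\<eta> < 1"
    using eventually_happens'[OF trivial_limit_at_right_real] by auto
  then show "\<forall>\<^sub>F n in sequentially. a < r n * (\<integral>x. exp_tail x \<partial>\<mu> n)"
    using scaled_tail_bounds(2)[of \<eta>] by (auto elim!: eventually_mono)
next
  fix a assume a: "tail_limit < a"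
  have "((\<lambda>\<eta>. (1 + \<eta>) * (tail_limit + \<eta>) / (1 - \<eta>)) \<longlongrightarrow> (1 + 0) * (tail_limit + 0) / (1 - 0)) (at_right 0)"
    by (intro tendsto_intros) auto
  then have "\<forall>\<^sub>F \<eta> in at_right 0. (1 + \<eta>) * (tail_limit + \<eta>) / (1 - \<eta>) < a"
    using a by (intro order_tendstoD) auto
  then have "\<forall>\<^sub>F \<eta> in at_right 0. (1 + \<eta>) * (tail_limit + \<eta>) / (1 - \<eta>) < a \<and> \<eta> \<in> {0<..<1}"
    using eventually_at_right_real[of 0 1, OF zero_less_one] by eventually_elim simp
  then obtain \<eta> where "(1 + \<eta>) * (tail_limit + \<eta>) / (1 - \<eta>) < a" "0 < \<eta>" "\<eta> < 1"
    using eventually_happens'[OF trivial_limit_at_right_real] by auto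
  then show "\<forall>\<^sub>F n in sequentially. r n * (\<integral>x. exp_tail x \<partial>\<mu> n) < a"
    using scaled_tail_bounds(1)[of \<eta>] by (auto elim!: eventually_mono)
qed

end

section \<open>Moderate deviations from a moment generating function\<close>

text \<open>The cumulant generating function agrees with the one of a centred normal law of variance \<open>\<sigma>\<^sup>2\<close> up to
\<open>O (\<bar>z\<bar>)\<close>, with constants that do not involve \<open>\<sigma>\<close>. This allows a bias in the mean of order 1, which is
negligible since \<open>\<sigma>\<close> tends to infinity and \<open>y / \<sigma>\<close> to 0.\<close>

definition mgf_near_gaussian :: "real measure \<Rightarrow> real \<Rightarrow> real \<Rightarrow> real \<Rightarrow> bool" where
  "mgf_near_gaussian N \<sigma> \<delta> C \<longleftrightarrow> real_distribution N \<and>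
     (\<forall>z :: complex. norm z \<le> \<delta> \<longrightarrow> integrable N (\<lambda>x. exp (z * of_real x)) \<and>
       (\<exists>h. norm h \<le> C * norm z \<and> (\<integral>x. exp (z * of_real x) \<partial>N) = exp (of_real (\<sigma>\<^sup>2 / 2) * z\<^sup>2 + h)))"

text \<open>
Exponential tilting. The rate \<open>s = y / \<sigma>\<close> moves the mean of the law to about \<open>s * \<sigma>\<^sup>2 = y * \<sigma>\<close>, where
the tail begins. In the coordinate \<open>s * x - y\<^sup>2\<close> the tail becomes the half line \<open>{0..}\<close>, and undoing the
tilt gives the weight \<open>exp (- t)\<close> there.
\<close>

locale tilted =
  fixes N :: "real measure" and \<sigma> \<delta> C y :: real
  assumes mgf: "mgf_near_gaussian N \<sigma> \<delta> C" and \<sigma>: "\<sigma> > 0" and y: "y > 0" and C: "C \<ge> 0" and small: "y / \<sigma> \<le> \<delta>"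
begin

sublocale real_distribution N using mgf by (simp add: mgf_near_gaussian_def)

definition s :: real where "s = y / \<sigma>"
definition Z :: real where "Z = (\<integral>x. exp (s * x) \<partial>N)"
definition tilt :: "real measure" where
  "tilt = distr (density N (\<lambda>x. ennreal (exp (s * x) / Z))) borel (\<lambda>x. s * x - y\<^sup>2)"

lemma s_pos: "s > 0" and s_sigma: "s * \<sigma> = y" and s_le: "s \<le> \<delta>"
  using \<sigma> y small by (auto simp: s_def)

lemma s_sigma_square: "\<sigma>\<^sup>2 * s\<^sup>2 = y\<^sup>2"
proof -
  have "(s * \<sigma>)\<^sup>2 = y\<^sup>2" by (simp only: s_sigma)
  then show ?thesis by (simp add: power_mult_distrib mult.commute)
qed

lemma mgf_at:
  fixes z :: complex
  assumes "norm z \<le> \<delta>"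
  shows "integrable N (\<lambda>x. exp (z * of_real x))"
    and "\<exists>h. norm h \<le> C * norm z \<and> (\<integral>x. exp (z * of_real x) \<partial>N) = exp (of_real (\<sigma>\<^sup>2 / 2) * z\<^sup>2 + h)"
  using mgf assms unfolding mgf_near_gaussian_def by blast+

lemma exp_s_complex: "complex_of_real (exp (s * x)) = exp (of_real s * of_real x)"
  by (simp flip: exp_of_real)

lemma integrable_exp_s: "integrable N (\<lambda>x. exp (s * x))"
proof -
  have "integrable N (\<lambda>x. exp (of_real s * complex_of_real x))"
    using s_pos s_le by (intro mgf_at) simp
  then have "integrable N (\<lambda>x. complex_of_real (exp (s * x)))" by (simp only: exp_s_complex)
  then show ?thesis by (simp only: complex_of_real_integrable_eq)
qed

lemma Z_complex: "complex_of_real Z = (\<integral>x. exp (of_real s * of_real x) \<partial>N)"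
  unfolding Z_def exp_s_complex[symmetric] by (rule integral_complex_of_real[symmetric])

lemma Z_eq: "\<exists>h. norm h \<le> C * s \<and> complex_of_real Z = exp (of_real (y\<^sup>2 / 2) + h)"
proof -
  have "norm (complex_of_real s) \<le> \<delta>" using s_pos s_le by simp
  from mgf_at(2)[OF this] obtain h where h: "norm h \<le> C * norm (complex_of_real s)"
    "complex_of_real Z = exp (of_real (\<sigma>\<^sup>2 / 2) * (of_real s)\<^sup>2 + h)" unfolding Z_complex by blast
  have "of_real (\<sigma>\<^sup>2 / 2) * (of_real s)\<^sup>2 = complex_of_real (\<sigma>\<^sup>2 * s\<^sup>2 / 2)" by simp
  then have "of_real (\<sigma>\<^sup>2 / 2) * (of_real s)\<^sup>2 = complex_of_real (y\<^sup>2 / 2)" by (simp only: s_sigma_square)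
  with h s_pos show ?thesis by (intro exI[of _ h]) simp
qed

lemma Z_pos: "Z > 0"
proof -
  have "Z \<noteq> 0" using Z_eq by (metis exp_not_eq_zero of_real_0)
  moreover have "Z \<ge> 0" unfolding Z_def by (intro integral_nonneg_AE) auto
  ultimately show ?thesis by simp
qed

lemma real_distribution_tilt: "real_distribution tilt"
proof -
  have "emeasure (density N (\<lambda>x. ennreal (exp (s * x) / Z))) (space (density N (\<lambda>x. ennreal (exp (s * x) / Z))))
     = (\<integral>\<^sup>+x. ennreal (exp (s * x) / Z) \<partial>N)" by (simp add: emeasure_density)
  also have "\<dots> = ennreal (\<integral>x. exp (s * x) / Z \<partial>N)"
    using integrable_exp_s Z_pos by (intro nn_integral_eq_integral) auto
  also have "(\<integral>x. exp (s * x) / Z \<partial>N) = 1" using Z_pos by (simp add: Z_def)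
  finally interpret D: prob_space "density N (\<lambda>x. ennreal (exp (s * x) / Z))" by (intro prob_spaceI) simp
  have "prob_space tilt" unfolding tilt_def by (rule D.prob_space_distr) simp
  then show ?thesis by (simp add: real_distribution_def real_distribution_axioms_def tilt_def)
qed

lemma integral_tilt:
  fixes f :: "real \<Rightarrow> 'b :: {banach, second_countable_topology}"
  assumes [measurable]: "f \<in> borel_measurable borel"
  shows "(\<integral>x. f x \<partial>tilt) = (\<integral>x. (exp (s * x) / Z) *\<^sub>R f (s * x - y\<^sup>2) \<partial>N)"
  unfolding tilt_def using Z_pos by (subst integral_distr) (auto simp: integral_density)

text \<open>The characteristic function of the tilted law is a quotient of two values of the moment generating
function, at \<open>s * (1 + \<i> * v)\<close> and at \<open>s\<close>. The error is multiplicative, as a local limit theorem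
requires, and small because \<open>s\<close> is.\<close>

lemma char_tilt:
  assumes "s * (1 + \<bar>v\<bar>) \<le> \<delta>"
  shows "\<exists>\<eta>. norm \<eta> \<le> 2 * C * (s * (1 + \<bar>v\<bar>)) \<and> char tilt v = of_real (exp (- (y\<^sup>2 * v\<^sup>2 / 2))) * exp \<eta>"
proof -
  define z where "z = complex_of_real s * (1 + \<i> * of_real v)"
  have "norm (1 + \<i> * complex_of_real v) \<le> norm (1::complex) + norm (\<i> * complex_of_real v)" by (rule norm_triangle_ineq)
  then have "norm (1 + \<i> * complex_of_real v) \<le> 1 + \<bar>v\<bar>" by (simp add: norm_mult)
  then have nz: "norm z \<le> s * (1 + \<bar>v\<bar>)"
    unfolding z_def norm_mult using s_pos by (simp add: mult_left_mono)
  then have "norm z \<le> \<delta>" using assms by linarith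
  from mgf_at(2)[OF this] obtain h where h: "norm h \<le> C * norm z"
    "(\<integral>x. exp (z * of_real x) \<partial>N) = exp (of_real (\<sigma>\<^sup>2 / 2) * z\<^sup>2 + h)" by blast
  obtain h0 where h0: "norm h0 \<le> C * s" "complex_of_real Z = exp (of_real (y\<^sup>2 / 2) + h0)" using Z_eq by blast
  have "char tilt v = (\<integral>x. (exp (s * x) / Z) *\<^sub>R iexp (v * (s * x - y\<^sup>2)) \<partial>N)"
    unfolding char_def by (rule integral_tilt) measurable
  also have "\<dots> = (\<integral>x. (exp (- \<i> * of_real (v * y\<^sup>2)) / of_real Z) * exp (z * of_real x) \<partial>N)"
  proof (rule Bochner_Integration.integral_cong[OF refl])
    fix x
    have "complex_of_real (exp (s * x)) * iexp (v * (s * x - y\<^sup>2)) = exp (- \<i> * of_real (v * y\<^sup>2)) * exp (z * of_real x)"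
      unfolding exp_s_complex exp_add[symmetric] z_def by (simp add: algebra_simps)
    then show "(exp (s * x) / Z) *\<^sub>R iexp (v * (s * x - y\<^sup>2)) = (exp (- \<i> * of_real (v * y\<^sup>2)) / of_real Z) * exp (z * of_real x)"
      by (simp add: scaleR_conv_of_real)
  qed
  also have "\<dots> = (exp (- \<i> * of_real (v * y\<^sup>2)) / of_real Z) * exp (of_real (\<sigma>\<^sup>2 / 2) * z\<^sup>2 + h)"
    by (simp add: h(2))
  also have "of_real (\<sigma>\<^sup>2 / 2) * z\<^sup>2 = of_real (y\<^sup>2 / 2) * (1 + \<i> * of_real v)\<^sup>2"
  proof -
    have "of_real (\<sigma>\<^sup>2 / 2) * z\<^sup>2 = complex_of_real (\<sigma>\<^sup>2 * s\<^sup>2 / 2) * (1 + \<i> * of_real v)\<^sup>2"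
      by (simp add: z_def power_mult_distrib)
    then show ?thesis by (simp only: s_sigma_square)
  qed
  also have "(exp (- \<i> * of_real (v * y\<^sup>2)) / of_real Z) * exp (of_real (y\<^sup>2 / 2) * (1 + \<i> * of_real v)\<^sup>2 + h)
     = exp (of_real (- (y\<^sup>2 * v\<^sup>2 / 2)) + (h - h0))"
    unfolding h0(2) exp_diff[symmetric] exp_add[symmetric]
    by (rule arg_cong[where f = exp]) (simp add: power2_eq_square algebra_simps)
  also have "\<dots> = of_real (exp (- (y\<^sup>2 * v\<^sup>2 / 2))) * exp (h - h0)"
    unfolding exp_add exp_of_real ..
  finally have 1: "char tilt v = of_real (exp (- (y\<^sup>2 * v\<^sup>2 / 2))) * exp (h - h0)" .
  have "norm (h - h0) \<le> C * (s * (1 + \<bar>v\<bar>)) + C * (s * (1 + \<bar>v\<bar>))"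
  proof (intro order_trans[OF norm_triangle_ineq4] add_mono)
    show "norm h \<le> C * (s * (1 + \<bar>v\<bar>))" using h(1) mult_left_mono[OF nz C] by linarith
    have "s * 1 \<le> s * (1 + \<bar>v\<bar>)" using s_pos by (intro mult_left_mono) auto
    then show "norm h0 \<le> C * (s * (1 + \<bar>v\<bar>))" using h0(1) mult_left_mono[of s "s * (1 + \<bar>v\<bar>)" C] C by simp
  qed
  then show ?thesis using 1 by (intro exI[of _ "h - h0"]) simp
qed

lemma tail_eq: "measure N {y * \<sigma>..} = Z * exp (- y\<^sup>2) * (\<integral>x. exp_tail x \<partial>tilt)"
proof -
  have "(\<integral>x. exp_tail x \<partial>tilt) = (\<integral>x. (exp (s * x) / Z) *\<^sub>R exp_tail (s * x - y\<^sup>2) \<partial>N)"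
    by (rule integral_tilt) measurable
  also have "\<dots> = (\<integral>x. exp (y\<^sup>2) / Z * indicator {y * \<sigma>..} x \<partial>N)"
  proof (rule Bochner_Integration.integral_cong[OF refl])
    fix x
    have "s * x - y\<^sup>2 \<ge> 0 \<longleftrightarrow> x \<ge> y * \<sigma>"
    proof -
      have "s * x - y\<^sup>2 = s * (x - y * \<sigma>)" using s_sigma by (simp add: algebra_simps power2_eq_square)
      then show ?thesis using s_pos by (simp add: zero_le_mult_iff)
    qed
    moreover have "exp (s * x) * exp (- (s * x - y\<^sup>2)) = exp (y\<^sup>2)" by (simp flip: exp_add)
    ultimately show "(exp (s * x) / Z) *\<^sub>R exp_tail (s * x - y\<^sup>2) = exp (y\<^sup>2) / Z * indicator {y * \<sigma>..} x"
      by (auto simp: exp_tail_def indicator_def)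
  qed
  also have "\<dots> = exp (y\<^sup>2) / Z * measure N {y * \<sigma>..}" by simp
  finally show ?thesis using Z_pos by (simp add: exp_minus field_simps)
qed

lemma Z_ratio: "\<exists>h. norm h \<le> C * s \<and> complex_of_real (Z * exp (- (y\<^sup>2 / 2))) = exp h"
proof -
  obtain h where h: "norm h \<le> C * s" "complex_of_real Z = exp (of_real (y\<^sup>2 / 2) + h)" using Z_eq by blast
  have "complex_of_real (Z * exp (- (y\<^sup>2 / 2))) = exp (of_real (y\<^sup>2 / 2) + h) * exp (- of_real (y\<^sup>2 / 2))"
    by (simp add: h(2) flip: exp_of_real)
  also have "\<dots> = exp h" by (simp flip: exp_add)
  finally show ?thesis using h(1) by blast
qed

end

lemma exp_near_1:
  fixes \<epsilon> :: real
  assumes "\<epsilon> > 0"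
  obtains d where "d > 0" "\<And>\<eta> :: complex. norm \<eta> < d \<Longrightarrow> norm (exp \<eta> - 1) < \<epsilon>"
proof -
  have "isCont (exp :: complex \<Rightarrow> complex) 0" by (intro continuous_intros)
  then obtain d where "d > 0" "\<forall>x'. dist x' (0::complex) < d \<longrightarrow> dist (exp x') (exp 0) < \<epsilon>"
    using assms unfolding continuous_at_eps_delta by blast
  then show thesis by (intro that[of d]) (auto simp: dist_norm)
qed

text \<open>The tail is \<open>Z * exp (- y\<^sup>2)\<close> times the mean of the test function under the tilted law, where
\<open>Z\<close> is asymptotic to \<open>exp (y\<^sup>2 / 2)\<close> since the rate tends to 0; the mean is given by the local limit theorem with spread \<open>y\<close>.\<close>

lemma large_tail_asymptotics:
  fixes N :: "nat \<Rightarrow> real measure" and \<sigma> y :: "nat \<Rightarrow> real"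
  assumes mgf: "\<And>n. mgf_near_gaussian (N n) (\<sigma> n) \<delta> C" and \<sigma>: "\<And>n. \<sigma> n > 0" and C: "C \<ge> 0"
    and y: "\<And>n. y n > 0" "filterlim y at_top sequentially"
    and small: "\<And>n. y n / \<sigma> n \<le> \<delta>" "(\<lambda>n. y n / \<sigma> n) \<longlonglongrightarrow> 0" and \<delta>: "\<delta> > 0"
  shows "(\<lambda>n. y n * exp ((y n)\<^sup>2 / 2) * measure (N n) {y n * \<sigma> n..}) \<longlonglongrightarrow> tail_limit"
proof -
  interpret t: tilted "N n" "\<sigma> n" \<delta> C "y n" for n
    by (rule tilted.intro[OF mgf \<sigma> y(1) C small(1)])
  let ?s = "\<lambda>n. y n / \<sigma> n"
  have s: "t.s n = ?s n" for n by (simp add: t.s_def)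
  interpret L: local_scale "\<lambda>n. t.tilt n" y
  proof (rule local_scale.intro)
    show "real_distribution (t.tilt n)" for n by (rule t.real_distribution_tilt)
    fix B \<epsilon> :: real assume B: "B > 0" "\<epsilon> > 0"
    obtain d where d: "d > 0" "\<And>\<eta> :: complex. norm \<eta> < d \<Longrightarrow> norm (exp \<eta> - 1) < \<epsilon>"
      using exp_near_1[OF B(2)] by blast
    have lim: "(\<lambda>n. ?s n * (1 + B)) \<longlonglongrightarrow> 0 * (1 + B)" "(\<lambda>n. 2 * C * (?s n * (1 + B))) \<longlonglongrightarrow> 2 * C * (0 * (1 + B))"
      by (rule tendsto_mult[OF small(2) tendsto_const],
          rule tendsto_mult[OF tendsto_const tendsto_mult[OF small(2) tendsto_const]])
    have "\<forall>\<^sub>F n in sequentially. ?s n * (1 + B) < \<delta>"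
      by (rule order_tendstoD(2)[OF lim(1)]) (use \<delta> in simp)
    moreover have "\<forall>\<^sub>F n in sequentially. 2 * C * (?s n * (1 + B)) < d"
      by (rule order_tendstoD(2)[OF lim(2)]) (use d(1) in simp)
    ultimately show "\<forall>\<^sub>F n in sequentially. \<forall>v. \<bar>v\<bar> \<le> B \<longrightarrow>
       norm (char (t.tilt n) v - of_real (exp (- ((y n)\<^sup>2 * v\<^sup>2 / 2)))) \<le> \<epsilon> * exp (- ((y n)\<^sup>2 * v\<^sup>2 / 2))"
    proof eventually_elim
      case (elim n)
      show ?case
      proof (intro allI impI)
        fix v :: real assume v: "\<bar>v\<bar> \<le> B"
        have le: "t.s n * (1 + \<bar>v\<bar>) \<le> ?s n * (1 + B)"
          unfolding s using v y(1)[of n] \<sigma>[of n] by (intro mult_left_mono) auto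
        then have "t.s n * (1 + \<bar>v\<bar>) \<le> \<delta>" using elim(1) by linarith
        from t.char_tilt[OF this] obtain \<eta> where \<eta>: "norm \<eta> \<le> 2 * C * (t.s n * (1 + \<bar>v\<bar>))"
          "char (t.tilt n) v = of_real (exp (- ((y n)\<^sup>2 * v\<^sup>2 / 2))) * exp \<eta>" by blast
        have "2 * C * (t.s n * (1 + \<bar>v\<bar>)) \<le> 2 * C * (?s n * (1 + B))" using le C by (intro mult_left_mono) auto
        then have "norm \<eta> < d" using \<eta>(1) elim(2) by linarith
        then have e: "norm (exp \<eta> - 1) \<le> \<epsilon>" by (rule less_imp_le[OF d(2)])
        have "char (t.tilt n) v - of_real (exp (- ((y n)\<^sup>2 * v\<^sup>2 / 2))) = of_real (exp (- ((y n)\<^sup>2 * v\<^sup>2 / 2))) * (exp \<eta> - 1)"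
          unfolding \<eta>(2) by (simp add: algebra_simps)
        then have "norm (char (t.tilt n) v - of_real (exp (- ((y n)\<^sup>2 * v\<^sup>2 / 2)))) = exp (- ((y n)\<^sup>2 * v\<^sup>2 / 2)) * norm (exp \<eta> - 1)"
          by (simp only: norm_mult norm_of_real abs_exp_cancel)
        also have "\<dots> \<le> exp (- ((y n)\<^sup>2 * v\<^sup>2 / 2)) * \<epsilon>" by (rule mult_left_mono[OF e]) simp
        finally show "norm (char (t.tilt n) v - of_real (exp (- ((y n)\<^sup>2 * v\<^sup>2 / 2)))) \<le> \<epsilon> * exp (- ((y n)\<^sup>2 * v\<^sup>2 / 2))"
          by (simp add: mult.commute)
      qed
    qed
  qed (rule y)+
  have Z: "(\<lambda>n. t.Z n * exp (- ((y n)\<^sup>2 / 2))) \<longlonglongrightarrow> 1"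
  proof (rule LIMSEQ_I)
    fix \<epsilon> :: real assume "\<epsilon> > 0"
    then obtain d where d: "d > 0" "\<And>\<eta> :: complex. norm \<eta> < d \<Longrightarrow> norm (exp \<eta> - 1) < \<epsilon>"
      using exp_near_1 by blast
    have lim: "(\<lambda>n. C * ?s n) \<longlonglongrightarrow> C * 0" by (rule tendsto_mult[OF tendsto_const small(2)])
    have "\<forall>\<^sub>F n in sequentially. C * ?s n < d" by (rule order_tendstoD(2)[OF lim]) (use d(1) in simp)
    then obtain n0 where n0: "\<And>n. n \<ge> n0 \<Longrightarrow> C * ?s n < d" unfolding eventually_sequentially by blast
    have "norm (t.Z n * exp (- ((y n)\<^sup>2 / 2)) - 1) < \<epsilon>" if "n \<ge> n0" for n
    proof -
      obtain h where h: "norm h \<le> C * t.s n" "complex_of_real (t.Z n * exp (- ((y n)\<^sup>2 / 2))) = exp h"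
        using t.Z_ratio by blast
      have "norm h < d" using h(1) n0[OF that] unfolding s by linarith
      from d(2)[OF this] have "norm (complex_of_real (t.Z n * exp (- ((y n)\<^sup>2 / 2)) - 1)) < \<epsilon>"
        unfolding h(2)[symmetric] by simp
      then show ?thesis unfolding norm_of_real by simp
    qed
    then show "\<exists>n0. \<forall>n\<ge>n0. norm (t.Z n * exp (- ((y n)\<^sup>2 / 2)) - 1) < \<epsilon>" by blast
  qed
  have eq: "y n * exp ((y n)\<^sup>2 / 2) * measure (N n) {y n * \<sigma> n..}
     = (t.Z n * exp (- ((y n)\<^sup>2 / 2))) * (y n * (\<integral>x. exp_tail x \<partial>t.tilt n))" for n
  proof -
    have "exp ((y n)\<^sup>2 / 2) * exp (- (y n)\<^sup>2) = exp (- ((y n)\<^sup>2 / 2))" by (simp flip: exp_add)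
    then show ?thesis unfolding t.tail_eq by (simp add: mult_ac)
  qed
  have "(\<lambda>n. (t.Z n * exp (- ((y n)\<^sup>2 / 2))) * (y n * (\<integral>x. exp_tail x \<partial>t.tilt n))) \<longlonglongrightarrow> 1 * tail_limit"
    by (intro tendsto_mult Z L.scaled_tail_tendsto)
  then show ?thesis unfolding eq by (simp only: mult_1_left)
qed

text \<open>The exact counterpart for the normal law. Tilting a standard normal law by \<open>y\<close> only translates it, so the
tilted law in the coordinate \<open>t\<close> is the normal law of variance \<open>y\<^sup>2\<close>, without any error. Obtaining
this case from the same local limit theorem makes the constants agree automatically.\<close>

lemma gaussian_tail_asymptotics:
  fixes y :: "nat \<Rightarrow> real"
  assumes y: "\<And>n. y n > 0" "filterlim y at_top sequentially"
  shows "(\<lambda>n. y n * exp ((y n)\<^sup>2 / 2) * measure std_normal_distribution {y n..}) \<longlonglongrightarrow> tail_limit"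
proof -
  interpret G: real_distribution std_normal_distribution by (rule real_dist_normal_dist)
  let ?\<mu> = "\<lambda>n. distr std_normal_distribution borel (\<lambda>x. y n * x)"
  interpret L: local_scale ?\<mu> y
  proof (rule local_scale.intro)
    show "real_distribution (?\<mu> n)" for n by (rule G.real_distribution_distr) simp
    fix B \<epsilon> :: real assume B: "B > 0" "\<epsilon> > 0"
    have "char (?\<mu> n) v = of_real (exp (- ((y n)\<^sup>2 * v\<^sup>2 / 2)))" for n v
    proof -
      have "char (?\<mu> n) v = (\<integral>x. iexp (v * (y n * x)) \<partial>std_normal_distribution)"
        unfolding char_def by (rule integral_distr) auto
      also have "\<dots> = char std_normal_distribution (v * y n)"
        by (simp add: char_def mult_ac)
      finally show ?thesis by (simp add: char_std_normal_distribution power_mult_distrib mult.commute)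
    qed
    then show "\<forall>\<^sub>F n in sequentially. \<forall>v. \<bar>v\<bar> \<le> B \<longrightarrow>
       norm (char (?\<mu> n) v - of_real (exp (- ((y n)\<^sup>2 * v\<^sup>2 / 2)))) \<le> \<epsilon> * exp (- ((y n)\<^sup>2 * v\<^sup>2 / 2))"
      using B by simp
  qed (rule y)+
  have "exp ((y n)\<^sup>2 / 2) * measure std_normal_distribution {y n..} = (\<integral>x. exp_tail x \<partial>?\<mu> n)" for n
  proof -
    have "measure std_normal_distribution {y n..} = (\<integral>x. indicator {y n..} x \<partial>std_normal_distribution)" by simp
    also have "\<dots> = (\<integral>x. std_normal_density x *\<^sub>R indicator {y n..} x \<partial>lborel)"
      by (rule integral_density) auto
    also have "\<dots> = \<bar>1\<bar> *\<^sub>R (\<integral>x. std_normal_density (y n + 1 * x) *\<^sub>R indicator {y n..} (y n + 1 * x) \<partial>lborel)"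
      by (rule lborel_integral_real_affine) simp
    also have "(\<lambda>x. std_normal_density (y n + 1 * x) *\<^sub>R indicator {y n..} (y n + 1 * x))
       = (\<lambda>x. exp (- ((y n)\<^sup>2 / 2)) * (std_normal_density x *\<^sub>R exp_tail (y n * x)))"
    proof
      fix x
      have "exp (- (y n + x)\<^sup>2 / 2) = exp (- ((y n)\<^sup>2 / 2)) * (exp (- x\<^sup>2 / 2) * exp (- (y n * x)))"
        unfolding exp_add[symmetric] by (simp add: power2_eq_square field_simps)
      then show "std_normal_density (y n + 1 * x) *\<^sub>R indicator {y n..} (y n + 1 * x)
         = exp (- ((y n)\<^sup>2 / 2)) * (std_normal_density x *\<^sub>R exp_tail (y n * x))"
        using y(1)[of n] by (auto simp: std_normal_density_def exp_tail_def indicator_def zero_le_mult_iff)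
    qed
    also have "\<bar>1\<bar> *\<^sub>R (\<integral>x. exp (- ((y n)\<^sup>2 / 2)) * (std_normal_density x *\<^sub>R exp_tail (y n * x)) \<partial>lborel)
       = exp (- ((y n)\<^sup>2 / 2)) * (\<integral>x. std_normal_density x *\<^sub>R exp_tail (y n * x) \<partial>lborel)" by simp
    also have "(\<integral>x. std_normal_density x *\<^sub>R exp_tail (y n * x) \<partial>lborel) = (\<integral>x. exp_tail (y n * x) \<partial>std_normal_distribution)"
      by (rule integral_density[symmetric]) auto
    also have "\<dots> = (\<integral>x. exp_tail x \<partial>?\<mu> n)"
      by (rule integral_distr[symmetric]) auto
    finally show ?thesis by (simp add: exp_minus field_simps)
  qed
  then show ?thesis using L.scaled_tail_tendsto by (simp add: mult.assoc)
qed

lemma std_normal_tail_pos: "measure std_normal_distribution {c<..} > 0"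
proof -
  interpret G: real_distribution std_normal_distribution by (rule real_dist_normal_dist)
  have "emeasure std_normal_distribution {c<..} \<noteq> 0"
  proof
    assume "emeasure std_normal_distribution {c<..} = 0"
    then have "AE x in lborel. x \<in> {c<..} \<longrightarrow> ennreal (std_normal_density x) = 0"
      by (subst (asm) emeasure_density) (auto simp: nn_integral_0_iff_AE indicator_def elim!: eventually_mono)
    then have "AE x in lborel. x \<notin> {c<..c + 1}"
    proof eventually_elim
      case (elim x)
      have "std_normal_density x > 0" by (rule normal_density_pos) simp
      then have "ennreal (std_normal_density x) \<noteq> 0" by (simp add: ennreal_eq_0_iff)
      with elim show ?case by auto
    qed
    then have "emeasure lborel {c<..c + 1} = 0" by (subst (asm) AE_iff_measurable[of "{c<..c + 1}"]) auto
    moreover have "emeasure lborel {c<..c + 1} = 1" by simp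
    ultimately show False by simp
  qed
  then show ?thesis by (simp add: G.emeasure_eq_measure zero_less_measure_iff)
qed

lemma (in real_distribution) measure_greaterThan: "measure M {x<..} = 1 - cdf M x"
proof -
  have "{x<..} = space M - {..x}" by auto
  then show ?thesis using prob_compl[of "{..x}"] by (simp add: cdf_def)
qed

lemma isCont_cdf_std_normal: "isCont (cdf std_normal_distribution) x"
proof -
  interpret G: real_distribution std_normal_distribution by (rule real_dist_normal_dist)
  have "emeasure std_normal_distribution {x} = 0"
    by (subst emeasure_density) (auto simp: nn_integral_0_iff_AE indicator_def intro: eventually_mono[OF AE_lborel_singleton[of x]])
  then show ?thesis by (simp add: G.isCont_cdf measure_def)
qed

text \<open>Weak convergence to a continuous law tolerates a moving threshold. Both half lines \<open>{y n..}\<close> and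
\<open>{c<..}\<close> are trapped between fixed half lines on either side of \<open>c\<close>.\<close>

lemma weak_conv_tail_tendsto:
  assumes T: "\<And>n. real_distribution (T n)" and w: "weak_conv_m T std_normal_distribution"
    and y: "y \<longlonglongrightarrow> c"
  shows "(\<lambda>n. measure (T n) {y n..}) \<longlonglongrightarrow> measure std_normal_distribution {c<..}"
proof -
  interpret G: real_distribution std_normal_distribution by (rule real_dist_normal_dist)
  interpret T: real_distribution "T n" for n by (rule T)
  let ?\<Phi> = "cdf std_normal_distribution"
  have conv: "(\<lambda>n. cdf (T n) x) \<longlonglongrightarrow> ?\<Phi> x" for x
    using w isCont_cdf_std_normal by (simp add: weak_conv_m_def weak_conv_def)
  have cont: "(?\<Phi> \<longlongrightarrow> ?\<Phi> c) (at_right c)" "(?\<Phi> \<longlongrightarrow> ?\<Phi> c) (at_left c)"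
    using isCont_cdf_std_normal[of c] by (auto simp: isCont_def filterlim_at_split)
  show ?thesis unfolding G.measure_greaterThan
  proof (rule order_tendstoI)
    fix a assume "a < 1 - ?\<Phi> c"
    then have "?\<Phi> c < 1 - a" by simp
    from order_tendstoD(2)[OF cont(1) this]
    have "\<forall>\<^sub>F x in at_right c. ?\<Phi> x < 1 - a \<and> x > c"
      using eventually_at_right_less[of c] by (rule eventually_conj)
    then obtain x where x: "?\<Phi> x < 1 - a" "x > c"
      using eventually_happens'[OF trivial_limit_at_right_real] by blast
    show "\<forall>\<^sub>F n in sequentially. a < measure (T n) {y n..}"
      using order_tendstoD(2)[OF conv x(1)] order_tendstoD(2)[OF y x(2)]
    proof eventually_elim
      case (elim n)
      have "measure (T n) {x<..} \<le> measure (T n) {y n..}"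
        using elim(2) by (intro T.finite_measure_mono) auto
      then show ?case using elim(1) unfolding T.measure_greaterThan by linarith
    qed
  next
    fix a assume "1 - ?\<Phi> c < a"
    then have "1 - a < ?\<Phi> c" by simp
    from order_tendstoD(1)[OF cont(2) this]
    have "\<forall>\<^sub>F x in at_left c. 1 - a < ?\<Phi> x \<and> x < c"
      using eventually_at_left_real[of "c - 1" c] by (auto elim: eventually_elim2)
    then obtain x where x: "1 - a < ?\<Phi> x" "x < c"
      using eventually_happens'[OF trivial_limit_at_left_real] by blast
    show "\<forall>\<^sub>F n in sequentially. measure (T n) {y n..} < a"
      using order_tendstoD(1)[OF conv x(1)] order_tendstoD(1)[OF y x(2)]
    proof eventually_elim
      case (elim n)
      have "measure (T n) {y n..} \<le> measure (T n) {x<..}"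
        using elim(2) by (intro T.finite_measure_mono) auto
      then show ?case using elim(1) unfolding T.measure_greaterThan by linarith
    qed
  qed
qed

lemma weak_conv_tail_tendsto_one:
  assumes T: "\<And>n. real_distribution (T n)" and w: "weak_conv_m T std_normal_distribution"
    and y: "filterlim y at_bot sequentially"
  shows "(\<lambda>n. measure (T n) {y n..}) \<longlonglongrightarrow> 1"
proof (rule order_tendstoI)
  interpret G: real_distribution std_normal_distribution by (rule real_dist_normal_dist)
  interpret T: real_distribution "T n" for n by (rule T)
  let ?\<Phi> = "cdf std_normal_distribution"
  have conv: "(\<lambda>n. cdf (T n) x) \<longlonglongrightarrow> ?\<Phi> x" for x
    using w isCont_cdf_std_normal by (simp add: weak_conv_m_def weak_conv_def)
  {
    fix a :: real assume "a < 1"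
    then have "\<forall>\<^sub>F x in at_bot. ?\<Phi> x < 1 - a" by (intro order_tendstoD(2)[OF G.cdf_lim_at_bot]) simp
    then obtain x where x: "?\<Phi> x < 1 - a" using eventually_happens'[OF trivial_limit_at_bot_linorder] by blast
    have "\<forall>\<^sub>F n in sequentially. y n \<le> x" using y by (simp add: filterlim_at_bot)
    with order_tendstoD(2)[OF conv x]
    show "\<forall>\<^sub>F n in sequentially. a < measure (T n) {y n..}"
    proof eventually_elim
      case (elim n)
      have "measure (T n) {x<..} \<le> measure (T n) {y n..}"
        using elim(2) by (intro T.finite_measure_mono) auto
      then show ?case using elim(1) unfolding T.measure_greaterThan by linarith
    qed
  next
    fix a :: real assume "1 < a"
    then show "\<forall>\<^sub>F n in sequentially. measure (T n) {y n..} < a"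
      using T.prob_le_1 by (intro always_eventually allI) (rule le_less_trans)
  }
qed

text \<open>On the imaginary axis at \<open>z = \<i> * t / \<sigma> n\<close> the error \<open>O (\<bar>z\<bar>)\<close> vanishes in the limit and the
Gaussian term is exactly \<open>exp (- t\<^sup>2 / 2)\<close>, so Levy's continuity theorem applies.\<close>

lemma central_limit_from_mgf:
  fixes N :: "nat \<Rightarrow> real measure" and \<sigma> :: "nat \<Rightarrow> real"
  assumes mgf: "\<And>n. mgf_near_gaussian (N n) (\<sigma> n) \<delta> C" and \<sigma>: "\<And>n. \<sigma> n > 0" "filterlim \<sigma> at_top sequentially"
    and \<delta>: "\<delta> > 0"
  shows "weak_conv_m (\<lambda>n. distr (N n) borel (\<lambda>x. x / \<sigma> n)) std_normal_distribution"
proof (rule levy_continuity)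
  interpret N: real_distribution "N n" for n using mgf[of n] by (simp add: mgf_near_gaussian_def)
  show "real_distribution (distr (N n) borel (\<lambda>x. x / \<sigma> n))" for n
    by (rule N.real_distribution_distr) simp
  show "real_distribution std_normal_distribution" by (rule real_dist_normal_dist)
  fix t :: real
  define z where "z n = \<i> * complex_of_real (t / \<sigma> n)" for n
  have nz: "norm (z n) = \<bar>t\<bar> / \<sigma> n" for n using \<sigma>(1)[of n] by (simp add: z_def norm_mult norm_divide)
  have lim: "(\<lambda>n. norm (z n)) \<longlonglongrightarrow> 0"
    unfolding nz by (intro real_tendsto_divide_at_top[OF tendsto_const \<sigma>(2)])
  then have ev: "\<forall>\<^sub>F n in sequentially. norm (z n) < \<delta>" using \<delta> by (rule order_tendstoD)
  have char: "char (distr (N n) borel (\<lambda>x. x / \<sigma> n)) t = (\<integral>x. exp (z n * of_real x) \<partial>N n)" for n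
  proof -
    have "char (distr (N n) borel (\<lambda>x. x / \<sigma> n)) t = (\<integral>x. iexp (t * (x / \<sigma> n)) \<partial>N n)"
      unfolding char_def by (rule integral_distr) auto
    then show ?thesis by (simp add: z_def mult.assoc)
  qed
  define h where "h n = (SOME h. norm h \<le> C * norm (z n) \<and> (\<integral>x. exp (z n * of_real x) \<partial>N n) = exp (of_real ((\<sigma> n)\<^sup>2 / 2) * (z n)\<^sup>2 + h))" for n
  have h: "norm (h n) \<le> C * norm (z n) \<and> (\<integral>x. exp (z n * of_real x) \<partial>N n) = exp (of_real ((\<sigma> n)\<^sup>2 / 2) * (z n)\<^sup>2 + h n)"
    if "norm (z n) < \<delta>" for n
    unfolding h_def using mgf[of n] that by (intro someI_ex[where P = "\<lambda>h. norm h \<le> C * norm (z n) \<and> _ h"]) (simp add: mgf_near_gaussian_def)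
  have sq: "of_real ((\<sigma> n)\<^sup>2 / 2) * (z n)\<^sup>2 = of_real (- (t\<^sup>2) / 2)" for n
    using \<sigma>(1)[of n] by (simp add: z_def power_mult_distrib power_divide)
  have "h \<longlonglongrightarrow> 0"
  proof (rule Lim_null_comparison)
    show "\<forall>\<^sub>F n in sequentially. norm (h n) \<le> C * norm (z n)" using ev by eventually_elim (use h in blast)
    show "(\<lambda>n. C * norm (z n)) \<longlonglongrightarrow> 0" using tendsto_mult[OF tendsto_const lim, of C] by simp
  qed
  then have "(\<lambda>n. exp (of_real (- (t\<^sup>2) / 2) + h n)) \<longlonglongrightarrow> exp (of_real (- (t\<^sup>2) / 2) + 0)"
    by (intro tendsto_intros)
  moreover have "\<forall>\<^sub>F n in sequentially. exp (of_real (- (t\<^sup>2) / 2) + h n) = char (distr (N n) borel (\<lambda>x. x / \<sigma> n)) t"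
    using ev unfolding char by eventually_elim (use h sq in metis)
  ultimately have "(\<lambda>n. char (distr (N n) borel (\<lambda>x. x / \<sigma> n)) t) \<longlonglongrightarrow> exp (of_real (- (t\<^sup>2) / 2) + 0)"
    by (rule Lim_transform_eventually)
  then show "(\<lambda>n. char (distr (N n) borel (\<lambda>x. x / \<sigma> n)) t) \<longlonglongrightarrow> char std_normal_distribution t"
    by (simp add: char_std_normal_distribution exp_of_real del: of_real_minus of_real_divide of_real_power)
qed

lemma moderate_deviations_convergent:
  fixes N :: "nat \<Rightarrow> real measure" and \<sigma> y :: "nat \<Rightarrow> real"
  assumes mgf: "\<And>n. mgf_near_gaussian (N n) (\<sigma> n) \<delta> C" and \<sigma>: "\<And>n. \<sigma> n > 0" "filterlim \<sigma> at_top sequentially"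
    and \<delta>: "\<delta> > 0" and C: "C \<ge> 0" and small: "(\<lambda>n. y n / \<sigma> n) \<longlonglongrightarrow> 0"
    and lim: "(\<lambda>n. ereal (y n)) \<longlonglongrightarrow> l"
  shows "(\<lambda>n. measure (N n) {y n * \<sigma> n..} / measure std_normal_distribution {y n..}) \<longlonglongrightarrow> 1"
proof -
  interpret N: real_distribution "N n" for n using mgf[of n] by (simp add: mgf_near_gaussian_def)
  let ?T = "\<lambda>n. distr (N n) borel (\<lambda>x. x / \<sigma> n)"
  have T: "real_distribution (?T n)" for n by (rule N.real_distribution_distr) simp
  have w: "weak_conv_m ?T std_normal_distribution" by (rule central_limit_from_mgf[OF mgf \<sigma> \<delta>])
  have w0: "weak_conv_m (\<lambda>n. std_normal_distribution) std_normal_distribution"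
    by (simp add: weak_conv_m_def weak_conv_def)
  have eq: "measure (?T n) {y n..} = measure (N n) {y n * \<sigma> n..}" for n
  proof -
    have "(\<lambda>x. x / \<sigma> n) -` {y n..} \<inter> space (N n) = {y n * \<sigma> n..}"
      using \<sigma>(1)[of n] by (auto simp: le_divide_eq)
    then show ?thesis by (subst measure_distr) auto
  qed
  show ?thesis
  proof (cases l)
    case (real c)
    then have y: "y \<longlonglongrightarrow> c" using lim by simp
    have "(\<lambda>n. measure (?T n) {y n..} / measure std_normal_distribution {y n..})
       \<longlonglongrightarrow> measure std_normal_distribution {c<..} / measure std_normal_distribution {c<..}"
      using std_normal_tail_pos[of c]
      by (intro tendsto_divide weak_conv_tail_tendsto[OF T w y] weak_conv_tail_tendsto[OF real_dist_normal_dist w0 y]) auto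
    then show ?thesis using std_normal_tail_pos[of c] by (simp add: eq)
  next
    case MInf
    have y: "filterlim y at_bot sequentially"
      unfolding filterlim_at_bot
    proof
      fix x
      show "\<forall>\<^sub>F n in sequentially. y n \<le> x"
        using lim unfolding MInf tendsto_MInfty by (auto elim!: allE[of _ x] eventually_mono)
    qed
    have "(\<lambda>n. measure (?T n) {y n..} / measure std_normal_distribution {y n..}) \<longlonglongrightarrow> 1 / 1"
      by (intro tendsto_divide weak_conv_tail_tendsto_one[OF T w y] weak_conv_tail_tendsto_one[OF real_dist_normal_dist w0 y]) auto
    then show ?thesis by (simp add: eq)
  next
    case PInf
    then have y: "filterlim y at_top sequentially" using lim by (simp add: tendsto_PInfty_eq_at_top)
    have "\<forall>\<^sub>F n in sequentially. y n > 0 \<and> y n / \<sigma> n < \<delta>"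
      using y order_tendstoD(2)[OF small \<delta>] by (auto simp: filterlim_at_top_dense intro: eventually_conj)
    then obtain n0 where n0: "\<And>n. n \<ge> n0 \<Longrightarrow> y n > 0 \<and> y n / \<sigma> n < \<delta>"
      unfolding eventually_sequentially by blast
    let ?y = "\<lambda>n. y (n + n0)" and ?\<sigma> = "\<lambda>n. \<sigma> (n + n0)"
    have y': "filterlim ?y at_top sequentially" "\<And>n. ?y n > 0"
      using filterlim_compose[OF y filterlim_add_const_nat_at_top[of n0]] n0 by auto
    have 1: "(\<lambda>n. ?y n * exp ((?y n)\<^sup>2 / 2) * measure (N (n + n0)) {?y n * ?\<sigma> n..}) \<longlonglongrightarrow> tail_limit"
      using n0 by (intro large_tail_asymptotics[where \<delta> = \<delta> and C = C] mgf \<sigma> C y' \<delta> LIMSEQ_ignore_initial_segment small)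
        (auto intro: less_imp_le)
    have 2: "(\<lambda>n. ?y n * exp ((?y n)\<^sup>2 / 2) * measure std_normal_distribution {?y n..}) \<longlonglongrightarrow> tail_limit"
      by (intro gaussian_tail_asymptotics y')
    have "(\<lambda>n. (?y n * exp ((?y n)\<^sup>2 / 2) * measure (N (n + n0)) {?y n * ?\<sigma> n..})
       / (?y n * exp ((?y n)\<^sup>2 / 2) * measure std_normal_distribution {?y n..})) \<longlonglongrightarrow> tail_limit / tail_limit"
      using tail_limit_pos by (intro tendsto_divide 1 2) auto
    moreover have "(?y n * exp ((?y n)\<^sup>2 / 2) * measure (N (n + n0)) {?y n * ?\<sigma> n..})
       / (?y n * exp ((?y n)\<^sup>2 / 2) * measure std_normal_distribution {?y n..})
       = measure (N (n + n0)) {?y n * ?\<sigma> n..} / measure std_normal_distribution {?y n..}" for n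
      using y'(2)[of n] by simp
    ultimately have "(\<lambda>n. measure (N (n + n0)) {?y n * ?\<sigma> n..} / measure std_normal_distribution {?y n..}) \<longlonglongrightarrow> 1"
      using tail_limit_pos by simp
    then show ?thesis by (rule LIMSEQ_offset)
  qed
qed

text \<open>The sequence \<open>y\<close> may mix different regimes. If the quotient of the tails failed to tend to 1, it would
stay away from 1 along a subsequence; by compactness of the extended reals a further subsequence of
\<open>y\<close> converges, which reduces the claim to the convergent case.\<close>

theorem moderate_deviations:
  fixes N :: "nat \<Rightarrow> real measure" and \<sigma> y :: "nat \<Rightarrow> real"
  assumes mgf: "\<forall>\<^sub>F n in sequentially. mgf_near_gaussian (N n) (\<sigma> n) \<delta> C"
    and \<sigma>: "filterlim \<sigma> at_top sequentially"
    and \<delta>: "\<delta> > 0" and C: "C \<ge> 0" and small: "(\<lambda>n. y n / \<sigma> n) \<longlonglongrightarrow> 0"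
  shows "(\<lambda>n. measure (N n) {y n * \<sigma> n..} / measure std_normal_distribution {y n..}) \<longlonglongrightarrow> 1"
proof (rule ccontr)
  let ?q = "\<lambda>n. measure (N n) {y n * \<sigma> n..} / measure std_normal_distribution {y n..}"
  assume "\<not> ?q \<longlonglongrightarrow> 1"
  then obtain e where e: "e > 0" "\<not> (\<forall>\<^sub>F n in sequentially. dist (?q n) 1 < e)"
    unfolding tendsto_iff by blast
  have "\<forall>\<^sub>F n in sequentially. \<sigma> n > 0" using \<sigma> by (simp add: filterlim_at_top_dense)
  with mgf have ev: "\<forall>\<^sub>F n in sequentially. mgf_near_gaussian (N n) (\<sigma> n) \<delta> C \<and> \<sigma> n > 0"
    by (rule eventually_conj)
  have "\<exists>\<^sub>F n in sequentially. \<not> dist (?q n) 1 < e"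
    using e(2) by (simp add: frequently_def)
  from frequently_eventually_frequently[OF this ev]
  have "\<exists>\<^sub>F n in sequentially. \<not> dist (?q n) 1 < e \<and> mgf_near_gaussian (N n) (\<sigma> n) \<delta> C \<and> \<sigma> n > 0" .
  then have "infinite {n. \<not> dist (?q n) 1 < e \<and> mgf_near_gaussian (N n) (\<sigma> n) \<delta> C \<and> \<sigma> n > 0}"
    by (simp add: cofinite_eq_sequentially[symmetric] frequently_cofinite)
  then obtain k :: "nat \<Rightarrow> nat" where k: "strict_mono k"
    "\<And>n. \<not> dist (?q (k n)) 1 < e \<and> mgf_near_gaussian (N (k n)) (\<sigma> (k n)) \<delta> C \<and> \<sigma> (k n) > 0"
    using infinite_enumerate by blast
  obtain l and j :: "nat \<Rightarrow> nat" where j: "strict_mono j" "((\<lambda>n. ereal (y (k n))) \<circ> j) \<longlonglongrightarrow> l"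
    using compact_complete_linorder by blast
  have kj: "strict_mono (\<lambda>n. k (j n))" using k(1) j(1) by (auto simp: strict_mono_def)
  then have sub: "filterlim (\<lambda>n. k (j n)) sequentially sequentially" by (rule filterlim_subseq)
  have "(\<lambda>n. measure (N (k (j n))) {y (k (j n)) * \<sigma> (k (j n))..} / measure std_normal_distribution {y (k (j n))..}) \<longlonglongrightarrow> 1"
  proof (rule moderate_deviations_convergent)
    show "filterlim (\<lambda>n. \<sigma> (k (j n))) at_top sequentially" by (rule filterlim_compose[OF \<sigma> sub])
    show "(\<lambda>n. y (k (j n)) / \<sigma> (k (j n))) \<longlonglongrightarrow> 0" by (rule filterlim_compose[OF small sub])
    show "(\<lambda>n. ereal (y (k (j n)))) \<longlonglongrightarrow> l" using j(2) by (simp add: o_def)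
  qed (use k(2) \<delta> C in blast)+
  then have "\<forall>\<^sub>F n in sequentially. dist (?q (k (j n))) 1 < e" using e(1) by (rule tendstoD)
  then show False using k(2) by (auto simp: eventually_sequentially)
qed

section \<open>Aomoto's recursion for Selberg integrals\<close>

text \<open>For \<open>\<epsilon> = 0\<close> this is \<open>\<bar>\<Delta>\<bar> powr (2 * \<gamma>)\<close> for the Vandermonde determinant \<open>\<Delta>\<close>: every pair \<open>{i, j}\<close> occurs twice
in the product. If \<open>2 * \<gamma> \<le> 1\<close>, that function is not differentiable where two coordinates
coincide. The parameter \<open>\<epsilon> > 0\<close> makes it smooth, so that one can integrate by parts before
letting \<open>\<epsilon>\<close> tend to 0.\<close>

definition repulsion :: "real \<Rightarrow> real \<Rightarrow> 'i set \<Rightarrow> ('i \<Rightarrow> real) \<Rightarrow> real" where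
  "repulsion \<gamma> \<epsilon> I x = (\<Prod>i\<in>I. \<Prod>j\<in>I - {i}. (\<epsilon> + (x i - x j)\<^sup>2) powr (\<gamma> / 2))"

lemma repulsion_nonneg: "repulsion \<gamma> \<epsilon> I x \<ge> 0"
  unfolding repulsion_def by (intro prod_nonneg) auto

lemma repulsion_measurable:
  assumes "finite I" "\<And>i. i \<in> I \<Longrightarrow> (\<lambda>x. f x i) \<in> borel_measurable N"
  shows "(\<lambda>x. repulsion \<gamma> \<epsilon> I (f x)) \<in> borel_measurable N"
  unfolding repulsion_def
  by (intro borel_measurable_prod powr_real_measurable borel_measurable_add borel_measurable_power
        borel_measurable_diff borel_measurable_const assms) (use assms in auto)

lemma repulsion_swap:
  assumes "finite I" "i \<in> I" "j \<in> I"
  shows "repulsion \<gamma> \<epsilon> I (\<lambda>k\<in>I. x (Transposition.transpose i j k)) = repulsion \<gamma> \<epsilon> I x"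
proof -
  let ?\<pi> = "Transposition.transpose i j"
  have p: "bij_betw ?\<pi> I I"
    using assms by (metis bij_betw_transpose_iff)
  have "repulsion \<gamma> \<epsilon> I (\<lambda>k\<in>I. x (?\<pi> k))
      = (\<Prod>k\<in>I. \<Prod>l\<in>I - {k}. (\<epsilon> + (x (?\<pi> k) - x (?\<pi> l))\<^sup>2) powr (\<gamma> / 2))"
    unfolding repulsion_def by (intro prod.cong) auto
  also have "\<dots> = (\<Prod>k\<in>I. \<Prod>l\<in>I - {?\<pi> k}. (\<epsilon> + (x (?\<pi> k) - x l)\<^sup>2) powr (\<gamma> / 2))"
  proof (rule prod.cong[OF refl])
    fix k assume "k \<in> I"
    have "bij_betw ?\<pi> (I - {k}) (I - {?\<pi> k})"
      using bij_betw_DiffI[OF p, of "{k}" "{?\<pi> k}"] \<open>k \<in> I\<close> bij_betw_apply[OF p]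
      by (simp add: bij_betw_def)
    then show "(\<Prod>l\<in>I - {k}. (\<epsilon> + (x (?\<pi> k) - x (?\<pi> l))\<^sup>2) powr (\<gamma> / 2))
       = (\<Prod>l\<in>I - {?\<pi> k}. (\<epsilon> + (x (?\<pi> k) - x l)\<^sup>2) powr (\<gamma> / 2))"
      by (rule prod.reindex_bij_betw)
  qed
  also have "\<dots> = repulsion \<gamma> \<epsilon> I x"
    unfolding repulsion_def by (rule prod.reindex_bij_betw[OF p])
  finally show ?thesis .
qed

lemma repulsion_fun_upd:
  assumes "finite I" "i \<notin> I" 
  shows "repulsion \<gamma> \<epsilon> (insert i I) (x(i := t))
    = (\<Prod>j\<in>I. (\<epsilon> + (t - x j)\<^sup>2) powr \<gamma>) * repulsion \<gamma> \<epsilon> I x"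
proof -
  let ?w = "\<lambda>u. (\<epsilon> + u\<^sup>2) powr (\<gamma> / 2)"
  have "repulsion \<gamma> \<epsilon> (insert i I) (x(i := t)) =
     (\<Prod>j\<in>I. ?w (t - x j)) * (\<Prod>k\<in>I. \<Prod>j\<in>insert i (I - {k}). ?w ((x(i:=t)) k - (x(i:=t)) j))"
    unfolding repulsion_def prod.insert[OF assms]
    using assms by (intro arg_cong2[where f="(*)"] prod.cong) (auto simp: insert_Diff_if)
  also have "(\<Prod>k\<in>I. \<Prod>j\<in>insert i (I - {k}). ?w ((x(i:=t)) k - (x(i:=t)) j))
     = (\<Prod>k\<in>I. ?w (x k - t) * (\<Prod>j\<in>I - {k}. ?w (x k - x j)))"
  proof (rule prod.cong[OF refl])
    fix k assume k: "k \<in> I"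
    have "(\<Prod>j\<in>I - {k}. ?w ((x(i:=t)) k - (x(i:=t)) j)) = (\<Prod>j\<in>I - {k}. ?w (x k - x j))"
      using assms k by (intro prod.cong) auto
    then show "(\<Prod>j\<in>insert i (I - {k}). ?w ((x(i:=t)) k - (x(i:=t)) j))
       = ?w (x k - t) * (\<Prod>j\<in>I - {k}. ?w (x k - x j))"
      using assms k by (subst prod.insert) auto
  qed
  also have "\<dots> = (\<Prod>k\<in>I. ?w (t - x k)) * repulsion \<gamma> \<epsilon> I x"
    by (simp add: prod.distrib repulsion_def power2_commute)
  also have "(\<Prod>j\<in>I. ?w (t - x j)) * ((\<Prod>k\<in>I. ?w (t - x k)) * repulsion \<gamma> \<epsilon> I x)
     = (\<Prod>j\<in>I. (\<epsilon> + (t - x j)\<^sup>2) powr \<gamma>) * repulsion \<gamma> \<epsilon> I x"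
    by (simp flip: powr_add prod.distrib mult.assoc)
  finally show ?thesis .
qed

lemma squared_gap_powr_le:
  fixes u v \<epsilon> \<gamma> :: real and K :: nat
  assumes "0 \<le> \<epsilon>" "\<epsilon> \<le> 1" "0 \<le> \<gamma>" "\<gamma> \<le> K"
  shows "(\<epsilon> + (u - v)\<^sup>2) powr \<gamma> \<le> ((1 + \<bar>u\<bar>) * (1 + \<bar>v\<bar>)) ^ (2 * K)"
proof -
  have "\<epsilon> + (u - v)\<^sup>2 \<le> 1 + (\<bar>u\<bar> + \<bar>v\<bar>)\<^sup>2"
    using assms by (intro add_mono abs_le_square_iff[THEN iffD1]) auto
  also have "\<dots> \<le> ((1 + \<bar>u\<bar>) * (1 + \<bar>v\<bar>))\<^sup>2"
  proof -
    have "1 + (\<bar>u\<bar> + \<bar>v\<bar>)\<^sup>2 \<le> (1 + (\<bar>u\<bar> + \<bar>v\<bar>))\<^sup>2"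
      by (simp add: power2_sum[of 1])
    also have "\<dots> \<le> (1 + (\<bar>u\<bar> + \<bar>v\<bar>) + \<bar>u\<bar> * \<bar>v\<bar>)\<^sup>2"
      by (intro power_mono) auto
    also have "1 + (\<bar>u\<bar> + \<bar>v\<bar>) + \<bar>u\<bar> * \<bar>v\<bar> = (1 + \<bar>u\<bar>) * (1 + \<bar>v\<bar>)"
      by (simp add: algebra_simps)
    finally show ?thesis .
  qed
  finally have "(\<epsilon> + (u - v)\<^sup>2) powr \<gamma> \<le> (((1 + \<bar>u\<bar>) * (1 + \<bar>v\<bar>))\<^sup>2) powr \<gamma>"
    using assms by (intro powr_mono2) auto
  also have "\<dots> \<le> (((1 + \<bar>u\<bar>) * (1 + \<bar>v\<bar>))\<^sup>2) powr K"
    using assms mult_mono[of 1 "1 + \<bar>u\<bar>" 1 "1 + \<bar>v\<bar>"] by (intro powr_mono one_le_power) auto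
  also have "\<dots> = ((1 + \<bar>u\<bar>) * (1 + \<bar>v\<bar>)) ^ (2 * K)"
  proof -
    have "((1 + \<bar>u\<bar>) * (1 + \<bar>v\<bar>))\<^sup>2 > 0" by (intro zero_less_power mult_pos_pos) auto
    then show ?thesis by (simp add: powr_realpow power_mult)
  qed
  finally show ?thesis .
qed

lemma repulsion_le:
  fixes I :: "'i set"
  assumes "finite I" "0 \<le> \<epsilon>" "\<epsilon> \<le> 1" "0 \<le> \<gamma>" "\<gamma> \<le> K"
  shows "repulsion \<gamma> \<epsilon> I x \<le> (\<Prod>i\<in>I. (1 + \<bar>x i\<bar>) ^ (4 * K * card I))"
proof -
  let ?f = "\<lambda>i. 1 + \<bar>x i\<bar>"
  have ge1: "1 \<le> ?f i * ?f j" for i j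
    using mult_mono[of 1 "?f i" 1 "?f j"] by simp
  have "repulsion \<gamma> \<epsilon> I x \<le> (\<Prod>i\<in>I. \<Prod>j\<in>I - {i}. (?f i * ?f j) ^ (2 * K))"
    unfolding repulsion_def using assms
    by (intro prod_mono conjI prod_nonneg squared_gap_powr_le) auto
  also have "\<dots> \<le> (\<Prod>i\<in>I. \<Prod>j\<in>I. (?f i * ?f j) ^ (2 * K))"
    using assms
    by (intro prod_mono conjI prod_nonneg prod_mono2) (auto intro!: one_le_power ge1)
  also have "\<dots> = (\<Prod>i\<in>I. ?f i ^ (2 * K * card I)) * (\<Prod>i\<in>I. ?f i ^ (2 * K * card I))"
    by (simp add: power_mult_distrib prod.distrib prod_power_distrib flip: power_mult)
  also have "\<dots> = (\<Prod>i\<in>I. ?f i ^ (4 * K * card I))"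
    unfolding prod.distrib[symmetric] power_add[symmetric] by (simp add: mult.assoc)
  finally show ?thesis .
qed

lemma repulsion_tendsto:
  assumes "finite I" "\<gamma> > 0" "e \<longlonglongrightarrow> 0" "\<And>n. e n > 0"
  shows "(\<lambda>n. repulsion \<gamma> (e n) I x) \<longlonglongrightarrow> repulsion \<gamma> 0 I x"
  unfolding repulsion_def
proof (intro tendsto_prod tendsto_powr2)
  fix i j
  show "(\<lambda>n. e n + (x i - x j)\<^sup>2) \<longlonglongrightarrow> 0 + (x i - x j)\<^sup>2"
    by (intro tendsto_intros assms)
  show "\<forall>\<^sub>F n in sequentially. 0 \<le> e n + (x i - x j)\<^sup>2"
    using assms(4) by (intro always_eventually allI add_nonneg_nonneg) (auto intro: less_imp_le)
qed (use assms in auto)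

text \<open>
Pearson's differential equation \<open>((t - d * t\<^sup>2) * w t)' = (a - c * t) * w t\<close> for the density \<open>w\<close>, in
its integrated form against test functions of polynomial growth. The gamma and the beta
densities satisfy it with \<open>d = 0\<close> and \<open>d = 1\<close>, which lets the Laguerre and Jacobi ensembles share the
argument.
\<close>

locale pearson_measure =
  fixes M :: "real measure" and a c d :: real
  assumes sets_M [measurable_cong, simp]: "sets M = sets borel"
    and integrable_growth: "\<And>K::nat. integrable M (\<lambda>t. (1 + \<bar>t\<bar>) ^ K)"
    and pearson_identity: "\<And>P P' C K.
      \<lbrakk>\<And>t. (P has_real_derivative P' t) (at t); continuous_on UNIV P';
       \<And>t. \<bar>P t\<bar> \<le> C * (1 + \<bar>t\<bar>) ^ K; \<And>t. \<bar>P' t\<bar> \<le> C * (1 + \<bar>t\<bar>) ^ K\<rbrakk> \<Longrightarrow>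
      (\<integral>t. (a - c * t) * P t + (t - d * t\<^sup>2) * P' t \<partial>M) = 0"
begin

lemma space_M [simp]: "space M = UNIV"
  using sets_eq_imp_space_eq[OF sets_M] by simp

sublocale finite_measure M
proof
  have "integrable M (\<lambda>t. 1 :: real)" using integrable_growth[of 0] by simp
  then show "emeasure M (space M) \<noteq> \<infinity>"
    by (auto simp: integrable_iff_bounded)
qed

abbreviation joint :: "'i set \<Rightarrow> ('i \<Rightarrow> real) measure" where
  "joint I \<equiv> Pi\<^sub>M I (\<lambda>_. M)"

lemma measurable_coordinate: "k \<in> I \<Longrightarrow> (\<lambda>x. x k) \<in> borel_measurable (joint I)"
  using measurable_component_singleton[of k I "\<lambda>_. M"]
  by (simp add: measurable_cong_sets[OF refl sets_M])

lemma integrable_joint_bound: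
  fixes I :: "'i set"
  assumes "finite I" and [measurable]: "F \<in> borel_measurable (joint I)"
    and "\<And>x. \<bar>F x\<bar> \<le> C * (\<Prod>i\<in>I. (1 + \<bar>x i\<bar>) ^ N)"
  shows "integrable (joint I) F"
proof -
  interpret product_sigma_finite "\<lambda>_::'i. M" by standard
  have "integrable (joint I) (\<lambda>x. C * (\<Prod>i\<in>I. (1 + \<bar>x i\<bar>) ^ N))"
    by (intro integrable_mult_right product_integrable_prod assms integrable_growth)
  then show ?thesis
    by (rule Bochner_Integration.integrable_bound)
       (auto intro!: AE_I2 order_trans[OF assms(3)])
qed

lemma
  fixes I :: "'i set"
  assumes "finite I" "i \<in> I" "j \<in> I"
  shows measurable_swap: "(\<lambda>x. \<lambda>k\<in>I. x (Transposition.transpose i j k)) \<in> measurable (joint I) (joint I)"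
    and distr_swap: "distr (joint I) (joint I) (\<lambda>x. \<lambda>k\<in>I. x (Transposition.transpose i j k)) = joint I"
proof -
  interpret product_sigma_finite "\<lambda>_::'i. M" by standard
  let ?\<pi> = "Transposition.transpose i j"
  have p: "bij_betw ?\<pi> I I"
    using assms by (metis bij_betw_transpose_iff)
  have pI: "?\<pi> k \<in> I" if "k \<in> I" for k using p that by (auto dest: bij_betw_apply)
  show [measurable]: "(\<lambda>x. \<lambda>k\<in>I. x (?\<pi> k)) \<in> measurable (joint I) (joint I)"
    by (intro measurable_restrict measurable_component_singleton pI)
  show "distr (joint I) (joint I) (\<lambda>x. \<lambda>k\<in>I. x (?\<pi> k)) = joint I"
  proof (rule PiM_eqI)
    fix A :: "'i \<Rightarrow> real set" assume A: "\<And>k. k \<in> I \<Longrightarrow> A k \<in> sets M"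
    have "(\<lambda>x. \<lambda>k\<in>I. x (?\<pi> k)) -` (Pi\<^sub>E I A) \<inter> space (joint I) = Pi\<^sub>E I (\<lambda>k. A (?\<pi> k))"
    proof (intro set_eqI iffI)
      fix x assume "x \<in> (\<lambda>x. \<lambda>k\<in>I. x (?\<pi> k)) -` (Pi\<^sub>E I A) \<inter> space (joint I)"
      then have x: "x \<in> extensional I" "\<And>k. k \<in> I \<Longrightarrow> x (?\<pi> k) \<in> A k"
        by (auto simp: space_PiM PiE_iff)
      have "x k \<in> A (?\<pi> k)" if "k \<in> I" for k
        using x(2)[OF pI[OF that]] by simp
      then show "x \<in> Pi\<^sub>E I (\<lambda>k. A (?\<pi> k))" using x(1) by (auto simp: PiE_iff)
    next
      fix x assume x: "x \<in> Pi\<^sub>E I (\<lambda>k. A (?\<pi> k))"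
      have "x (?\<pi> k) \<in> A k" if "k \<in> I" for k
        using PiE_mem[OF x pI[OF that]] by simp
      with x show "x \<in> (\<lambda>x. \<lambda>k\<in>I. x (?\<pi> k)) -` (Pi\<^sub>E I A) \<inter> space (joint I)"
        by (auto simp: space_PiM PiE_iff)
    qed
    moreover have "(\<Prod>k\<in>I. emeasure M (A (?\<pi> k))) = (\<Prod>k\<in>I. emeasure M (A k))"
      by (rule prod.reindex_bij_betw[OF p])
    ultimately show "emeasure (distr (joint I) (joint I) (\<lambda>x. \<lambda>k\<in>I. x (?\<pi> k))) (Pi\<^sub>E I A)
        = (\<Prod>k\<in>I. emeasure M (A k))"
      using A \<open>finite I\<close> pI
      by (subst emeasure_distr) (auto intro!: sets_PiM_I_finite simp: emeasure_PiM)
  qed (use assms in auto)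
qed

text \<open>The product measure is invariant under exchanging two coordinates, so an integrand can be averaged with its
mirror image.\<close>

lemma integral_eq_half_symmetrised:
  fixes I :: "'i set" and F :: "('i \<Rightarrow> real) \<Rightarrow> real"
  assumes "finite I" "i \<in> I" "j \<in> I" and F: "integrable (joint I) F"
    and G: "\<And>x. F x + F (\<lambda>k\<in>I. x (Transposition.transpose i j k)) = G x"
  shows "(\<integral>x. F x \<partial>joint I) = (\<integral>x. G x \<partial>joint I) / 2"
proof -
  let ?\<tau> = "\<lambda>x. \<lambda>k\<in>I. x (Transposition.transpose i j k)"
  note [measurable] = measurable_swap[OF assms(1-3)] borel_measurable_integrable[OF F]
  have "integrable (joint I) (\<lambda>x. F (?\<tau> x))"
    using F by (subst (asm) distr_swap[OF assms(1-3), symmetric], subst (asm) integrable_distr_eq) auto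
  moreover have "(\<integral>x. F (?\<tau> x) \<partial>joint I) = (\<integral>x. F x \<partial>joint I)"
    by (subst (2) distr_swap[OF assms(1-3), symmetric], subst integral_distr) auto
  ultimately have "(\<integral>x. G x \<partial>joint I) = (\<integral>x. F x \<partial>joint I) + (\<integral>x. F x \<partial>joint I)"
    using F unfolding G[symmetric] by simp
  then show ?thesis by simp
qed

lemma abs_repulsion_le:
  fixes I :: "'i set"
  assumes "finite I" "A \<subseteq> I" and \<epsilon>: "0 \<le> \<epsilon>" "\<epsilon> \<le> 1" and \<gamma>: "0 \<le> \<gamma>" "\<gamma> \<le> K"
    and g: "\<bar>g\<bar> \<le> C * (\<Prod>k\<in>I. 1 + \<bar>x k\<bar>) ^ m"
  shows "\<bar>(\<Prod>k\<in>A. x k) * repulsion \<gamma> \<epsilon> I x * g\<bar>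
     \<le> C * (\<Prod>k\<in>I. (1 + \<bar>x k\<bar>) ^ (Suc (4 * K * card I) + m))"
proof -
  let ?f = "\<lambda>k. 1 + \<bar>x k\<bar>"
  have "\<bar>\<Prod>k\<in>A. x k\<bar> \<le> (\<Prod>k\<in>A. ?f k)"
    unfolding abs_prod by (intro prod_mono) auto
  also have "\<dots> \<le> (\<Prod>k\<in>I. ?f k)"
    using assms by (intro prod_mono2) auto
  finally have 1: "\<bar>\<Prod>k\<in>A. x k\<bar> \<le> (\<Prod>k\<in>I. ?f k)" .
  have 2: "repulsion \<gamma> \<epsilon> I x \<le> (\<Prod>k\<in>I. ?f k) ^ (4 * K * card I)"
    using repulsion_le[OF assms(1) \<epsilon> \<gamma>, of x] by (simp add: prod_power_distrib)
  have "\<bar>(\<Prod>k\<in>A. x k) * repulsion \<gamma> \<epsilon> I x * g\<bar>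
      = \<bar>\<Prod>k\<in>A. x k\<bar> * repulsion \<gamma> \<epsilon> I x * \<bar>g\<bar>"
    by (simp add: abs_mult repulsion_nonneg)
  also have "\<dots> \<le> (\<Prod>k\<in>I. ?f k) * (\<Prod>k\<in>I. ?f k) ^ (4 * K * card I) * (C * (\<Prod>k\<in>I. ?f k) ^ m)"
  proof (rule mult_mono[OF mult_mono[OF 1 2] g])
    show "0 \<le> (\<Prod>k\<in>I. ?f k)" "0 \<le> repulsion \<gamma> \<epsilon> I x"
      by (auto intro: prod_nonneg repulsion_nonneg)
    then show "0 \<le> (\<Prod>k\<in>I. ?f k) * (\<Prod>k\<in>I. ?f k) ^ (4 * K * card I)" by simp
  qed simp
  also have "\<dots> = C * (\<Prod>k\<in>I. ?f k) ^ (Suc (4 * K * card I) + m)"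
    by (simp add: power_add)
  also have "(\<Prod>k\<in>I. ?f k) ^ (Suc (4 * K * card I) + m) = (\<Prod>k\<in>I. ?f k ^ (Suc (4 * K * card I) + m))"
    by (rule prod_power_distrib)
  finally show ?thesis .
qed

lemma measurable_repulsion_term:
  fixes I :: "'i set"
  assumes "finite I" "A \<subseteq> I"
  shows "(\<lambda>x. (\<Prod>k\<in>A. x k) * repulsion \<gamma> \<epsilon> I x) \<in> borel_measurable (joint I)"
proof (rule borel_measurable_times)
  show "(\<lambda>x. \<Prod>k\<in>A. x k) \<in> borel_measurable (joint I)"
    by (rule borel_measurable_prod, rule measurable_coordinate) (use assms in blast)
  show "repulsion \<gamma> \<epsilon> I \<in> borel_measurable (joint I)"
    by (rule repulsion_measurable[OF assms(1)], rule measurable_coordinate)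
qed

lemma integrable_repulsion:
  fixes I :: "'i set"
  assumes "finite I" "A \<subseteq> I" and \<epsilon>: "0 \<le> \<epsilon>" "\<epsilon> \<le> 1" and "0 \<le> \<gamma>"
    and [measurable]: "g \<in> borel_measurable (joint I)"
    and g: "\<And>x. \<bar>g x\<bar> \<le> C * (\<Prod>k\<in>I. 1 + \<bar>x k\<bar>) ^ m"
  shows "integrable (joint I) (\<lambda>x. (\<Prod>k\<in>A. x k) * repulsion \<gamma> \<epsilon> I x * g x)"
proof -
  obtain K :: nat where K: "\<gamma> \<le> K" using real_arch_simple by blast
  note [measurable] = measurable_repulsion_term[OF assms(1,2)]
  show ?thesis
    by (rule integrable_joint_bound[OF assms(1) _ abs_repulsion_le[OF assms(1-5) K g]]) measurable
qed

lemma smoothed_kernel_le: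
  fixes u \<epsilon> :: real
  assumes "0 < \<epsilon>" "\<epsilon> \<le> 1"
  shows "\<bar>u / (\<epsilon> + u\<^sup>2)\<bar> \<le> 1 / \<epsilon>"
proof -
  have p: "\<epsilon> + u\<^sup>2 > 0" using assms by (simp add: add_pos_nonneg)
  have "\<bar>u\<bar> * \<epsilon> \<le> \<epsilon> + u\<^sup>2"
  proof (cases "\<bar>u\<bar> \<le> 1")
    case True
    then have "\<bar>u\<bar> * \<epsilon> \<le> 1 * \<epsilon>" using assms by (intro mult_right_mono) auto
    then show ?thesis by (simp add: add_increasing2)
  next
    case False
    then have "\<bar>u\<bar> * \<epsilon> \<le> \<bar>u\<bar> * \<bar>u\<bar>" using assms by (intro mult_left_mono) auto
    then show ?thesis using assms by (simp add: power2_eq_square)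
  qed
  then show ?thesis using p assms by (simp add: field_simps)
qed

text \<open>The Pearson identity in the coordinate \<open>i\<close>, with the other coordinates frozen, applied to the factor of
the repulsion that contains \<open>x i\<close>. The sum is the logarithmic derivative of this factor.\<close>

lemma joint_pearson_identity:
  fixes I :: "'i set"
  assumes "finite I" "i \<in> I" "A \<subseteq> I - {i}" and \<epsilon>: "0 < \<epsilon>" "\<epsilon> \<le> 1" and "0 \<le> \<gamma>"
  shows "(\<integral>x. (\<Prod>k\<in>A. x k) * repulsion \<gamma> \<epsilon> I x * ((a - c * x i) +
       (x i - d * (x i)\<^sup>2) * (\<Sum>j\<in>I - {i}. 2 * \<gamma> * ((x i - x j) / (\<epsilon> + (x i - x j)\<^sup>2)))) \<partial>joint I) = 0"
  (is "(\<integral>x. ?F x \<partial>joint I) = 0")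
proof -
  interpret product_sigma_finite "\<lambda>_::'i. M" by standard
  define J where "J = I - {i}"
  have J: "I = insert i J" "i \<notin> J" "finite J" "A \<subseteq> J" using assms by (auto simp: J_def)
  note [measurable] = measurable_coordinate[OF assms(2)]
  have iI: "i \<in> I" by fact
  define B where "B = card J * (2 * \<gamma> / \<epsilon>)"
  have B: "B \<ge> 0" using assms by (simp add: B_def)
  have sum_le: "\<bar>\<Sum>j\<in>J. 2 * \<gamma> * ((t - x j) / (\<epsilon> + (t - x j)\<^sup>2))\<bar> \<le> B" for t and x :: "'i \<Rightarrow> real"
  proof -
    have "\<bar>2 * \<gamma> * ((t - x j) / (\<epsilon> + (t - x j)\<^sup>2))\<bar> \<le> 2 * \<gamma> / \<epsilon>" for j
      using mult_left_mono[OF smoothed_kernel_le[OF \<epsilon>, of "t - x j"], of "2 * \<gamma>"] assms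
      by (simp add: abs_mult)
    then show ?thesis unfolding B_def by (intro order_trans[OF sum_abs] sum_bounded_above) auto
  qed
  have int: "integrable (joint I) ?F"
  proof (rule integrable_repulsion[where C = "\<bar>a\<bar> + \<bar>c\<bar> + (1 + \<bar>d\<bar>) * B" and m = 2])
    show "(\<lambda>x. (a - c * x i) + (x i - d * (x i)\<^sup>2) * (\<Sum>j\<in>I - {i}. 2 * \<gamma> * ((x i - x j) / (\<epsilon> + (x i - x j)\<^sup>2))))
        \<in> borel_measurable (joint I)"
    proof -
      have "(\<lambda>x. \<Sum>j\<in>I - {i}. 2 * \<gamma> * ((x i - x j) / (\<epsilon> + (x i - x j)\<^sup>2))) \<in> borel_measurable (joint I)"
      proof (rule borel_measurable_sum)
        fix j assume "j \<in> I - {i}"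
        then have [measurable]: "(\<lambda>x. x j) \<in> borel_measurable (joint I)"
          by (intro measurable_coordinate) auto
        show "(\<lambda>x. 2 * \<gamma> * ((x i - x j) / (\<epsilon> + (x i - x j)\<^sup>2))) \<in> borel_measurable (joint I)"
          by measurable
      qed
      with iI show ?thesis by measurable
    qed
    fix x :: "'i \<Rightarrow> real"
    define S where "S = (\<Sum>j\<in>I - {i}. 2 * \<gamma> * ((x i - x j) / (\<epsilon> + (x i - x j)\<^sup>2)))"
    have S: "\<bar>S\<bar> \<le> B" using sum_le[of "x i" x] by (simp add: S_def J_def)
    define f where "f = 1 + \<bar>x i\<bar>"
    have f: "f \<ge> 1" "\<bar>x i\<bar> \<le> f\<^sup>2" "(x i)\<^sup>2 \<le> f\<^sup>2" "1 \<le> f\<^sup>2"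
      unfolding f_def by (auto simp: power2_sum[of 1])
    have "\<bar>(a - c * x i) + (x i - d * (x i)\<^sup>2) * S\<bar>
        \<le> \<bar>a\<bar> + \<bar>c\<bar> * \<bar>x i\<bar> + (\<bar>x i\<bar> + \<bar>d\<bar> * (x i)\<^sup>2) * \<bar>S\<bar>"
      by (intro order_trans[OF abs_triangle_ineq] add_mono order_trans[OF abs_triangle_ineq4])
         (auto simp: abs_mult intro!: mult_right_mono order_trans[OF abs_triangle_ineq4])
    also have "\<dots> \<le> \<bar>a\<bar> * f\<^sup>2 + \<bar>c\<bar> * f\<^sup>2 + (f\<^sup>2 + \<bar>d\<bar> * f\<^sup>2) * B"
      using f S B mult_left_mono[OF f(4), of "\<bar>a\<bar>"] by (intro add_mono mult_mono mult_left_mono) auto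
    also have "\<dots> = (\<bar>a\<bar> + \<bar>c\<bar> + (1 + \<bar>d\<bar>) * B) * f\<^sup>2" by (simp add: algebra_simps)
    also have "\<dots> \<le> (\<bar>a\<bar> + \<bar>c\<bar> + (1 + \<bar>d\<bar>) * B) * (\<Prod>k\<in>I. 1 + \<bar>x k\<bar>)\<^sup>2"
    proof (intro mult_left_mono power_mono)
      have "(\<Prod>k\<in>{i}. 1 + \<bar>x k\<bar>) \<le> (\<Prod>k\<in>I. 1 + \<bar>x k\<bar>)"
        using assms by (intro prod_mono2) auto
      then show "f \<le> (\<Prod>k\<in>I. 1 + \<bar>x k\<bar>)" by (simp add: f_def)
    qed (use f B in auto)
    finally show "\<bar>(a - c * x i) + (x i - d * (x i)\<^sup>2) * (\<Sum>j\<in>I - {i}. 2 * \<gamma> * ((x i - x j) / (\<epsilon> + (x i - x j)\<^sup>2)))\<bar>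
       \<le> (\<bar>a\<bar> + \<bar>c\<bar> + (1 + \<bar>d\<bar>) * B) * (\<Prod>k\<in>I. 1 + \<bar>x k\<bar>)\<^sup>2"
      by (simp add: S_def)
  qed (use assms in auto)
  have inner: "(\<integral>t. ?F (x(i := t)) \<partial>M) = 0" for x :: "'i \<Rightarrow> real"
  proof -
    define P where "P t = (\<Prod>j\<in>J. (\<epsilon> + (t - x j)\<^sup>2) powr \<gamma>)" for t
    define L where "L t = (\<Sum>j\<in>J. 2 * \<gamma> * ((t - x j) / (\<epsilon> + (t - x j)\<^sup>2)))" for t
    have pos: "\<epsilon> + u\<^sup>2 > 0" for u :: real using \<epsilon> by (simp add: add_pos_nonneg)
    have P_exp: "P t = exp (\<Sum>j\<in>J. \<gamma> * ln (\<epsilon> + (t - x j)\<^sup>2))" for t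
      using pos unfolding P_def exp_sum[OF J(3)]
      by (intro prod.cong refl) (simp add: powr_def less_imp_neq[THEN not_sym])
    have deriv: "(P has_real_derivative P t * L t) (at t)" for t
    proof -
      have "((\<lambda>t. exp (\<Sum>j\<in>J. \<gamma> * ln (\<epsilon> + (t - x j)\<^sup>2))) has_real_derivative
         exp (\<Sum>j\<in>J. \<gamma> * ln (\<epsilon> + (t - x j)\<^sup>2)) * L t) (at t)"
        unfolding L_def using pos
        by (auto intro!: derivative_eq_intros sum.cong simp: field_simps)
      then show ?thesis unfolding P_exp[abs_def, symmetric] P_exp[symmetric] .
    qed
    have cont: "continuous_on UNIV (\<lambda>t. P t * L t)"
      unfolding P_def L_def using pos
      by (intro continuous_intros) (auto simp: less_imp_neq[THEN not_sym])
    obtain K :: nat where K: "\<gamma> \<le> K" using real_arch_simple by blast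
    define C where "C = (\<Prod>j\<in>J. (1 + \<bar>x j\<bar>) ^ (2 * K))"
    have "C \<ge> 1" unfolding C_def by (intro prod_ge_1) auto
    have P0: "P t \<ge> 0" for t unfolding P_def by (intro prod_nonneg) auto
    have "P t \<le> C * (1 + \<bar>t\<bar>) ^ (2 * K * card J)" for t
    proof -
      have "P t \<le> (\<Prod>j\<in>J. ((1 + \<bar>t\<bar>) * (1 + \<bar>x j\<bar>)) ^ (2 * K))"
        unfolding P_def using \<epsilon> assms K by (intro prod_mono conjI squared_gap_powr_le) auto
      also have "\<dots> = C * (1 + \<bar>t\<bar>) ^ (2 * K * card J)"
        by (simp add: power_mult_distrib prod.distrib C_def flip: power_mult)
      finally show ?thesis .
    qed
    then have bP: "P t \<le> C * (1 + \<bar>t\<bar>) ^ (2 * K * card J)" for t .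
    have "(\<integral>t. (a - c * t) * P t + (t - d * t\<^sup>2) * (P t * L t) \<partial>M) = 0"
    proof (rule pearson_identity[where C = "C * (1 + B)" and K = "2 * K * card J"])
      fix t :: real
      let ?g = "(1 + \<bar>t\<bar>) ^ (2 * K * card J)"
      have g0: "?g \<ge> 0" by simp
      have "\<bar>P t\<bar> * 1 \<le> (C * ?g) * (1 + B)"
        using P0 bP B \<open>C \<ge> 1\<close> by (intro mult_mono) auto
      then show "\<bar>P t\<bar> \<le> C * (1 + B) * ?g" by (simp add: mult_ac)
      have "\<bar>P t\<bar> * \<bar>L t\<bar> \<le> (C * ?g) * (1 + B)"
        using P0 bP B \<open>C \<ge> 1\<close> sum_le[of t x] by (intro mult_mono) (auto simp: L_def)
      then show "\<bar>P t * L t\<bar> \<le> C * (1 + B) * ?g" by (simp add: mult_ac abs_mult)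
    qed (use deriv cont in auto)
    moreover have "?F (x(i := t)) = ((\<Prod>k\<in>A. x k) * repulsion \<gamma> \<epsilon> J x) *
        ((a - c * t) * P t + (t - d * t\<^sup>2) * (P t * L t))" for t
    proof -
      have 1: "(\<Prod>k\<in>A. (x(i := t)) k) = (\<Prod>k\<in>A. x k)" using J by (intro prod.cong) auto
      have 2: "(\<Sum>j\<in>J. 2 * \<gamma> * ((t - (x(i := t)) j) / (\<epsilon> + (t - (x(i := t)) j)\<^sup>2))) = L t"
        unfolding L_def using J by (intro sum.cong) auto
      have 3: "repulsion \<gamma> \<epsilon> I (x(i := t)) = P t * repulsion \<gamma> \<epsilon> J x"
        unfolding J(1) P_def by (rule repulsion_fun_upd) fact+
      show ?thesis unfolding 1 3 fun_upd_same J_def[symmetric] 2 by (simp add: algebra_simps)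
    qed
    ultimately show ?thesis by simp
  qed
  have "(\<integral>x. ?F x \<partial>joint I) = (\<integral>x. (\<integral>t. ?F (x(i := t)) \<partial>M) \<partial>joint J)"
    using int unfolding J(1) by (intro product_integral_insert J(2,3))
  also have "\<dots> = 0" unfolding inner by simp
  finally show ?thesis .
qed

text \<open>The factor \<open>g n\<close> stands for the quotients \<open>u\<^sup>2 / (\<epsilon> + u\<^sup>2)\<close> that replace 1 as long as \<open>\<epsilon> > 0\<close>.
Where two coordinates coincide \<open>g n\<close> need not converge to 1, but there the limiting repulsion vanishes.\<close>

lemma integral_repulsion_limit:
  fixes I :: "'i set"
  assumes "finite I" "A \<subseteq> I" "\<gamma> > 0"
    and e: "e \<longlonglongrightarrow> 0" "\<And>n. 0 < e n" "\<And>n. e n \<le> 1"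
    and [measurable]: "\<And>n. g n \<in> borel_measurable (joint I)"
    and g: "\<And>n x. \<bar>g n x\<bar> \<le> 1"
    and lim: "\<And>x. repulsion \<gamma> 0 I x \<noteq> 0 \<Longrightarrow> (\<lambda>n. g n x) \<longlonglongrightarrow> 1"
  shows "(\<lambda>n. \<integral>x. (\<Prod>k\<in>A. x k) * repulsion \<gamma> (e n) I x * g n x \<partial>joint I)
     \<longlonglongrightarrow> (\<integral>x. (\<Prod>k\<in>A. x k) * repulsion \<gamma> 0 I x \<partial>joint I)"
proof -
  interpret product_sigma_finite "\<lambda>_::'i. M" by standard
  obtain K :: nat where K: "\<gamma> \<le> K" using real_arch_simple by blast
  note [measurable] = measurable_repulsion_term[OF assms(1,2)]
  let ?w = "\<lambda>x. 1 * (\<Prod>k\<in>I. (1 + \<bar>x k\<bar>) ^ (Suc (4 * K * card I) + 0))"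
  show ?thesis
  proof (rule integral_dominated_convergence[where w = ?w])
    show "integrable (joint I) ?w"
      by (intro integrable_mult_right product_integrable_prod assms integrable_growth)
    show "AE x in joint I. norm ((\<Prod>k\<in>A. x k) * repulsion \<gamma> (e n) I x * g n x) \<le> ?w x" for n
      using g[of n] e(2)[THEN less_imp_le, of n] e(3)[of n] less_imp_le[OF \<open>\<gamma> > 0\<close>] K assms(1,2) unfolding real_norm_def
      by (intro AE_I2 abs_repulsion_le) auto
    show "AE x in joint I. (\<lambda>n. (\<Prod>k\<in>A. x k) * repulsion \<gamma> (e n) I x * g n x)
        \<longlonglongrightarrow> (\<Prod>k\<in>A. x k) * repulsion \<gamma> 0 I x"
    proof (intro AE_I2)
      fix x
      have r: "(\<lambda>n. repulsion \<gamma> (e n) I x) \<longlonglongrightarrow> repulsion \<gamma> 0 I x"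
        by (rule repulsion_tendsto) fact+
      show "(\<lambda>n. (\<Prod>k\<in>A. x k) * repulsion \<gamma> (e n) I x * g n x) \<longlonglongrightarrow> (\<Prod>k\<in>A. x k) * repulsion \<gamma> 0 I x"
      proof (cases "repulsion \<gamma> 0 I x = 0")
        case True
        have "(\<lambda>n. (\<Prod>k\<in>A. x k) * repulsion \<gamma> (e n) I x * g n x) \<longlonglongrightarrow> 0"
        proof (rule Lim_null_comparison)
          have "norm ((\<Prod>k\<in>A. x k) * repulsion \<gamma> (e n) I x * g n x)
            \<le> \<bar>\<Prod>k\<in>A. x k\<bar> * repulsion \<gamma> (e n) I x" for n
            using mult_left_mono[OF g[of n x], of "\<bar>\<Prod>k\<in>A. x k\<bar> * repulsion \<gamma> (e n) I x"]
            by (simp add: abs_mult repulsion_nonneg)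
          then show "\<forall>\<^sub>F n in sequentially. norm ((\<Prod>k\<in>A. x k) * repulsion \<gamma> (e n) I x * g n x)
            \<le> \<bar>\<Prod>k\<in>A. x k\<bar> * repulsion \<gamma> (e n) I x" by simp
          show "(\<lambda>n. \<bar>\<Prod>k\<in>A. x k\<bar> * repulsion \<gamma> (e n) I x) \<longlonglongrightarrow> 0"
            using tendsto_mult_left[OF r, of "\<bar>\<Prod>k\<in>A. x k\<bar>"] True by simp
        qed
        with True show ?thesis by simp
      next
        case False
        show ?thesis
          using tendsto_mult[OF tendsto_mult[OF tendsto_const r] lim[OF False]] by simp
      qed
    qed
  qed measurable
qed

text \<open>In the identity above the singular terms are
\<open>(x\<^sub>i - d * x\<^sub>i\<^sup>2) * (\<Prod>k\<in>A. x\<^sub>k) / (x\<^sub>i - x\<^sub>j)\<close>. Averaging with the image under \<open>i \<leftrightarrow> j\<close> cancels the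
denominator: for \<open>j\<close> outside \<open>A\<close> what is left is \<open>1 - d * (x\<^sub>i + x\<^sub>j)\<close>, and for \<open>j\<close> in \<open>A\<close> the term with
\<open>d\<close> alone. By symmetry every integral that arises is the one for \<open>A\<close> or for \<open>insert i A\<close>, so counting the
\<open>j\<close> of each kind gives a linear relation between these two.\<close>

lemma aomoto_step:
  fixes I :: "'i set"
  assumes "finite I" "i \<in> I" "A \<subseteq> I - {i}" "\<gamma> > 0"
  defines "m \<equiv> \<lambda>B. \<integral>x. (\<Prod>k\<in>B. x k) * repulsion \<gamma> 0 I x \<partial>joint I"
  shows "(a + \<gamma> * (real (card I) - 1 - real (card A))) * m A
       = (c + \<gamma> * d * (2 * real (card I) - 2 - real (card A))) * m (insert i A)"
proof -
  note [measurable] = measurable_coordinate[OF assms(2)]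
  define \<rho> :: "real \<Rightarrow> real \<Rightarrow> real" where "\<rho> e u = u\<^sup>2 / (e + u\<^sup>2)" for e u
  define m1 where "m1 e B = (\<integral>x. (\<Prod>k\<in>B. x k) * repulsion \<gamma> e I x * 1 \<partial>joint I)" for e B
  define m2 where "m2 e B j = (\<integral>x. (\<Prod>k\<in>B. x k) * repulsion \<gamma> e I x * \<rho> e (x i - x j) \<partial>joint I)" for e B j
  have fA: "finite A" "i \<notin> A" "A \<subseteq> I" "insert i A \<subseteq> I" using assms finite_subset by auto
  have \<rho>: "\<bar>\<rho> e u\<bar> \<le> 1" if "e > 0" for e u
    using that by (simp add: \<rho>_def add_pos_nonneg)
  have Q1: "1 + \<bar>x i\<bar> \<le> (\<Prod>k\<in>I. 1 + \<bar>x k\<bar>)" for x :: "'i \<Rightarrow> real"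
    using assms prod_mono2[of I "{i}" "\<lambda>k. 1 + \<bar>x k\<bar>"] by auto
  have smoothed: "a * m1 e A - c * m1 e (insert i A)
      + \<gamma> * (\<Sum>j\<in>I - {i} - A. m2 e A j - d * m2 e (insert i A) j - d * m2 e (insert j A) j)
      - \<gamma> * d * (\<Sum>j\<in>A. m2 e (insert i A) j) = 0" if e: "0 < e" "e \<le> 1" for e
  proof -
    define T where "T j x = (\<Prod>k\<in>A. x k) * repulsion \<gamma> e I x *
        ((x i - d * (x i)\<^sup>2) * ((x i - x j) / (e + (x i - x j)\<^sup>2)))" for j and x :: "'i \<Rightarrow> real"
    have D: "e + u\<^sup>2 > 0" for u :: real using e by (simp add: add_pos_nonneg)
    have int1: "integrable (joint I) (\<lambda>x. (\<Prod>k\<in>B. x k) * repulsion \<gamma> e I x * 1)" if "B \<subseteq> I" for B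
      using assms that e by (intro integrable_repulsion[where C = 1 and m = 0]) auto
    have \<rho>_meas: "(\<lambda>x. \<rho> e (x i - x j)) \<in> borel_measurable (joint I)" if "j \<in> I" for j
    proof -
      note [measurable] = measurable_coordinate[OF that]
      show ?thesis unfolding \<rho>_def by measurable
    qed
    have int2: "integrable (joint I) (\<lambda>x. (\<Prod>k\<in>B. x k) * repulsion \<gamma> e I x * \<rho> e (x i - x j))"
      if "B \<subseteq> I" "j \<in> I" for B j
      using assms that e \<rho>[OF e(1)]
      by (intro integrable_repulsion[where C = 1 and m = 0] \<rho>_meas) auto
    have intT: "integrable (joint I) (T j)" if "j \<in> I" for j
      unfolding T_def
    proof (rule integrable_repulsion[where C = "(1 + \<bar>d\<bar>) / e" and m = 2])
      show "(\<lambda>x. (x i - d * (x i)\<^sup>2) * ((x i - x j) / (e + (x i - x j)\<^sup>2))) \<in> borel_measurable (joint I)"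
      proof -
        note [measurable] = measurable_coordinate[OF that]
        show ?thesis by measurable
      qed
      fix x :: "'i \<Rightarrow> real"
      let ?Q = "\<Prod>k\<in>I. 1 + \<bar>x k\<bar>"
      have f: "1 + \<bar>x i\<bar> \<ge> 1" "\<bar>x i\<bar> \<le> (1 + \<bar>x i\<bar>)\<^sup>2" "(x i)\<^sup>2 \<le> (1 + \<bar>x i\<bar>)\<^sup>2"
        by (auto simp: power2_sum[of 1])
      have "\<bar>x i - d * (x i)\<^sup>2\<bar> \<le> \<bar>x i\<bar> + \<bar>d\<bar> * (x i)\<^sup>2"
        by (intro order_trans[OF abs_triangle_ineq4]) (simp add: abs_mult)
      also have "\<dots> \<le> (1 + \<bar>x i\<bar>)\<^sup>2 + \<bar>d\<bar> * (1 + \<bar>x i\<bar>)\<^sup>2"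
        using f by (intro add_mono mult_left_mono) auto
      also have "\<dots> \<le> ?Q\<^sup>2 + \<bar>d\<bar> * ?Q\<^sup>2"
        using Q1[of x] by (intro add_mono mult_left_mono power_mono) auto
      finally have "\<bar>x i - d * (x i)\<^sup>2\<bar> \<le> (1 + \<bar>d\<bar>) * ?Q\<^sup>2" by (simp add: algebra_simps)
      from mult_mono[OF this smoothed_kernel_le[OF e, of "x i - x j"]]
      show "\<bar>(x i - d * (x i)\<^sup>2) * ((x i - x j) / (e + (x i - x j)\<^sup>2))\<bar> \<le> (1 + \<bar>d\<bar>) / e * ?Q\<^sup>2"
        by (simp add: abs_mult mult_ac)
    qed (use assms e in auto)
    let ?X = "\<lambda>B x. (\<Prod>k\<in>B. x k) * repulsion \<gamma> e I x * 1"
    have "0 = (\<integral>x. a * ?X A x - c * ?X (insert i A) x + (\<Sum>j\<in>I - {i}. 2 * \<gamma> * T j x) \<partial>joint I)"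
    proof -
      have "(\<Sum>j\<in>I - {i}. 2 * \<gamma> * T j x) = (\<Prod>k\<in>A. x k) * repulsion \<gamma> e I x * ((x i - d * (x i)\<^sup>2) *
          (\<Sum>j\<in>I - {i}. 2 * \<gamma> * ((x i - x j) / (e + (x i - x j)\<^sup>2))))" for x :: "'i \<Rightarrow> real"
        unfolding T_def sum_distrib_left by (intro sum.cong refl) (simp only: mult_ac)
      then have "a * ?X A x - c * ?X (insert i A) x + (\<Sum>j\<in>I - {i}. 2 * \<gamma> * T j x)
          = (\<Prod>k\<in>A. x k) * repulsion \<gamma> e I x * ((a - c * x i) + (x i - d * (x i)\<^sup>2) *
          (\<Sum>j\<in>I - {i}. 2 * \<gamma> * ((x i - x j) / (e + (x i - x j)\<^sup>2))))" for x :: "'i \<Rightarrow> real"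
        unfolding prod.insert[OF fA(1,2)] by (simp only:) (simp only: algebra_simps mult_1_right)
      then show ?thesis
        by (simp only: joint_pearson_identity[OF assms(1-3) e less_imp_le[OF assms(4)]])
    qed
    also have "\<dots> = (\<integral>x. a * ?X A x - c * ?X (insert i A) x \<partial>joint I)
       + (\<integral>x. (\<Sum>j\<in>I - {i}. 2 * \<gamma> * T j x) \<partial>joint I)"
      using fA intT by (intro Bochner_Integration.integral_add Bochner_Integration.integrable_diff
          integrable_mult_right int1 integrable_sum) auto
    also have "(\<integral>x. a * ?X A x - c * ?X (insert i A) x \<partial>joint I) = a * m1 e A - c * m1 e (insert i A)"
      unfolding m1_def Bochner_Integration.integral_diff[OF
          integrable_mult_right[OF int1[OF fA(3)]] integrable_mult_right[OF int1[OF fA(4)]]]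
      by (simp only: integral_mult_right_zero)
    also have "(\<integral>x. (\<Sum>j\<in>I - {i}. 2 * \<gamma> * T j x) \<partial>joint I)
       = (\<Sum>j\<in>I - {i}. 2 * \<gamma> * (\<integral>x. T j x \<partial>joint I))"
      using intT by (subst Bochner_Integration.integral_sum) auto
    also have "(\<Sum>j\<in>I - {i}. 2 * \<gamma> * (\<integral>x. T j x \<partial>joint I))
       = (\<Sum>j\<in>I - {i} - A. 2 * \<gamma> * (\<integral>x. T j x \<partial>joint I)) + (\<Sum>j\<in>A. 2 * \<gamma> * (\<integral>x. T j x \<partial>joint I))"
      using assms by (intro sum.subset_diff) auto
    also have "(\<Sum>j\<in>I - {i} - A. 2 * \<gamma> * (\<integral>x. T j x \<partial>joint I))
      = (\<Sum>j\<in>I - {i} - A. \<gamma> * (m2 e A j - d * m2 e (insert i A) j - d * m2 e (insert j A) j))"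
    proof (rule sum.cong[OF refl])
      fix j assume j: "j \<in> I - {i} - A"
      define G where "G x = (\<Prod>k\<in>A. x k) * repulsion \<gamma> e I x * \<rho> e (x i - x j)
         - d * ((\<Prod>k\<in>insert i A. x k) * repulsion \<gamma> e I x * \<rho> e (x i - x j))
         - d * ((\<Prod>k\<in>insert j A. x k) * repulsion \<gamma> e I x * \<rho> e (x i - x j))" for x :: "'i \<Rightarrow> real"
      have "(\<integral>x. T j x \<partial>joint I) = (\<integral>x. G x \<partial>joint I) / 2"
      proof (rule integral_eq_half_symmetrised[OF assms(1,2)])
        fix x :: "'i \<Rightarrow> real"
        let ?x = "\<lambda>k\<in>I. x (Transposition.transpose i j k)"
        have 1: "(\<Prod>k\<in>A. ?x k) = (\<Prod>k\<in>A. x k)"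
          using fA j by (intro prod.cong) (auto simp: Transposition.transpose_def)
        have 2: "?x i = x j" "?x j = x i" using assms j by auto
        define D' where "D' = e + (x i - x j)\<^sup>2"
        have D': "D' \<noteq> 0" "e + (x j - x i)\<^sup>2 = D'"
          using D[of "x i - x j"] by (auto simp: D'_def power2_commute)
        show "T j x + T j ?x = G x"
          unfolding T_def G_def 1 2 \<rho>_def prod.insert[OF fA(1,2)] 
          using j assms fA D'(1) unfolding D'(2) D'_def[symmetric]
          by (simp add: repulsion_swap prod.insert) (simp add: divide_inverse power2_eq_square algebra_simps)
      qed (use j intT in auto)
      also have "(\<integral>x. G x \<partial>joint I) = m2 e A j - d * m2 e (insert i A) j - d * m2 e (insert j A) j"
      proof -
        have j': "j \<in> I" "insert j A \<subseteq> I" using j fA by auto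
        note i1 = int2[OF fA(3) j'(1)] and i2 = integrable_mult_right[OF int2[OF fA(4) j'(1)], of d]
          and i3 = integrable_mult_right[OF int2[OF j'(2,1)], of d]
        show ?thesis
          unfolding G_def m2_def Bochner_Integration.integral_diff[OF Bochner_Integration.integrable_diff[OF i1 i2] i3]
            Bochner_Integration.integral_diff[OF i1 i2]
          by (simp only: integral_mult_right_zero)
      qed
      finally show "2 * \<gamma> * (\<integral>x. T j x \<partial>joint I)
        = \<gamma> * (m2 e A j - d * m2 e (insert i A) j - d * m2 e (insert j A) j)" by simp
    qed
    also have "(\<Sum>j\<in>A. 2 * \<gamma> * (\<integral>x. T j x \<partial>joint I)) = (\<Sum>j\<in>A. - \<gamma> * d * m2 e (insert i A) j)"
    proof (rule sum.cong[OF refl])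
      fix j assume j: "j \<in> A"
      define G where "G x = - d * ((\<Prod>k\<in>insert i A. x k) * repulsion \<gamma> e I x * \<rho> e (x i - x j))"
        for x :: "'i \<Rightarrow> real"
      have "(\<integral>x. T j x \<partial>joint I) = (\<integral>x. G x \<partial>joint I) / 2"
      proof (rule integral_eq_half_symmetrised[OF assms(1,2)])
        fix x :: "'i \<Rightarrow> real"
        let ?x = "\<lambda>k\<in>I. x (Transposition.transpose i j k)"
        define p where "p = (\<Prod>k\<in>A - {j}. x k)"
        have "(\<Prod>k\<in>A - {j}. ?x k) = p"
          using fA j unfolding p_def by (intro prod.cong) (auto simp: Transposition.transpose_def)
        moreover have 2: "?x i = x j" "?x j = x i" using assms j by auto
        ultimately have 1: "(\<Prod>k\<in>A. ?x k) = x i * p" "(\<Prod>k\<in>A. x k) = x j * p"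
          using prod.remove[OF fA(1) j, of ?x] prod.remove[OF fA(1) j, of x] by (simp_all add: p_def)
        define D' where "D' = e + (x i - x j)\<^sup>2"
        have D': "D' \<noteq> 0" "e + (x j - x i)\<^sup>2 = D'"
          using D[of "x i - x j"] by (auto simp: D'_def power2_commute)
        show "T j x + T j ?x = G x"
          unfolding T_def G_def prod.insert[OF fA(1,2)] 1 2 \<rho>_def
          using j assms fA D'(1) unfolding D'(2) D'_def[symmetric]
          by (simp add: repulsion_swap subsetD) (simp add: divide_inverse power2_eq_square algebra_simps)
      qed (use j fA intT in auto)
      then show "2 * \<gamma> * (\<integral>x. T j x \<partial>joint I) = - \<gamma> * d * m2 e (insert i A) j"
        by (simp add: G_def m2_def)
    qed
    finally show ?thesis by (simp add: sum_distrib_left sum_negf algebra_simps)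
  qed
  define e where "e n = inverse (real (Suc n))" for n
  have e: "e \<longlonglongrightarrow> 0" "\<And>n. 0 < e n" "\<And>n. e n \<le> 1"
    unfolding e_def using LIMSEQ_inverse_real_of_nat by (auto simp: inverse_eq_divide)
  have lim1: "(\<lambda>n. m1 (e n) B) \<longlonglongrightarrow> m B" if "B \<subseteq> I" for B
    unfolding m1_def m_def using that assms e by (intro integral_repulsion_limit) auto
  have lim2: "(\<lambda>n. m2 (e n) B j) \<longlonglongrightarrow> m B" if "B \<subseteq> I" "j \<in> I - {i}" for B j
    unfolding m2_def m_def
  proof (rule integral_repulsion_limit[OF assms(1) that(1) assms(4) e])
    show "(\<lambda>x. \<rho> (e n) (x i - x j)) \<in> borel_measurable (joint I)" for n
    proof -
      have "j \<in> I" using that by simp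
      note [measurable] = measurable_coordinate[OF this]
      show ?thesis unfolding \<rho>_def by measurable
    qed
    show "\<bar>\<rho> (e n) (x i - x j)\<bar> \<le> 1" for n x by (intro \<rho> e)
    fix x :: "'i \<Rightarrow> real" assume "repulsion \<gamma> 0 I x \<noteq> 0"
    then have "(0 + (x i - x j)\<^sup>2) powr (\<gamma> / 2) \<noteq> 0"
      using assms(1,2) that(2) by (force simp: repulsion_def)
    then have "(x i - x j)\<^sup>2 \<noteq> 0" by auto
    then have "(\<lambda>n. \<rho> (e n) (x i - x j)) \<longlonglongrightarrow> (x i - x j)\<^sup>2 / (0 + (x i - x j)\<^sup>2)"
      unfolding \<rho>_def by (intro tendsto_intros e) auto
    with \<open>(x i - x j)\<^sup>2 \<noteq> 0\<close> show "(\<lambda>n. \<rho> (e n) (x i - x j)) \<longlonglongrightarrow> 1" by simp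
  qed
  have sw: "m (insert j A) = m (insert i A)" if j: "j \<in> I - {i} - A" for j
  proof -
    have jI: "j \<in> I" using j by auto
    let ?\<tau> = "\<lambda>x::'i \<Rightarrow> real. \<lambda>k\<in>I. x (Transposition.transpose i j k)"
    have "m (insert j A) = (\<integral>x. (\<Prod>k\<in>insert j A. x k) * repulsion \<gamma> 0 I x \<partial>distr (joint I) (joint I) ?\<tau>)"
      unfolding m_def distr_swap[OF assms(1,2) jI] ..
    also have "\<dots> = (\<integral>x. (\<Prod>k\<in>insert j A. ?\<tau> x k) * repulsion \<gamma> 0 I (?\<tau> x) \<partial>joint I)"
      using jI fA by (intro integral_distr measurable_swap measurable_repulsion_term assms) auto
    also have "\<dots> = m (insert i A)"
    proof -
      have "(\<Prod>k\<in>insert j A. ?\<tau> x k) = (\<Prod>k\<in>insert i A. x k)" for x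
      proof -
        have "(\<Prod>k\<in>A. ?\<tau> x k) = (\<Prod>k\<in>A. x k)"
          using fA j by (intro prod.cong) (auto simp: Transposition.transpose_def)
        then show ?thesis using fA j jI by simp
      qed
      then show ?thesis unfolding m_def repulsion_swap[OF assms(1,2) jI] by simp
    qed
    finally show ?thesis .
  qed
  have "(\<lambda>n. a * m1 (e n) A - c * m1 (e n) (insert i A)
      + \<gamma> * (\<Sum>j\<in>I - {i} - A. m2 (e n) A j - d * m2 (e n) (insert i A) j - d * m2 (e n) (insert j A) j)
      - \<gamma> * d * (\<Sum>j\<in>A. m2 (e n) (insert i A) j))
     \<longlonglongrightarrow> a * m A - c * m (insert i A)
      + \<gamma> * (\<Sum>j\<in>I - {i} - A. m A - d * m (insert i A) - d * m (insert j A))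
      - \<gamma> * d * (\<Sum>j\<in>A. m (insert i A))"
    using assms(3) fA
    by (intro tendsto_add tendsto_diff tendsto_mult tendsto_sum tendsto_const lim1 lim2) auto
  then have "a * m A - c * m (insert i A)
      + \<gamma> * (\<Sum>j\<in>I - {i} - A. m A - d * m (insert i A) - d * m (insert j A))
      - \<gamma> * d * (\<Sum>j\<in>A. m (insert i A)) = 0"
    unfolding smoothed[OF e(2,3)] by (simp add: LIMSEQ_const_iff)
  also have "(\<Sum>j\<in>I - {i} - A. m A - d * m (insert i A) - d * m (insert j A))
     = (\<Sum>j\<in>I - {i} - A. m A - d * m (insert i A) - d * m (insert i A))"
    using sw by (intro sum.cong) auto
  also have "\<dots> = (real (card I) - 1 - real (card A)) * (m A - d * m (insert i A) - d * m (insert i A))"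
  proof -
    have "card (insert i A) \<le> card I" using fA assms by (intro card_mono) auto
    then have "real (card (I - {i} - A)) = real (card I) - 1 - real (card A)"
      using assms fA by (subst card_Diff_subset) auto
    then show ?thesis by simp
  qed
  finally show ?thesis by (simp add: algebra_simps)
qed

text \<open>Adding the coordinates to \<open>A\<close> one at a time, from the empty set to all of \<open>I\<close>.\<close>

lemma aomoto:
  fixes I :: "'i set"
  assumes "finite I" "\<gamma> > 0"
  defines "n \<equiv> card I"
  shows "(\<Prod>j<n. c + \<gamma> * d * (real n - 1 + real j)) * (\<integral>x. (\<Prod>k\<in>I. x k) * repulsion \<gamma> 0 I x \<partial>joint I)
       = (\<Prod>j<n. a + \<gamma> * real j) * (\<integral>x. repulsion \<gamma> 0 I x \<partial>joint I)"
proof -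
  define m where "m B = (\<integral>x. (\<Prod>k\<in>B. x k) * repulsion \<gamma> 0 I x \<partial>joint I)" for B
  have "(\<Prod>p<card A. c + \<gamma> * d * (2 * real n - 2 - real p)) * m A
      = (\<Prod>p<card A. a + \<gamma> * (real n - 1 - real p)) * m {}" if "A \<subseteq> I" for A
    using finite_subset[OF that assms(1)] that
  proof (induction A rule: finite_induct)
    case (insert i A)
    have "(a + \<gamma> * (real n - 1 - real (card A))) * m A
       = (c + \<gamma> * d * (2 * real n - 2 - real (card A))) * m (insert i A)"
      unfolding m_def n_def using insert assms by (intro aomoto_step) auto
    then have step: "(c + \<gamma> * d * (2 * real n - 2 - real (card A))) * m (insert i A)
       = (a + \<gamma> * (real n - 1 - real (card A))) * m A" ..
    have IH: "(\<Prod>p<card A. c + \<gamma> * d * (2 * real n - 2 - real p)) * m A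
      = (\<Prod>p<card A. a + \<gamma> * (real n - 1 - real p)) * m {}"
      using insert by auto
    have "(X * l) * mi = (Y * k) * m0" if "l * mi = k * mA" "X * mA = Y * m0" for X Y l k mi mA m0 :: real
      using that by algebra
    from this[OF step IH] show ?case
      unfolding card_insert_disjoint[OF insert(1,2)] prod.lessThan_Suc .
  qed simp
  from this[of I] have "(\<Prod>p<n. c + \<gamma> * d * (2 * real n - 2 - real p)) * m I
      = (\<Prod>p<n. a + \<gamma> * (real n - 1 - real p)) * m {}" by (simp add: n_def)
  also have "(\<Prod>p<n. c + \<gamma> * d * (2 * real n - 2 - real p)) = (\<Prod>j<n. c + \<gamma> * d * (real n - 1 + real j))"
    by (subst prod.nat_diff_reindex[symmetric]) (auto intro!: prod.cong simp: of_nat_diff algebra_simps)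
  also have "(\<Prod>p<n. a + \<gamma> * (real n - 1 - real p)) = (\<Prod>j<n. a + \<gamma> * real j)"
    by (subst prod.nat_diff_reindex[symmetric]) (auto intro!: prod.cong simp: of_nat_diff algebra_simps)
  finally show ?thesis by (simp add: m_def)
qed

end

section \<open>Gamma and beta weights\<close>

text \<open>Integration by parts on the support, an interval from 0 to a possibly infinite \<open>R\<close>; the boundary terms vanish by
the assumptions on the two ends.\<close>

lemma pearson_measureI:
  fixes w :: "real \<Rightarrow> real" and R :: ereal
  assumes R: "0 < R"
    and [measurable]: "w \<in> borel_measurable borel"
    and nonneg: "\<And>x. 0 \<le> w x"
    and supp: "\<And>x. x \<notin> einterval 0 R \<Longrightarrow> w x = 0"
    and cont: "\<And>x. 0 < ereal x \<Longrightarrow> ereal x < R \<Longrightarrow> isCont w x"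
    and deriv: "\<And>x. 0 < ereal x \<Longrightarrow> ereal x < R \<Longrightarrow>
       ((\<lambda>t. (t - d * t\<^sup>2) * w t) has_real_derivative (a - c * x) * w x) (at x)"
    and int: "\<And>K::nat. integrable lborel (\<lambda>x. w x * (1 + \<bar>x\<bar>) ^ K)"
    and left: "\<And>K::nat. ((\<lambda>t. (1 + \<bar>t\<bar>) ^ K * ((t - d * t\<^sup>2) * w t)) \<longlongrightarrow> 0) (at_right 0)"
    and right: "\<And>K::nat. (((\<lambda>t. (1 + \<bar>t\<bar>) ^ K * ((t - d * t\<^sup>2) * w t)) \<circ> real_of_ereal) \<longlongrightarrow> 0) (at_left R)"
  shows "pearson_measure (density lborel (\<lambda>x. ennreal (w x))) a c d"
proof
  show "sets (density lborel (\<lambda>x. ennreal (w x))) = sets borel" by simp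
  show "integrable (density lborel (\<lambda>x. ennreal (w x))) (\<lambda>t. (1 + \<bar>t\<bar>) ^ K)" for K :: nat
    using int[of K] nonneg by (subst integrable_density) auto
  fix P P' :: "real \<Rightarrow> real" and C :: real and K :: nat
  assume P: "\<And>t. (P has_real_derivative P' t) (at t)" and P'_cont: "continuous_on UNIV P'"
    and bP: "\<And>t. \<bar>P t\<bar> \<le> C * (1 + \<bar>t\<bar>) ^ K" and bP': "\<And>t. \<bar>P' t\<bar> \<le> C * (1 + \<bar>t\<bar>) ^ K"
  have P_cont: "continuous_on UNIV P"
    using P by (meson DERIV_isCont continuous_at_imp_continuous_on)
  have [measurable]: "P \<in> borel_measurable borel" "P' \<in> borel_measurable borel"
    using P_cont P'_cont by (auto intro: borel_measurable_continuous_onI)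
  define q where "q t = t - d * t\<^sup>2" for t
  define f where "f t = w t * ((a - c * t) * P t + q t * P' t)" for t
  have int_f: "integrable lborel f"
  proof (rule Bochner_Integration.integrable_bound)
    define D where "D = C * (\<bar>a\<bar> + \<bar>c\<bar> + 1 + \<bar>d\<bar>)"
    show "integrable lborel (\<lambda>x. D * (w x * (1 + \<bar>x\<bar>) ^ (K + 2)))"
      by (intro integrable_mult_right int)
    show "AE x in lborel. norm (f x) \<le> norm (D * (w x * (1 + \<bar>x\<bar>) ^ (K + 2)))"
    proof (intro AE_I2)
      fix x :: real
      define g where "g = 1 + \<bar>x\<bar>"
      have g: "g \<ge> 1" "1 \<le> g\<^sup>2" "\<bar>x\<bar> \<le> g\<^sup>2" "x\<^sup>2 \<le> g\<^sup>2" by (auto simp: g_def power2_sum[of 1])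
      have "\<bar>P x\<bar> \<le> C * g ^ K" "\<bar>P' x\<bar> \<le> C * g ^ K" using bP bP' by (auto simp: g_def)
      note PP = this
      have C: "0 \<le> C * g ^ K" using PP(1) by linarith
      have 1: "\<bar>a - c * x\<bar> \<le> (\<bar>a\<bar> + \<bar>c\<bar>) * g\<^sup>2"
      proof -
        have "\<bar>a - c * x\<bar> \<le> \<bar>a\<bar> * 1 + \<bar>c\<bar> * \<bar>x\<bar>"
          using abs_triangle_ineq4[of a "c * x"] by (simp add: abs_mult)
        also have "\<dots> \<le> \<bar>a\<bar> * g\<^sup>2 + \<bar>c\<bar> * g\<^sup>2" using g by (intro add_mono mult_left_mono) auto
        finally show ?thesis by (simp add: algebra_simps)
      qed
      have 2: "\<bar>q x\<bar> \<le> (1 + \<bar>d\<bar>) * g\<^sup>2"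
      proof -
        have "\<bar>q x\<bar> \<le> \<bar>x\<bar> + \<bar>d\<bar> * x\<^sup>2"
          using abs_triangle_ineq4[of x "d * x\<^sup>2"] by (simp add: abs_mult q_def)
        also have "\<dots> \<le> g\<^sup>2 + \<bar>d\<bar> * g\<^sup>2" using g by (intro add_mono mult_left_mono) auto
        finally show ?thesis by (simp add: algebra_simps)
      qed
      have "\<bar>(a - c * x) * P x + q x * P' x\<bar> \<le> \<bar>a - c * x\<bar> * \<bar>P x\<bar> + \<bar>q x\<bar> * \<bar>P' x\<bar>"
        using abs_triangle_ineq[of "(a - c * x) * P x" "q x * P' x"] by (simp add: abs_mult)
      also have "\<dots> \<le> (\<bar>a\<bar> + \<bar>c\<bar>) * g\<^sup>2 * (C * g ^ K) + (1 + \<bar>d\<bar>) * g\<^sup>2 * (C * g ^ K)"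
        using 1 2 PP C by (intro add_mono mult_mono) auto
      also have "\<dots> = D * g ^ (K + 2)" by (simp add: D_def algebra_simps power_add power2_eq_square)
      finally have "w x * \<bar>(a - c * x) * P x + q x * P' x\<bar> \<le> w x * (D * g ^ (K + 2))"
        using nonneg by (intro mult_left_mono) auto
      moreover have "norm (f x) = w x * \<bar>(a - c * x) * P x + q x * P' x\<bar>"
        using nonneg[of x] by (simp add: f_def abs_mult)
      ultimately have "norm (f x) \<le> D * (w x * g ^ (K + 2))" by (simp only: mult_ac)
      also have "\<dots> \<le> norm (D * (w x * (1 + \<bar>x\<bar>) ^ (K + 2)))"
        unfolding g_def real_norm_def by (rule abs_ge_self)
      finally show "norm (f x) \<le> norm (D * (w x * (1 + \<bar>x\<bar>) ^ (K + 2)))" .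
    qed
    show "f \<in> borel_measurable lborel" unfolding f_def[abs_def] q_def by measurable
  qed
  have "(LBINT x=0..R. f x) = 0 - 0"
  proof (rule interval_integral_FTC_integrable[OF R])
    fix x assume x: "0 < ereal x" "ereal x < R"
    have "((\<lambda>t. (q t * w t) * P t) has_real_derivative f x) (at x)"
      unfolding q_def f_def by (rule derivative_eq_intros deriv x P refl)+ (simp add: algebra_simps)
    then show "((\<lambda>t. (q t * w t) * P t) has_vector_derivative f x) (at x)"
      by (simp add: has_real_derivative_iff_has_vector_derivative)
    have "isCont P x" "isCont P' x"
      using P_cont P'_cont by (auto simp: continuous_on_eq_continuous_at)
    then show "isCont f x" unfolding f_def q_def using cont[OF x] by (intro continuous_intros) auto
  next
    show "set_integrable lborel (einterval 0 R) f"
      unfolding set_integrable_def using int_f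
      by (intro integrable_mult_indicator) auto
    have bd: "\<bar>(q t * w t) * P t\<bar> \<le> \<bar>C * ((1 + \<bar>t\<bar>) ^ K * ((t - d * t\<^sup>2) * w t))\<bar>" for t
    proof -
      have "\<bar>q t * w t\<bar> * \<bar>P t\<bar> \<le> \<bar>q t * w t\<bar> * (C * (1 + \<bar>t\<bar>) ^ K)"
        using bP by (intro mult_left_mono) auto
      also have "\<dots> \<le> \<bar>C * ((1 + \<bar>t\<bar>) ^ K * (q t * w t))\<bar>"
        by (simp add: abs_mult mult_ac) (intro mult_right_mono mult_left_mono abs_ge_self; simp)
      finally show ?thesis by (simp add: abs_mult q_def mult_ac)
    qed
    have "((\<lambda>t. (q t * w t) * P t) \<longlongrightarrow> 0) (at_right 0)"
      by (rule Lim_null_comparison[OF _ tendsto_rabs_zero[OF tendsto_mult_right_zero[OF left[of K], of C]]])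
         (use bd in simp)
    then show "(((\<lambda>t. (q t * w t) * P t) \<circ> real_of_ereal) \<longlongrightarrow> 0) (at_right 0)"
      by (simp add: zero_ereal_def ereal_tendsto_simps)
    show "(((\<lambda>t. (q t * w t) * P t) \<circ> real_of_ereal) \<longlongrightarrow> 0) (at_left R)"
      by (rule Lim_null_comparison[OF _ tendsto_rabs_zero[OF tendsto_mult_right_zero[OF right[of K], of C]]])
         (intro always_eventually allI, simp only: o_def real_norm_def bd)
  qed
  moreover have "(LBINT x=0..R. f x) = (\<integral>x. f x \<partial>lborel)"
  proof -
    have "(LBINT x=0..R. f x) = (\<integral>x. indicator (einterval 0 R) x *\<^sub>R f x \<partial>lborel)"
      using R by (simp add: interval_lebesgue_integral_def set_lebesgue_integral_def less_imp_le)
    also have "\<dots> = (\<integral>x. f x \<partial>lborel)"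
      using supp by (intro Bochner_Integration.integral_cong) (auto simp: indicator_def f_def)
    finally show ?thesis .
  qed
  ultimately have "(\<integral>x. f x \<partial>lborel) = 0" by simp
  then show "(\<integral>t. (a - c * t) * P t + (t - d * t\<^sup>2) * P' t \<partial>density lborel (\<lambda>x. ennreal (w x))) = 0"
    using nonneg by (subst integral_density) (auto simp: f_def q_def)
qed

lemma integrable_powr_exp:
  fixes a :: real
  assumes "a > 0"
  shows "integrable lborel (\<lambda>t. indicator {0<..} t * (t powr (a - 1) * exp (- t / 2)))"
proof -
  have "(\<lambda>t. complex_of_real t powr (complex_of_real a - 1) / of_real (exp ((1/2) * t)))
             absolutely_integrable_on {0<..}"
    by (rule absolutely_integrable_Gamma_integral) (use assms in auto)
  then have "integrable lebesgue (\<lambda>t. norm (indicator {0<..} t *\<^sub>R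
     (complex_of_real t powr (complex_of_real a - 1) / of_real (exp ((1/2) * t)))))"
    unfolding set_integrable_def by (rule integrable_norm)
  also have "(\<lambda>t. norm (indicator {0<..} t *\<^sub>R
     (complex_of_real t powr (complex_of_real a - 1) / of_real (exp ((1/2) * t)))))
     = (\<lambda>t. indicator {0<..} t * (t powr (a - 1) * exp (- t / 2)))"
    by (auto simp: indicator_def norm_divide norm_powr_real_powr exp_minus field_simps fun_eq_iff)
  finally show ?thesis by (subst (asm) integrable_completion) auto
qed

lemma one_plus_power_le:
  fixes t :: real
  assumes "t > 0"
  shows "(1 + \<bar>t\<bar>) ^ K \<le> 2 ^ K * (1 + t ^ K)"
proof (cases "t \<le> 1")
  case True
  then have "(1 + \<bar>t\<bar>) ^ K \<le> 2 ^ K" using assms by (intro power_mono) auto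
  also have "\<dots> \<le> 2 ^ K * (1 + t ^ K)" using assms by simp
  finally show ?thesis .
next
  case False
  then have "(1 + \<bar>t\<bar>) ^ K \<le> (2 * t) ^ K" using assms by (intro power_mono) auto
  also have "\<dots> \<le> 2 ^ K * (1 + t ^ K)" by (simp add: power_mult_distrib)
  finally show ?thesis .
qed

text \<open>The two weights are stripped of the factor \<open>x powr (a - 1)\<close>: its exponent is the variable of the recursion.\<close>

definition laguerre_weight :: "real \<Rightarrow> real" where
  "laguerre_weight x = exp (- x / 2) * indicator {0<..} x"

definition jacobi_weight :: "real \<Rightarrow> real \<Rightarrow> real" where
  "jacobi_weight b x = (1 - x) powr (b - 1) * indicator {0<..<1} x"

lemma mult_powr_diff_one: "t * t powr (a - 1) = t powr a" if "t > 0" for t a :: real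
  using powr_mult_base[of t "a - 1"] that by simp

lemma pearson_laguerre:
  assumes "a > 0"
  shows "pearson_measure (density lborel (\<lambda>x. ennreal (x powr (a - 1) * laguerre_weight x))) a (1 / 2) 0"
proof (rule pearson_measureI[where R = \<infinity>])
  let ?w = "\<lambda>x. x powr (a - 1) * laguerre_weight x"
  show "?w \<in> borel_measurable borel" unfolding laguerre_weight_def by measurable
  show "0 \<le> ?w x" for x by (simp add: laguerre_weight_def)
  show "?w x = 0" if "x \<notin> einterval 0 \<infinity>" for x
    using that by (simp add: laguerre_weight_def einterval_def indicator_def)
  have ev: "\<forall>\<^sub>F t in nhds x. ?w t = t powr (a - 1) * exp (- t / 2)" if "x > 0" for x
    using eventually_nhds_in_open[of "{0<..}" x] that
    by (auto elim!: eventually_mono simp: laguerre_weight_def)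
  fix x :: real assume "0 < ereal x"
  then have x: "x > 0" by simp
  show "isCont ?w x"
  proof -
    have "isCont (\<lambda>t. t powr (a - 1) * exp (- t / 2)) x" using x by (intro continuous_intros) auto
    then show ?thesis using isCont_cong[OF ev[OF x]] by simp
  qed
  have "((\<lambda>t. t powr a * exp (- t / 2)) has_real_derivative (a - x / 2) * (x powr (a - 1) * exp (- x / 2))) (at x)"
    using x by (auto intro!: derivative_eq_intros simp: algebra_simps mult_powr_diff_one[symmetric, of x a])
  moreover have "\<forall>\<^sub>F t in nhds x. (t - 0 * t\<^sup>2) * ?w t = t powr a * exp (- t / 2)"
    using eventually_nhds_in_open[of "{0<..}" x] x
    by (auto elim!: eventually_mono simp: laguerre_weight_def mult_powr_diff_one simp flip: mult.assoc)
  ultimately show "((\<lambda>t. (t - 0 * t\<^sup>2) * ?w t) has_real_derivative (a - 1 / 2 * x) * ?w x) (at x)"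
    using x by (subst DERIV_cong_ev[OF refl _ refl]) (auto simp: laguerre_weight_def)
next
  fix K :: nat
  let ?w = "\<lambda>x. x powr (a - 1) * laguerre_weight x"
  let ?g = "\<lambda>x. indicator {0<..} x * (x powr (a - 1) * exp (- x / 2))
     + indicator {0<..} x * (x powr ((a + K) - 1) * exp (- x / 2))"
  show "integrable lborel (\<lambda>x. ?w x * (1 + \<bar>x\<bar>) ^ K)"
  proof (rule Bochner_Integration.integrable_bound)
    show "integrable lborel (\<lambda>x. 2 ^ K * ?g x)"
      using assms by (intro integrable_mult_right Bochner_Integration.integrable_add integrable_powr_exp) auto
    show "(\<lambda>x. ?w x * (1 + \<bar>x\<bar>) ^ K) \<in> borel_measurable lborel"
      unfolding laguerre_weight_def by measurable
    show "AE x in lborel. norm (?w x * (1 + \<bar>x\<bar>) ^ K) \<le> norm (2 ^ K * ?g x)"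
    proof (intro AE_I2)
      fix x :: real
      show "norm (?w x * (1 + \<bar>x\<bar>) ^ K) \<le> norm (2 ^ K * ?g x)"
      proof (cases "x > 0")
        case True
        have "?w x * (1 + \<bar>x\<bar>) ^ K \<le> ?w x * (2 ^ K * (1 + x ^ K))"
          by (intro mult_left_mono one_plus_power_le True) (simp add: laguerre_weight_def)
        also have "\<dots> = 2 ^ K * ?g x"
          using True by (simp add: laguerre_weight_def algebra_simps powr_realpow[symmetric] flip: powr_add)
        finally show ?thesis using True by (simp add: laguerre_weight_def)
      qed (simp add: laguerre_weight_def)
    qed
  qed
  show "((\<lambda>t. (1 + \<bar>t\<bar>) ^ K * ((t - 0 * t\<^sup>2) * ?w t)) \<longlongrightarrow> 0) (at_right 0)"
  proof (rule Lim_transform_eventually)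
    show "((\<lambda>t. (1 + \<bar>t\<bar>) ^ K * (t powr a * exp (- t / 2))) \<longlongrightarrow> 0) (at_right 0)"
    proof -
      have "((\<lambda>t. t powr a) \<longlongrightarrow> 0 powr a) (at_right (0::real))"
        using assms eventually_at_right_less[of "0::real"]
        by (intro tendsto_powr2) (auto elim: eventually_mono)
      then have "((\<lambda>t. (1 + \<bar>t\<bar>) ^ K * (t powr a * exp (- t / 2))) \<longlongrightarrow> (1 + \<bar>0\<bar>) ^ K * (0 powr a * exp (- 0 / 2))) (at_right 0)"
        by (intro tendsto_mult[OF _ tendsto_mult]) (assumption | rule tendsto_intros | simp)+
      then show ?thesis by simp
    qed
    show "\<forall>\<^sub>F t in at_right 0. (1 + \<bar>t\<bar>) ^ K * (t powr a * exp (- t / 2)) = (1 + \<bar>t\<bar>) ^ K * ((t - 0 * t\<^sup>2) * ?w t)"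
      using eventually_at_right_less[of 0]
      by eventually_elim (auto simp: laguerre_weight_def powr_diff)
  qed
  have "((\<lambda>t. (1 + \<bar>t\<bar>) ^ K * ((t - 0 * t\<^sup>2) * ?w t)) \<longlongrightarrow> 0) at_top"
  proof (rule Lim_transform_eventually)
    show "((\<lambda>t. (1 + t) ^ K * (t powr a * exp (- t / 2))) \<longlongrightarrow> 0) at_top"
      by real_asymp
    show "\<forall>\<^sub>F t in at_top. (1 + t) ^ K * (t powr a * exp (- t / 2)) = (1 + \<bar>t\<bar>) ^ K * ((t - 0 * t\<^sup>2) * ?w t)"
      using eventually_gt_at_top[of 0]
      by eventually_elim (auto simp: laguerre_weight_def powr_diff)
  qed
  then show "(((\<lambda>t. (1 + \<bar>t\<bar>) ^ K * ((t - 0 * t\<^sup>2) * ?w t)) \<circ> real_of_ereal) \<longlongrightarrow> 0) (at_left \<infinity>)"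
    by (simp add: ereal_tendsto_simps)
qed simp

lemma jacobi_weight_eq:
  assumes "0 < t" "t < 1"
  shows "(t - t\<^sup>2) * (t powr (a - 1) * jacobi_weight b t) = t powr a * (1 - t) powr b"
proof -
  have "(t - t\<^sup>2) * (t powr (a - 1) * jacobi_weight b t) = (t * t powr (a - 1)) * ((1 - t) * (1 - t) powr (b - 1))"
    using assms by (simp add: jacobi_weight_def power2_eq_square algebra_simps)
  then show ?thesis using assms by (simp add: mult_powr_diff_one)
qed

lemma pearson_jacobi:
  assumes "a > 0" "b > 0"
  shows "pearson_measure (density lborel (\<lambda>x. ennreal (x powr (a - 1) * jacobi_weight b x))) a (a + b) 1"
proof (rule pearson_measureI[where R = 1])
  let ?w = "\<lambda>x. x powr (a - 1) * jacobi_weight b x"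
  show "?w \<in> borel_measurable borel" unfolding jacobi_weight_def by measurable
  show "0 \<le> ?w x" for x by (simp add: jacobi_weight_def)
  show "?w x = 0" if "x \<notin> einterval 0 1" for x
    using that by (simp add: jacobi_weight_def einterval_def indicator_def)
  have ev: "\<forall>\<^sub>F t in nhds x. ?w t = t powr (a - 1) * (1 - t) powr (b - 1)" if "x > 0" "x < 1" for x
    using eventually_nhds_in_open[of "{0<..<1}" x] that
    by (auto elim!: eventually_mono simp: jacobi_weight_def)
  fix x :: real assume "0 < ereal x" "ereal x < 1"
  then have x: "x > 0" "x < 1" by simp_all
  show "isCont ?w x"
  proof -
    have "isCont (\<lambda>t. t powr (a - 1) * (1 - t) powr (b - 1)) x" using x by (intro continuous_intros) auto
    then show ?thesis using isCont_cong[OF ev[OF x]] by simp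
  qed
  have "((\<lambda>t. t powr a * (1 - t) powr b) has_real_derivative (a - (a + b) * x) * (x powr (a - 1) * (1 - x) powr (b - 1))) (at x)"
    using x by (auto intro!: derivative_eq_intros
        simp: algebra_simps mult_powr_diff_one[symmetric, of x a] mult_powr_diff_one[symmetric, of "1 - x" b])
  moreover have "\<forall>\<^sub>F t in nhds x. (t - 1 * t\<^sup>2) * ?w t = t powr a * (1 - t) powr b"
    using eventually_nhds_in_open[of "{0<..<1}" x] x
    by (auto elim!: eventually_mono simp: jacobi_weight_eq)
  ultimately show "((\<lambda>t. (t - 1 * t\<^sup>2) * ?w t) has_real_derivative (a - (a + b) * x) * ?w x) (at x)"
    using x by (subst DERIV_cong_ev[OF refl _ refl]) (auto simp: jacobi_weight_def)
next
  fix K :: nat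
  let ?w = "\<lambda>x. x powr (a - 1) * jacobi_weight b x"
  have eq: "(t - 1 * t\<^sup>2) * ?w t = t powr a * (1 - t) powr b" if "0 < t" "t < 1" for t
    using that by (simp add: jacobi_weight_eq)
  show "integrable lborel (\<lambda>x. ?w x * (1 + \<bar>x\<bar>) ^ K)"
  proof (rule Bochner_Integration.integrable_bound)
    show "integrable lborel (\<lambda>x. 2 ^ K * (indicator {0..1} x *\<^sub>R (x powr (a - 1) * (1 - x) powr (b - 1))))"
      using integrable_Beta[OF assms] unfolding set_integrable_def by (rule integrable_mult_right)
    show "(\<lambda>x. ?w x * (1 + \<bar>x\<bar>) ^ K) \<in> borel_measurable lborel"
      unfolding jacobi_weight_def by measurable
    show "AE x in lborel. norm (?w x * (1 + \<bar>x\<bar>) ^ K)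
        \<le> norm (2 ^ K * (indicator {0..1} x *\<^sub>R (x powr (a - 1) * (1 - x) powr (b - 1))))"
    proof (intro AE_I2)
      fix x :: real
      show "norm (?w x * (1 + \<bar>x\<bar>) ^ K)
        \<le> norm (2 ^ K * (indicator {0..1} x *\<^sub>R (x powr (a - 1) * (1 - x) powr (b - 1))))"
      proof (cases "x > 0 \<and> x < 1")
        case True
        then have "?w x * (1 + \<bar>x\<bar>) ^ K \<le> ?w x * 2 ^ K"
          by (intro mult_left_mono power_mono) (auto simp: jacobi_weight_def)
        then show ?thesis using True by (simp add: jacobi_weight_def mult_ac)
      qed (auto simp: jacobi_weight_def)
    qed
  qed
  show "((\<lambda>t. (1 + \<bar>t\<bar>) ^ K * ((t - 1 * t\<^sup>2) * ?w t)) \<longlongrightarrow> 0) (at_right 0)"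
  proof (rule Lim_transform_eventually)
    show "((\<lambda>t. (1 + \<bar>t\<bar>) ^ K * (t powr a * (1 - t) powr b)) \<longlongrightarrow> 0) (at_right 0)"
    proof -
      have "((\<lambda>t. t powr a) \<longlongrightarrow> 0 powr a) (at_right (0::real))"
        using assms eventually_at_right_less[of "0::real"]
        by (intro tendsto_powr2) (auto elim: eventually_mono)
      then have "((\<lambda>t. (1 + \<bar>t\<bar>) ^ K * (t powr a * (1 - t) powr b)) \<longlongrightarrow> (1 + \<bar>0\<bar>) ^ K * (0 powr a * (1 - 0) powr b)) (at_right 0)"
        by (intro tendsto_mult[OF _ tendsto_mult]) (assumption | rule tendsto_intros | simp)+
      then show ?thesis by simp
    qed
    show "\<forall>\<^sub>F t in at_right 0. (1 + \<bar>t\<bar>) ^ K * (t powr a * (1 - t) powr b) = (1 + \<bar>t\<bar>) ^ K * ((t - 1 * t\<^sup>2) * ?w t)"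
      using eventually_at_right_less[of 0] eventually_at_right_real[of 0 1, OF zero_less_one]
      by eventually_elim (subst eq; simp)
  qed
  have "((\<lambda>t. (1 + \<bar>t\<bar>) ^ K * ((t - 1 * t\<^sup>2) * ?w t)) \<longlongrightarrow> 0) (at_left 1)"
  proof (rule Lim_transform_eventually)
    show "((\<lambda>t. (1 + \<bar>t\<bar>) ^ K * (t powr a * (1 - t) powr b)) \<longlongrightarrow> 0) (at_left 1)"
    proof -
      have "((\<lambda>t. (1 - t) powr b) \<longlongrightarrow> (1 - 1) powr b) (at_left (1::real))"
        using assms eventually_at_left_real[of 0 1, OF zero_less_one]
        by (intro tendsto_powr2 tendsto_intros) (auto elim: eventually_mono)
      then have "((\<lambda>t. (1 - t) powr b) \<longlongrightarrow> 0) (at_left (1::real))" by simp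
      then have "((\<lambda>t. (1 + \<bar>t\<bar>) ^ K * (t powr a * (1 - t) powr b)) \<longlongrightarrow> (1 + \<bar>1\<bar>) ^ K * (1 powr a * 0)) (at_left 1)"
        by (intro tendsto_intros) auto
      then show ?thesis by simp
    qed
    show "\<forall>\<^sub>F t in at_left 1. (1 + \<bar>t\<bar>) ^ K * (t powr a * (1 - t) powr b) = (1 + \<bar>t\<bar>) ^ K * ((t - 1 * t\<^sup>2) * ?w t)"
      using eventually_at_left_real[of 0 1, OF zero_less_one]
      by eventually_elim (subst eq; simp)
  qed
  then show "(((\<lambda>t. (1 + \<bar>t\<bar>) ^ K * ((t - 1 * t\<^sup>2) * ?w t)) \<circ> real_of_ereal) \<longlongrightarrow> 0) (at_left 1)"
    by (simp add: one_ereal_def ereal_tendsto_simps)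
qed simp

text \<open>Moving between a product of densities and the density of a product: Aomoto's recursion lives on product
measures, while the ensembles are given by densities with respect to Lebesgue measure.\<close>

lemma (in product_sigma_finite) PiM_density:
  fixes f :: "'i \<Rightarrow> 'a \<Rightarrow> ennreal"
  assumes I: "finite I" and [measurable]: "\<And>i. f i \<in> borel_measurable (M i)"
    and sf: "\<And>i. sigma_finite_measure (density (M i) (f i))"
  shows "Pi\<^sub>M I (\<lambda>i. density (M i) (f i)) = density (Pi\<^sub>M I M) (\<lambda>x. \<Prod>i\<in>I. f i (x i))"
proof -
  interpret D: product_sigma_finite "\<lambda>i. density (M i) (f i)" by (intro product_sigma_finite.intro sf)
  have meas: "(\<lambda>x. \<Prod>i\<in>I. f i (x i)) \<in> borel_measurable (Pi\<^sub>M I M)"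
    by (intro borel_measurable_prod_ennreal measurable_compose[OF measurable_component_singleton]) auto
  have "density (Pi\<^sub>M I M) (\<lambda>x. \<Prod>i\<in>I. f i (x i)) = Pi\<^sub>M I (\<lambda>i. density (M i) (f i))"
  proof (rule D.PiM_eqI)
    show "sets (density (Pi\<^sub>M I M) (\<lambda>x. \<Prod>i\<in>I. f i (x i))) = sets (Pi\<^sub>M I (\<lambda>i. density (M i) (f i)))"
      by (simp cong: sets_PiM_cong)
    fix A assume A: "\<And>i. i \<in> I \<Longrightarrow> A i \<in> sets (density (M i) (f i))"
    have "emeasure (density (Pi\<^sub>M I M) (\<lambda>x. \<Prod>i\<in>I. f i (x i))) (Pi\<^sub>E I A)
        = (\<integral>\<^sup>+x. (\<Prod>i\<in>I. f i (x i)) * indicator (Pi\<^sub>E I A) x \<partial>Pi\<^sub>M I M)"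
      using A I meas by (intro emeasure_density sets_PiM_I_finite) auto
    also have "\<dots> = (\<integral>\<^sup>+x. (\<Prod>i\<in>I. f i (x i) * indicator (A i) (x i)) \<partial>Pi\<^sub>M I M)"
    proof (rule nn_integral_cong)
      fix x assume "x \<in> space (Pi\<^sub>M I M)"
      then have "indicator (Pi\<^sub>E I A) x = (\<Prod>i\<in>I. indicator (A i) (x i) :: ennreal)"
        using I by (auto simp: indicator_def space_PiM PiE_iff prod_zero_iff)
      then show "(\<Prod>i\<in>I. f i (x i)) * indicator (Pi\<^sub>E I A) x = (\<Prod>i\<in>I. f i (x i) * indicator (A i) (x i))"
        by (simp add: prod.distrib)
    qed
    also have "\<dots> = (\<Prod>i\<in>I. \<integral>\<^sup>+x. f i x * indicator (A i) x \<partial>M i)"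
      using A I by (intro product_nn_integral_prod) auto
    also have "\<dots> = (\<Prod>i\<in>I. emeasure (density (M i) (f i)) (A i))"
      using A by (intro prod.cong refl emeasure_density[symmetric]) auto
    finally show "emeasure (density (Pi\<^sub>M I M) (\<lambda>x. \<Prod>i\<in>I. f i (x i))) (Pi\<^sub>E I A)
       = (\<Prod>i\<in>I. emeasure (density (M i) (f i)) (A i))" .
  qed fact
  then show ?thesis ..
qed

section \<open>Determination of Selberg quotients by log-convexity\<close>

text \<open>As in the theorem of Bohr and Mollerup: log-convexity bounds \<open>F (x + s)\<close> from above by interpolation
between \<open>x\<close> and \<open>x + 1\<close>, and from below because \<open>x + 1\<close> lies between \<open>x + s\<close> and \<open>x + s + 1\<close>. Both
bounds agree asymptotically as the shift factor \<open>R\<close> varies slowly.\<close>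

lemma log_convex_shift_asymptotics:
  fixes F R :: "real \<Rightarrow> real"
  assumes pos: "\<And>x. x > 0 \<Longrightarrow> F x > 0" "\<And>x. x > 0 \<Longrightarrow> R x > 0"
    and shift: "\<And>x. x > 0 \<Longrightarrow> F (x + 1) = R x * F x"
    and conv: "\<And>x y t. 0 < x \<Longrightarrow> 0 < y \<Longrightarrow> 0 \<le> t \<Longrightarrow> t \<le> 1 \<Longrightarrow>
        F ((1 - t) * x + t * y) \<le> F x powr (1 - t) * F y powr t"
    and slow: "\<And>s. ((\<lambda>x. R (x + s) / R x) \<longlongrightarrow> 1) at_top"
    and s: "0 \<le> s" "s \<le> 1"
  shows "((\<lambda>x. F (x + s) / (F x * R x powr s)) \<longlongrightarrow> 1) at_top"
proof (rule tendsto_sandwich)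
  show "\<forall>\<^sub>F x in at_top. F (x + s) / (F x * R x powr s) \<le> 1"
    using eventually_gt_at_top[of 0]
  proof eventually_elim
    case (elim x)
    have "F (x + s) \<le> F x powr (1 - s) * F (x + 1) powr s"
      using conv[of x "x + 1" s] elim s by (simp add: algebra_simps)
    also have "\<dots> = F x powr (1 - s) * F x powr s * R x powr s"
      using pos[OF elim] elim by (simp add: shift powr_mult)
    also have "\<dots> = F x * R x powr s" using pos[OF elim] by (simp flip: powr_add)
    finally show ?case using pos[OF elim] by (simp add: divide_le_eq)
  qed
  show "\<forall>\<^sub>F x in at_top. (R (x + s) / R x) powr (s - 1) \<le> F (x + s) / (F x * R x powr s)"
    using eventually_gt_at_top[of 0]
  proof eventually_elim
    case (elim x)
    note p = pos[OF elim] pos[of "x + s"]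
    have xs: "x + s > 0" using elim s by simp
    have "(1 - (1 - s)) * (x + s) + (1 - s) * (x + s + 1) = x + 1" by (simp add: algebra_simps)
    then have "F (x + 1) \<le> F (x + s) powr s * F (x + s + 1) powr (1 - s)"
      using conv[of "x + s" "x + s + 1" "1 - s"] xs s by (simp add: algebra_simps)
    also have "\<dots> = F (x + s) powr s * F (x + s) powr (1 - s) * R (x + s) powr (1 - s)"
      using p xs by (simp add: shift[OF xs] powr_mult)
    also have "\<dots> = F (x + s) * R (x + s) powr (1 - s)" using p xs by (simp flip: powr_add)
    finally have "R x * F x \<le> F (x + s) * R (x + s) powr (1 - s)" using shift[OF elim] by simp
    then have *: "R x * F x / R (x + s) powr (1 - s) \<le> F (x + s)"
      using p xs by (simp add: divide_le_eq)
    have "(R (x + s) / R x) powr (s - 1) * (F x * R x powr s)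
       = R x powr (1 - s) * R x powr s * F x / R (x + s) powr (1 - s)"
      using p xs by (simp add: powr_divide powr_diff field_simps flip: powr_add)
    also have "\<dots> = R x * F x / R (x + s) powr (1 - s)" using p by (simp flip: powr_add)
    also note *
    finally show ?case using p by (simp add: le_divide_eq)
  qed
  have "((\<lambda>x. (R (x + s) / R x) powr (s - 1)) \<longlongrightarrow> 1 powr (s - 1)) at_top"
    by (intro tendsto_powr slow tendsto_const) simp
  then show "((\<lambda>x. (R (x + s) / R x) powr (s - 1)) \<longlongrightarrow> 1) at_top" by simp
qed simp

text \<open>The quotient of \<open>F (x + s) / F x\<close> and \<open>G (x + s) / G x\<close> is invariant under \<open>x \<mapsto> x + 1\<close> and tends to 1
at infinity, hence it equals 1.\<close>

lemma shift_quotient_unique: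
  fixes F G R :: "real \<Rightarrow> real"
  assumes pos: "\<And>x. x > 0 \<Longrightarrow> F x > 0" "\<And>x. x > 0 \<Longrightarrow> G x > 0" "\<And>x. x > 0 \<Longrightarrow> R x > 0"
    and shift: "\<And>x. x > 0 \<Longrightarrow> F (x + 1) = R x * F x" "\<And>x. x > 0 \<Longrightarrow> G (x + 1) = R x * G x"
    and lim: "((\<lambda>x. F (x + s) / (F x * R x powr s)) \<longlongrightarrow> 1) at_top"
      "((\<lambda>x. G (x + s) / (G x * R x powr s)) \<longlongrightarrow> 1) at_top"
    and s: "s \<ge> 0" and a: "a > 0"
  shows "F (a + s) / F a = G (a + s) / G a"
proof -
  define Q where "Q x = (F (x + s) / F x) / (G (x + s) / G x)" for x
  have Q1: "Q (x + 1) = Q x" if "x > 0" for x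
  proof -
    have "F (x + 1 + s) = R (x + s) * F (x + s)" "G (x + 1 + s) = R (x + s) * G (x + s)"
      using shift[of "x + s"] that s by (auto simp: add_ac)
    then show ?thesis
      unfolding Q_def shift[OF that] using pos(3)[of x] pos(3)[of "x + s"] that s by simp
  qed
  have Qn: "Q (a + real n) = Q a" for n
  proof (induction n)
    case (Suc n)
    have "Q (a + real (Suc n)) = Q (a + real n + 1)" by (simp add: add_ac)
    also have "\<dots> = Q (a + real n)" using a by (intro Q1) simp
    finally show ?case using Suc by simp
  qed simp
  have "((\<lambda>x. (F (x + s) / (F x * R x powr s)) / (G (x + s) / (G x * R x powr s))) \<longlongrightarrow> 1 / 1) at_top"
    by (intro tendsto_divide lim) simp
  moreover have "\<forall>\<^sub>F x in at_top. (F (x + s) / (F x * R x powr s)) / (G (x + s) / (G x * R x powr s)) = Q x"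
    using eventually_gt_at_top[of 0]
    by eventually_elim (use pos in \<open>auto simp: Q_def less_imp_neq[THEN not_sym]\<close>)
  ultimately have "(Q \<longlongrightarrow> 1) at_top" using Lim_transform_eventually by fastforce
  then have "((\<lambda>n. Q (a + real n)) \<longlonglongrightarrow> 1)"
    by (rule filterlim_compose) real_asymp
  then have "Q a = 1" unfolding Qn by (simp add: LIMSEQ_const_iff)
  then show ?thesis using pos(1,2)[of a] pos(1,2)[of "a + s"] a s by (simp add: Q_def field_simps)
qed

text \<open>Hoelder's inequality, proved pointwise from the convexity of the exponential function after
normalising both integrands to total mass 1.\<close>

lemma log_convex_integral_powr:
  fixes H D :: "'a \<Rightarrow> real"
  assumes pos: "\<And>x. 0 \<le> H x" "\<And>x. H x \<noteq> 0 \<Longrightarrow> 0 < D x"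
    and int: "integrable N (\<lambda>x. H x * D x powr a)" "integrable N (\<lambda>x. H x * D x powr b)"
      "integrable N (\<lambda>x. H x * D x powr ((1 - t) * a + t * b))"
    and t: "0 \<le> t" "t \<le> 1"
  defines "F \<equiv> \<lambda>s. \<integral>x. H x * D x powr s \<partial>N"
  assumes F: "F a > 0" "F b > 0"
  shows "F ((1 - t) * a + t * b) \<le> F a powr (1 - t) * F b powr t"
proof -
  let ?c = "(1 - t) * a + t * b"
  let ?C = "F a powr (1 - t) * F b powr t"
  have C: "?C > 0" using F by simp
  have "H x * D x powr ?c \<le> ?C * ((1 - t) * (H x * D x powr a / F a) + t * (H x * D x powr b / F b))" for x
  proof (cases "H x = 0")
    case False
    then have H: "H x > 0" "D x > 0" using pos[of x] by auto
    define p where "p = ln (H x * D x powr a / F a)"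
    define q where "q = ln (H x * D x powr b / F b)"
    have pq: "exp p = H x * D x powr a / F a" "exp q = H x * D x powr b / F b"
      using H F by (auto simp: p_def q_def)
    have "exp ((1 - t) * p + t * q) \<le> (1 - t) * exp p + t * exp q"
      using convex_onD[OF exp_convex, of t p q] t by simp
    moreover have "exp ((1 - t) * p + t * q) = H x * D x powr ?c / ?C"
    proof -
      have pq': "p = ln (H x) + a * ln (D x) - ln (F a)" "q = ln (H x) + b * ln (D x) - ln (F b)"
        using H F by (auto simp: p_def q_def ln_mult ln_div ln_powr)
      have "(1 - t) * p + t * q = ln (H x) + ?c * ln (D x) - ((1 - t) * ln (F a) + t * ln (F b))"
        unfolding pq' by (simp add: algebra_simps)
      also have "exp \<dots> = H x * D x powr ?c / ?C"
        using H F by (simp add: exp_diff exp_add powr_def)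
      finally show ?thesis .
    qed
    ultimately have "H x * D x powr ?c / ?C \<le> (1 - t) * (H x * D x powr a / F a) + t * (H x * D x powr b / F b)"
      by (simp add: pq)
    then show ?thesis using C by (simp add: divide_le_eq mult.commute)
  qed simp
  then have "F ?c \<le> (\<integral>x. ?C * ((1 - t) * (H x * D x powr a / F a) + t * (H x * D x powr b / F b)) \<partial>N)"
    unfolding F_def using int by (intro integral_mono) auto
  also have "\<dots> = ?C * ((1 - t) * (F a / F a) + t * (F b / F b))"
    using int by (simp add: F_def)
  also have "\<dots> = ?C" using F by simp
  finally show ?thesis .
qed

text \<open>
The index sets are \<open>{1..n}\<close>; rewriting 1 to \<open>Suc 0\<close> in them would obstruct the matching of terms below.
\<close>

declare One_nat_def [simp del]

lemma powr_prod_eq: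
  fixes x :: "'i \<Rightarrow> real"
  assumes "\<And>k. k \<in> I \<Longrightarrow> 0 \<le> x k"
  shows "(\<Prod>k\<in>I. x k) powr s = (\<Prod>k\<in>I. x k powr s)"
  using assms by (induction I rule: infinite_finite_induct) (auto simp: powr_mult prod_nonneg)

text \<open>
A family of weights \<open>x powr (a - 1) * u x\<close> for which the coefficient of \<open>t\<close> in Pearson's equation depends on \<open>a\<close> as
for the gamma weight (\<open>d = 0\<close>) or the beta weight (\<open>d = 1\<close>).
\<close>

locale selberg_family =
  fixes u :: "real \<Rightarrow> real" and \<gamma> c d :: real
  assumes \<gamma>: "\<gamma> > 0" and c: "c > 0" and d: "d = 0 \<or> d = 1"
    and u_measurable [measurable]: "u \<in> borel_measurable borel"
    and u_nonneg: "\<And>x. 0 \<le> u x"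
    and u_supp: "\<And>x. x \<le> 0 \<Longrightarrow> u x = 0"
    and u_pos: "\<And>x. 0 < x \<Longrightarrow> x < 1 \<Longrightarrow> 0 < u x"
    and pearson: "\<And>a. a > 0 \<Longrightarrow>
       pearson_measure (density lborel (\<lambda>x. ennreal (x powr (a - 1) * u x))) a (c + d * a) d"
begin

definition selberg_weight :: "nat \<Rightarrow> (nat \<Rightarrow> real) \<Rightarrow> real" where
  "selberg_weight n x = repulsion \<gamma> 0 {1..n} x * (\<Prod>k\<in>{1..n}. u (x k))"

definition selberg :: "nat \<Rightarrow> real \<Rightarrow> real" where
  "selberg n a = (\<integral>x. selberg_weight n x * (\<Prod>k\<in>{1..n}. x k) powr (a - 1) \<partial>lborel_n n)"

definition aomoto_ratio :: "nat \<Rightarrow> real \<Rightarrow> real" where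
  "aomoto_ratio n a = (\<Prod>j<n. (a + \<gamma> * real j) / (c + d * a + \<gamma> * d * (real n - 1 + real j)))"

lemma selberg_weight_nonneg: "0 \<le> selberg_weight n x"
  unfolding selberg_weight_def by (intro mult_nonneg_nonneg repulsion_nonneg prod_nonneg u_nonneg ballI)

lemma selberg_weight_pos_coords: "selberg_weight n x \<noteq> 0 \<Longrightarrow> k \<in> {1..n} \<Longrightarrow> 0 < x k"
  using u_supp[of "x k"] by (force simp: selberg_weight_def)

lemma measurable_coord: "k \<in> {1..n} \<Longrightarrow> (\<lambda>x. x k) \<in> borel_measurable (lborel_n n)"
  using measurable_component_singleton[of k "{1..n}" "\<lambda>_. lborel"] by simp

lemma measurable_det [measurable]: "(\<lambda>x. \<Prod>k\<in>{1..n}. x k) \<in> borel_measurable (lborel_n n)"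
  by (intro borel_measurable_prod measurable_coord)

lemma measurable_selberg_weight [measurable]: "selberg_weight n \<in> borel_measurable (lborel_n n)"
proof -
  have 1: "repulsion \<gamma> 0 {1..n} \<in> borel_measurable (lborel_n n)"
    by (rule repulsion_measurable) (auto intro: measurable_coord)
  have "(\<lambda>x. \<Prod>k\<in>{1..n}. u (x k)) \<in> borel_measurable (lborel_n n)"
    by (intro borel_measurable_prod measurable_compose[OF measurable_coord u_measurable]) auto
  from borel_measurable_times[OF 1 this] show ?thesis by (simp add: selberg_weight_def[abs_def])
qed

lemma selberg_weight_times_powr:
  "selberg_weight n x * (\<Prod>k\<in>{1..n}. x k) powr s
   = repulsion \<gamma> 0 {1..n} x * (\<Prod>k\<in>{1..n}. x k powr s * u (x k))"
proof (cases "selberg_weight n x = 0")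
  case True
  then show ?thesis by (auto simp: selberg_weight_def prod.distrib)
next
  case False
  then have "(\<Prod>k\<in>{1..n}. x k) powr s = (\<Prod>k\<in>{1..n}. x k powr s)"
    by (intro powr_prod_eq less_imp_le selberg_weight_pos_coords)
  then show ?thesis by (simp add: selberg_weight_def prod.distrib)
qed

lemma joint_eq_density:
  assumes "a > 0"
  shows "Pi\<^sub>M {1..n} (\<lambda>_. density lborel (\<lambda>x. ennreal (x powr (a - 1) * u x)))
     = density (lborel_n n) (\<lambda>x. ennreal (\<Prod>k\<in>{1..n}. x k powr (a - 1) * u (x k)))"
proof -
  interpret pearson_measure "density lborel (\<lambda>x. ennreal (x powr (a - 1) * u x))" a "c + d * a" d
    by (rule pearson) fact
  interpret L: product_sigma_finite "\<lambda>_::nat. lborel :: real measure" by standard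
  show ?thesis
    using u_nonneg sigma_finite_measure_axioms by (subst L.PiM_density) (auto simp: prod_ennreal)
qed

lemma
  assumes a: "a > 0"
  shows selberg_integrable: "integrable (lborel_n n) (\<lambda>x. selberg_weight n x * (\<Prod>k\<in>{1..n}. x k) powr (a - 1))"
    and selberg_shift: "selberg n (a + 1) = aomoto_ratio n a * selberg n a"
proof -
  interpret pearson_measure "density lborel (\<lambda>x. ennreal (x powr (a - 1) * u x))" a "c + d * a" d
    by (rule pearson) fact
  let ?W = "\<lambda>x. \<Prod>k\<in>{1..n}. x k powr (a - 1) * u (x k)"
  have W0: "0 \<le> ?W x" for x by (intro prod_nonneg ballI mult_nonneg_nonneg u_nonneg) simp
  have [measurable]: "?W \<in> borel_measurable (lborel_n n)"
    by (intro borel_measurable_prod borel_measurable_times powr_real_measurable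
        measurable_compose[OF measurable_coord u_measurable] measurable_coord) auto
  have [measurable]: "repulsion \<gamma> 0 {1..n} \<in> borel_measurable (lborel_n n)"
    by (rule repulsion_measurable) (auto intro: measurable_coord)
  have "integrable (joint {1..n}) (\<lambda>x. (\<Prod>k\<in>{}. x k) * repulsion \<gamma> 0 {1..n} x * 1)"
    using \<gamma> by (intro integrable_repulsion[where C = 1 and m = 0]) auto
  then have int: "integrable (joint {1..n}) (repulsion \<gamma> 0 {1..n})" by simp
  have D: "joint {1..n} = density (lborel_n n) (\<lambda>x. ennreal (?W x))"
    by (rule joint_eq_density[OF a])
  have W: "?W x * repulsion \<gamma> 0 {1..n} x = selberg_weight n x * (\<Prod>k\<in>{1..n}. x k) powr (a - 1)" for x
    unfolding selberg_weight_times_powr by (rule mult.commute)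
  have "integrable (lborel_n n) (\<lambda>x. ?W x *\<^sub>R repulsion \<gamma> 0 {1..n} x)"
    using int W0 unfolding D by (subst (asm) integrable_density) auto
  then show "integrable (lborel_n n) (\<lambda>x. selberg_weight n x * (\<Prod>k\<in>{1..n}. x k) powr (a - 1))"
    unfolding real_scaleR_def W .
  have "(\<integral>x. repulsion \<gamma> 0 {1..n} x \<partial>joint {1..n}) = (\<integral>x. ?W x *\<^sub>R repulsion \<gamma> 0 {1..n} x \<partial>lborel_n n)"
    unfolding D using W0 by (intro integral_density) auto
  then have 1: "(\<integral>x. repulsion \<gamma> 0 {1..n} x \<partial>joint {1..n}) = selberg n a"
    unfolding real_scaleR_def W selberg_def .
  have "(\<integral>x. (\<Prod>k\<in>{1..n}. x k) * repulsion \<gamma> 0 {1..n} x \<partial>joint {1..n})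
      = (\<integral>x. ?W x *\<^sub>R ((\<Prod>k\<in>{1..n}. x k) * repulsion \<gamma> 0 {1..n} x) \<partial>lborel_n n)"
    unfolding D using W0 by (intro integral_density) auto
  also have "\<dots> = selberg n (a + 1)"
    unfolding selberg_def
  proof (intro Bochner_Integration.integral_cong refl)
    fix x :: "nat \<Rightarrow> real"
    have "x k powr (a - 1) * u (x k) * x k = x k powr a * u (x k)" for k
      using u_supp[of "x k"] mult_powr_diff_one[of "x k" a] by (cases "x k > 0") (auto simp: mult_ac)
    then have *: "?W x * (\<Prod>k\<in>{1..n}. x k) = (\<Prod>k\<in>{1..n}. x k powr a * u (x k))"
      by (simp only: prod.distrib[symmetric])
    have "?W x *\<^sub>R ((\<Prod>k\<in>{1..n}. x k) * repulsion \<gamma> 0 {1..n} x)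
        = (?W x * (\<Prod>k\<in>{1..n}. x k)) * repulsion \<gamma> 0 {1..n} x" by simp
    also have "\<dots> = selberg_weight n x * (\<Prod>k\<in>{1..n}. x k) powr (a + 1 - 1)"
      unfolding * selberg_weight_times_powr by simp
    finally show "?W x *\<^sub>R ((\<Prod>k\<in>{1..n}. x k) * repulsion \<gamma> 0 {1..n} x)
        = selberg_weight n x * (\<Prod>k\<in>{1..n}. x k) powr (a + 1 - 1)" .
  qed
  finally have 2: "(\<integral>x. (\<Prod>k\<in>{1..n}. x k) * repulsion \<gamma> 0 {1..n} x \<partial>joint {1..n}) = selberg n (a + 1)" .
  let ?A = "\<Prod>j<n. a + \<gamma> * real j" and ?C = "\<Prod>j<n. c + d * a + \<gamma> * d * (real n - 1 + real j)"
  have eq: "?C * selberg n (a + 1) = ?A * selberg n a"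
    using aomoto[of "{1..n}" \<gamma>] \<gamma> by (simp only: 1 2 finite_atLeastAtMost card_atLeastAtMost diff_Suc_1)
  have "c + d * a + \<gamma> * d * (real n - 1 + real j) > 0" if "j < n" for j
  proof -
    have "\<gamma> * d * (real n - 1 + real j) \<ge> 0"
      using \<gamma> d that by (intro mult_nonneg_nonneg) auto
    moreover have "c + d * a > 0" using c d a by (auto intro: add_pos_nonneg)
    ultimately show ?thesis by linarith
  qed
  then have "?C > 0" by (intro prod_pos) auto
  moreover have "S1 = A / C * S0" if "C * S1 = A * S0" "C > 0" for A C S0 S1 :: real
    using that by (simp add: field_simps)
  ultimately show "selberg n (a + 1) = aomoto_ratio n a * selberg n a"
    unfolding aomoto_ratio_def prod_dividef using eq by blast
qed

text \<open>The integrand is positive on a box whose sides are disjoint subintervals of \<open>{0<..<1}\<close> and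
which has positive volume.\<close>

lemma selberg_pos:
  assumes a: "a > 0"
  shows "selberg n a > 0"
proof -
  interpret L: product_sigma_finite "\<lambda>_::nat. lborel :: real measure" by standard
  let ?f = "\<lambda>x. selberg_weight n x * (\<Prod>k\<in>{1..n}. x k) powr (a - 1)"
  have nn: "0 \<le> ?f x" for x using selberg_weight_nonneg by simp
  define J where "J k = {real k / (real n + 1) .. (real k + 1 / 2) / (real n + 1)}" for k
  let ?B = "Pi\<^sub>E {1..n} J"
  have B: "?B \<in> sets (lborel_n n)" by (intro sets_PiM_I_finite) (auto simp: J_def)
  have "emeasure (lborel_n n) ?B = (\<Prod>k\<in>{1..n}. emeasure lborel (J k))"
    by (intro L.emeasure_PiM) (auto simp: J_def)
  also have "\<dots> = (\<Prod>k\<in>{1..n}. ennreal ((1 / 2) / (real n + 1)))"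
    unfolding J_def by (intro prod.cong refl) (simp add: divide_right_mono flip: diff_divide_distrib)
  also have "\<dots> \<noteq> 0" by (auto simp: prod_zero_iff ennreal_eq_0_iff not_le intro!: divide_pos_pos)
  finally have B0: "emeasure (lborel_n n) ?B \<noteq> 0" .
  have pos: "?f x \<noteq> 0" if x: "x \<in> ?B" for x
  proof -
    have x01: "0 < x k" "x k < 1" if "k \<in> {1..n}" for k
    proof -
      have xk: "real k / (real n + 1) \<le> x k" "x k \<le> (real k + 1 / 2) / (real n + 1)"
        using PiE_mem[OF x that] by (auto simp: J_def)
      have "0 < real k / (real n + 1)" using that by simp
      with xk show "0 < x k" by linarith
      have "(real k + 1 / 2) / (real n + 1) < 1" using that by simp
      with xk show "x k < 1" by linarith
    qed
    have less: "x k < x l" if "k \<in> {1..n}" "l \<in> {1..n}" "k < l" for k l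
    proof -
      have "x k \<le> (real k + 1 / 2) / (real n + 1)" "real l / (real n + 1) \<le> x l"
        using PiE_mem[OF x that(1)] PiE_mem[OF x that(2)] by (auto simp: J_def)
      moreover have "(real k + 1 / 2) / (real n + 1) < real l / (real n + 1)"
        using that by (intro divide_strict_right_mono) auto
      ultimately show ?thesis by linarith
    qed
    have "x k \<noteq> x l" if "k \<in> {1..n}" "l \<in> {1..n} - {k}" for k l
      using less[of k l] less[of l k] that by (cases "k < l") auto
    then have "repulsion \<gamma> 0 {1..n} x \<noteq> 0" by (auto simp: repulsion_def prod_zero_iff)
    moreover have "(\<Prod>k\<in>{1..n}. u (x k)) \<noteq> 0"
      using u_pos[OF x01] by (auto simp: prod_zero_iff less_imp_neq[THEN not_sym])
    moreover have "(\<Prod>k\<in>{1..n}. x k) \<noteq> 0"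
      using x01(1) by (force simp: prod_zero_iff)
    ultimately show ?thesis by (simp add: selberg_weight_def)
  qed
  have "selberg n a \<noteq> 0"
  proof
    assume "selberg n a = 0"
    then have "AE x in lborel_n n. ?f x = 0"
      using integral_nonneg_eq_0_iff_AE[OF selberg_integrable[OF a] AE_I2[OF nn]]
      by (simp add: selberg_def)
    then have "AE x in lborel_n n. x \<notin> ?B"
      by eventually_elim (use pos in auto)
    then have "emeasure (lborel_n n) ?B = 0"
      using B by (subst (asm) AE_iff_measurable[OF B]) (auto dest: sets.sets_into_space)
    with B0 show False by simp
  qed
  moreover have "selberg n a \<ge> 0"
    unfolding selberg_def by (intro integral_nonneg_AE AE_I2 nn)
  ultimately show ?thesis by simp
qed

lemma aomoto_ratio_pos: "a > 0 \<Longrightarrow> aomoto_ratio n a > 0"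
  using selberg_shift[of a n] selberg_pos[of a n] selberg_pos[of "a + 1" n]
  by (simp add: zero_less_mult_iff)

text \<open>Each factor is linear in \<open>a\<close> (when \<open>d = 0\<close>) or a quotient of two linear functions.\<close>

lemma aomoto_ratio_slow: "((\<lambda>x. aomoto_ratio n (x + s) / aomoto_ratio n x) \<longlongrightarrow> 1) at_top"
proof -
  have "((\<lambda>x. \<Prod>j<n. ((x + s + \<gamma> * real j) / (c + d * (x + s) + \<gamma> * d * (real n - 1 + real j)))
        / ((x + \<gamma> * real j) / (c + d * x + \<gamma> * d * (real n - 1 + real j)))) \<longlongrightarrow> (\<Prod>j<n. 1)) at_top"
  proof (rule tendsto_prod)
    fix j
    define p where "p = \<gamma> * real j"
    define q where "q = \<gamma> * (real n - 1 + real j)"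
    have "((\<lambda>x. ((x + s + p) / (c + d * (x + s) + d * q)) / ((x + p) / (c + d * x + d * q))) \<longlongrightarrow> 1) at_top"
    proof (cases "d = 0")
      case True
      then show ?thesis using c by simp real_asymp
    next
      case False
      then have "d = 1" using d by simp
      then show ?thesis by simp real_asymp
    qed
    then show "((\<lambda>x. ((x + s + \<gamma> * real j) / (c + d * (x + s) + \<gamma> * d * (real n - 1 + real j)))
        / ((x + \<gamma> * real j) / (c + d * x + \<gamma> * d * (real n - 1 + real j)))) \<longlongrightarrow> 1) at_top"
      by (simp add: p_def q_def mult_ac)
  qed
  then show ?thesis by (simp only: aomoto_ratio_def prod_dividef prod.neutral_const)
qed

lemma selberg_asymptotics:
  assumes s: "0 \<le> s" "s \<le> 1"
  shows "((\<lambda>x. selberg n (x + s) / (selberg n x * aomoto_ratio n x powr s)) \<longlongrightarrow> 1) at_top"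
proof (rule log_convex_shift_asymptotics)
  fix x y t :: real assume t: "0 < x" "0 < y" "0 \<le> t" "t \<le> 1"
  have "(1 - t) * x + t * y > 0"
    using t by (cases "t = 0") (auto intro: add_nonneg_pos)
  moreover have "(1 - t) * (x - 1) + t * (y - 1) = (1 - t) * x + t * y - 1"
    by (simp add: algebra_simps)
  moreover have "0 < (\<Prod>k\<in>{1..n}. z k)" if "selberg_weight n z \<noteq> 0" for z
    by (rule prod_pos) (rule selberg_weight_pos_coords[OF that])
  ultimately show "selberg n ((1 - t) * x + t * y) \<le> selberg n x powr (1 - t) * selberg n y powr t"
    using log_convex_integral_powr[of "selberg_weight n" "\<lambda>x. \<Prod>k\<in>{1..n}. x k" "lborel_n n" "x - 1" "y - 1" t]
      t selberg_integrable selberg_pos selberg_weight_nonneg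
    by (simp add: selberg_def)
qed (use s selberg_pos selberg_shift aomoto_ratio_pos aomoto_ratio_slow in auto)

text \<open>Functions \<open>g j\<close> that satisfy the shift relation factor by factor, and have the asymptotics of a log-convex
solution, represent the quotients of Selberg integrals as a product. In the Jacobi case they are quotients
of two Gamma functions, for which the asymptotics are easy to check but log-convexity may fail.\<close>

lemma selberg_quotient:
  fixes n :: nat and g :: "nat \<Rightarrow> real \<Rightarrow> real"
  defines "r \<equiv> \<lambda>j a. (a + \<gamma> * real j) / (c + d * a + \<gamma> * d * (real n - 1 + real j))"
  assumes g: "\<And>j x. j < n \<Longrightarrow> x > 0 \<Longrightarrow> g j x > 0"
    and shift: "\<And>j x. j < n \<Longrightarrow> x > 0 \<Longrightarrow> g j (x + 1) = r j x * g j x"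
    and lim: "\<And>j s. j < n \<Longrightarrow> 0 \<le> s \<Longrightarrow> s \<le> 1 \<Longrightarrow>
       ((\<lambda>x. g j (x + s) / (g j x * r j x powr s)) \<longlongrightarrow> 1) at_top"
    and a: "a > 0" "b > 0" "\<bar>b - a\<bar> \<le> 1"
  shows "selberg n b / selberg n a = (\<Prod>j<n. g j b / g j a)"
proof -
  have r: "aomoto_ratio n x = (\<Prod>j<n. r j x)" for x by (simp add: aomoto_ratio_def r_def)
  have rpos: "r j x > 0" if "j < n" "x > 0" for j x
    using shift[OF that] g[OF that] g[OF that(1), of "x + 1"] that by (simp add: zero_less_mult_iff)
  have main: "selberg n (a + s) / selberg n a = (\<Prod>j<n. g j (a + s) / g j a)"
    if s: "0 \<le> s" "s \<le> 1" and a: "a > 0" for a s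
  proof -
    have "selberg n (a + s) / selberg n a = (\<Prod>j<n. g j (a + s)) / (\<Prod>j<n. g j a)"
    proof (rule shift_quotient_unique[where R = "aomoto_ratio n"])
      show "((\<lambda>x. (\<Prod>j<n. g j (x + s)) / ((\<Prod>j<n. g j x) * aomoto_ratio n x powr s)) \<longlongrightarrow> 1) at_top"
      proof (rule Lim_transform_eventually)
        have "((\<lambda>x. \<Prod>j<n. g j (x + s) / (g j x * r j x powr s)) \<longlongrightarrow> (\<Prod>j<n. 1)) at_top"
          by (intro tendsto_prod lim s) auto
        then show "((\<lambda>x. \<Prod>j<n. g j (x + s) / (g j x * r j x powr s)) \<longlongrightarrow> 1) at_top" by simp
        show "\<forall>\<^sub>F x in at_top. (\<Prod>j<n. g j (x + s) / (g j x * r j x powr s))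
            = (\<Prod>j<n. g j (x + s)) / ((\<Prod>j<n. g j x) * aomoto_ratio n x powr s)"
          using eventually_gt_at_top[of 0]
        proof eventually_elim
          case (elim x)
          have "aomoto_ratio n x powr s = (\<Prod>j<n. r j x powr s)"
            unfolding r by (intro powr_prod_eq less_imp_le rpos elim) auto
          then show ?case by (simp add: prod_dividef prod.distrib)
        qed
      qed
      show "(\<Prod>j<n. g j (x + 1)) = aomoto_ratio n x * (\<Prod>j<n. g j x)" if "x > 0" for x
        using that by (simp add: r shift flip: prod.distrib)
      show "0 < (\<Prod>j<n. g j x)" if "x > 0" for x using that g by (intro prod_pos) auto
    qed (use s a selberg_pos selberg_shift aomoto_ratio_pos selberg_asymptotics in auto)
    then show ?thesis by (simp add: prod_dividef)
  qed
  show ?thesis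
  proof (cases "a \<le> b")
    case True
    then show ?thesis using main[of "b - a" a] a by simp
  next
    case False
    then have "selberg n a / selberg n b = (\<Prod>j<n. g j a / g j b)"
      using main[of "a - b" b] a by simp
    then have "inverse (selberg n a / selberg n b) = inverse (\<Prod>j<n. g j a / g j b)" by simp
    then show ?thesis by (simp add: prod_dividef)
  qed
qed

text \<open>Multiplying the density by a power of the determinant only changes the exponent \<open>a\<close>. So the moments of the
determinant are quotients of Selberg integrals.\<close>

lemma moments_det:
  assumes a: "a > 0" "a + s > 0"
    and f: "\<And>x. f x = selberg_weight n x * (\<Prod>k\<in>{1..n}. x k) powr (a - 1)"
  defines "\<mu> \<equiv> distr (density_propto (lborel_n n) f) borel (\<lambda>x. \<Prod>k\<in>{1..n}. x k)"
  shows "(\<integral>\<^sup>+y. ennreal (y powr s) \<partial>\<mu>) = ennreal (selberg n (a + s) / selberg n a)"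
    and "AE y in \<mu>. y > 0"
proof -
  let ?D = "\<lambda>x. \<Prod>k\<in>{1..n}. x k"
  have f0: "0 \<le> f x" for x unfolding f by (simp add: selberg_weight_nonneg)
  have fm [measurable]: "f \<in> borel_measurable (lborel_n n)" unfolding f[abs_def] by measurable
  have f_int: "(\<integral>\<^sup>+x. ennreal (f x) \<partial>lborel_n n) = ennreal (selberg n a)"
    unfolding f selberg_def by (rule nn_integral_eq_integral[OF selberg_integrable[OF a(1)]])
      (simp add: selberg_weight_nonneg)
  have Z: "selberg n a > 0" by (rule selberg_pos) fact
  have dens: "density_propto (lborel_n n) f = density (lborel_n n) (\<lambda>x. ennreal (f x / selberg n a))"
    unfolding density_propto_def f_int using Z f0 by (simp add: divide_ennreal)
  have Dpos: "0 < ?D x" if "f x \<noteq> 0" for x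
    by (rule prod_pos) (rule selberg_weight_pos_coords[of n x], use that in \<open>auto simp: f\<close>)
  have "(\<integral>\<^sup>+y. ennreal (y powr s) \<partial>\<mu>) = (\<integral>\<^sup>+x. ennreal (?D x powr s) \<partial>density_propto (lborel_n n) f)"
    unfolding \<mu>_def by (intro nn_integral_distr) (auto simp: dens)
  also have "\<dots> = (\<integral>\<^sup>+x. ennreal (f x / selberg n a) * ennreal (?D x powr s) \<partial>lborel_n n)"
    unfolding dens by (intro nn_integral_density) auto
  also have "\<dots> = (\<integral>\<^sup>+x. ennreal (selberg_weight n x * ?D x powr (a + s - 1) / selberg n a) \<partial>lborel_n n)"
  proof (intro nn_integral_cong)
    fix x
    have "f x * ?D x powr s = selberg_weight n x * ?D x powr (a + s - 1)"
    proof -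
      have e: "a + s - 1 = a - 1 + s" by simp
      show ?thesis unfolding f e powr_add by simp
    qed
    then show "ennreal (f x / selberg n a) * ennreal (?D x powr s)
       = ennreal (selberg_weight n x * ?D x powr (a + s - 1) / selberg n a)"
      using f0 Z by (simp add: ennreal_mult'[symmetric])
  qed
  also have "\<dots> = ennreal (\<integral>x. selberg_weight n x * ?D x powr (a + s - 1) / selberg n a \<partial>lborel_n n)"
    using selberg_integrable[OF a(2)] Z by (intro nn_integral_eq_integral) (auto simp: selberg_weight_nonneg)
  also have "\<dots> = ennreal (selberg n (a + s) / selberg n a)"
    by (simp add: selberg_def)
  finally show "(\<integral>\<^sup>+y. ennreal (y powr s) \<partial>\<mu>) = ennreal (selberg n (a + s) / selberg n a)" .
  have "AE x in density_propto (lborel_n n) f. 0 < ?D x"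
    unfolding dens
  proof (subst AE_density)
    show "AE x in lborel_n n. 0 < ennreal (f x / selberg n a) \<longrightarrow> 0 < ?D x"
      using Dpos by (intro AE_I2) force
  qed measurable
  then show "AE y in \<mu>. y > 0"
    unfolding \<mu>_def by (subst AE_distr_iff) (auto simp: dens)
qed

end

lemma Gamma_shift_asymptotics:
  fixes e s :: real
  assumes "0 \<le> s" "s \<le> 1"
  shows "((\<lambda>x. Gamma (x + e + s) / (Gamma (x + e) * (x + e) powr s)) \<longlongrightarrow> 1) at_top"
proof -
  have "((\<lambda>x::real. Gamma (x + s) / (Gamma x * x powr s)) \<longlongrightarrow> 1) at_top"
  proof (rule log_convex_shift_asymptotics)
    fix x y t :: real assume t: "0 < x" "0 < y" "0 \<le> t" "t \<le> 1"
    have p: "(1 - t) * x + t * y > 0"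
      using t by (cases "t = 0") (auto intro: add_nonneg_pos)
    have "ln (Gamma ((1 - t) * x + t * y)) \<le> (1 - t) * ln (Gamma x) + t * ln (Gamma y)"
      using convex_onD[OF log_convex_Gamma_real, of t x y] t by simp
    then have "exp (ln (Gamma ((1 - t) * x + t * y))) \<le> exp ((1 - t) * ln (Gamma x) + t * ln (Gamma y))"
      by simp
    then show "Gamma ((1 - t) * x + t * y) \<le> Gamma x powr (1 - t) * Gamma y powr t"
      using Gamma_real_pos[OF t(1)] Gamma_real_pos[OF t(2)] Gamma_real_pos[OF p]
      by (simp add: exp_add powr_def)
  next
    show "((\<lambda>x. (x + s) / x) \<longlongrightarrow> 1) at_top" for s :: real by real_asymp
    show "Gamma (x + 1) = x * Gamma x" if "x > 0" for x :: real
      using that by (subst Gamma_plus1) (auto simp: nonpos_Ints_def)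
  qed (use assms in \<open>auto simp: Gamma_real_pos\<close>)
  moreover have "filterlim (\<lambda>x. x + e) at_top at_top" by real_asymp
  ultimately have "((\<lambda>x. (\<lambda>x. Gamma (x + s) / (Gamma x * x powr s)) (x + e)) \<longlongrightarrow> 1) at_top"
    by (rule filterlim_compose)
  then show ?thesis by simp
qed

lemma Gamma_plus1_pos: "x > 0 \<Longrightarrow> Gamma (x + 1) = x * Gamma x" for x :: real
  by (subst Gamma_plus1) (auto simp: nonpos_Ints_def)

lemma selberg_family_laguerre:
  assumes "\<gamma> > 0"
  shows "selberg_family laguerre_weight \<gamma> (1 / 2) 0"
proof (rule selberg_family.intro)
  show "laguerre_weight \<in> borel_measurable borel" unfolding laguerre_weight_def[abs_def] by measurable
  show "pearson_measure (density lborel (\<lambda>x. ennreal (x powr (a - 1) * laguerre_weight x))) a (1 / 2 + 0 * a) 0"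
    if "a > 0" for a using pearson_laguerre[OF that] by simp
qed (use assms in \<open>auto simp: laguerre_weight_def\<close>)

lemma selberg_family_jacobi:
  assumes "\<gamma> > 0" "b > 0"
  shows "selberg_family (jacobi_weight b) \<gamma> b 1"
proof (rule selberg_family.intro)
  show "jacobi_weight b \<in> borel_measurable borel" unfolding jacobi_weight_def[abs_def] by measurable
  show "pearson_measure (density lborel (\<lambda>x. ennreal (x powr (a - 1) * jacobi_weight b x))) a (b + 1 * a) 1"
    if "a > 0" for a using pearson_jacobi[OF that assms(2)] by (simp add: add.commute)
qed (use assms in \<open>auto simp: jacobi_weight_def\<close>)

text \<open>Solving the shift relation: the factor \<open>2 * (x + \<gamma> * j)\<close> is the one of \<open>2 powr x * \<Gamma> (x + \<gamma> * j)\<close>.\<close>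

lemma laguerre_quotient:
  assumes "\<gamma> > 0" "a > 0" "a + s > 0" "\<bar>s\<bar> \<le> 1"
  shows "selberg_family.selberg laguerre_weight \<gamma> n (a + s) / selberg_family.selberg laguerre_weight \<gamma> n a
    = (\<Prod>j<n. 2 powr s * (Gamma (a + \<gamma> * real j + s) / Gamma (a + \<gamma> * real j)))"
proof -
  interpret selberg_family laguerre_weight \<gamma> "1 / 2" 0 by (rule selberg_family_laguerre) fact
  let ?g = "\<lambda>j x. 2 powr x * Gamma (x + \<gamma> * real j)"
  have pos: "x + \<gamma> * real j > 0" if "x > 0" for x j using that assms by (simp add: add_pos_nonneg)
  have "selberg n (a + s) / selberg n a = (\<Prod>j<n. ?g j (a + s) / ?g j a)"
  proof (rule selberg_quotient)
    fix j :: nat and x :: real assume x: "x > 0"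
    show "?g j x > 0" using Gamma_real_pos[OF pos[OF x]] by simp
    have e: "x + 1 + \<gamma> * real j = x + \<gamma> * real j + 1" by simp
    show "?g j (x + 1) = (x + \<gamma> * real j) / (1 / 2 + 0 * x + \<gamma> * 0 * (real n - 1 + real j)) * ?g j x"
      unfolding e Gamma_plus1_pos[OF pos[OF x]] powr_add by simp
  next
    fix j :: nat and s :: real assume s: "0 \<le> s" "s \<le> 1"
    show "((\<lambda>x. ?g j (x + s) / (?g j x * ((x + \<gamma> * real j) / (1 / 2 + 0 * x + \<gamma> * 0 * (real n - 1 + real j))) powr s)) \<longlongrightarrow> 1) at_top"
    proof (rule Lim_transform_eventually[OF Gamma_shift_asymptotics[OF s, of "\<gamma> * real j"]])
      show "\<forall>\<^sub>F x in at_top. Gamma (x + \<gamma> * real j + s) / (Gamma (x + \<gamma> * real j) * (x + \<gamma> * real j) powr s)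
        = ?g j (x + s) / (?g j x * ((x + \<gamma> * real j) / (1 / 2 + 0 * x + \<gamma> * 0 * (real n - 1 + real j))) powr s)"
        using eventually_gt_at_top[of 0]
      proof eventually_elim
        case (elim x)
        have e: "x + s + \<gamma> * real j = x + \<gamma> * real j + s" by simp
        have r: "(x + \<gamma> * real j) / (1 / 2 + 0 * x + \<gamma> * 0 * (real n - 1 + real j)) = 2 * (x + \<gamma> * real j)"
          by simp
        show ?case unfolding e r powr_add powr_mult by simp
      qed
    qed
  qed (use assms in auto)
  also have "\<dots> = (\<Prod>j<n. 2 powr s * (Gamma (a + \<gamma> * real j + s) / Gamma (a + \<gamma> * real j)))"
    by (intro prod.cong refl) (simp add: powr_add add_ac)
  finally show ?thesis .
qed

text \<open>Here the shift factor \<open>(x + \<gamma> * j) / (x + e j)\<close> belongs to a quotient of two Gamma functions.\<close>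

lemma jacobi_quotient:
  fixes n :: nat
  assumes "\<gamma> > 0" "a > 0" "a + s > 0" "\<bar>s\<bar> \<le> 1" "b > 0"
  defines "e \<equiv> \<lambda>j. b + \<gamma> * (real n - 1 + real j)"
  shows "selberg_family.selberg (jacobi_weight b) \<gamma> n (a + s) / selberg_family.selberg (jacobi_weight b) \<gamma> n a
    = (\<Prod>j<n. (Gamma (a + \<gamma> * real j + s) / Gamma (a + \<gamma> * real j)) /
         (Gamma (a + e j + s) / Gamma (a + e j)))"
proof -
  interpret selberg_family "jacobi_weight b" \<gamma> b 1 by (rule selberg_family_jacobi) fact+
  let ?g = "\<lambda>j x. Gamma (x + \<gamma> * real j) / Gamma (x + e j)"
  have pos: "x + \<gamma> * real j > 0" if "x > 0" for x j using that assms by (simp add: add_pos_nonneg)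
  have pos': "x + e j > 0" if "x > 0" "j < n" for x j
  proof -
    have "\<gamma> * (real n - 1 + real j) \<ge> 0" using that assms by (intro mult_nonneg_nonneg) auto
    then show ?thesis using that assms(5) unfolding e_def by linarith
  qed
  have r: "b + 1 * x + \<gamma> * 1 * (real n - 1 + real j) = x + e j" for x j by (simp add: e_def)
  have "selberg n (a + s) / selberg n a = (\<Prod>j<n. ?g j (a + s) / ?g j a)"
  proof (rule selberg_quotient, unfold r)
    fix j :: nat and x :: real assume x: "j < n" "x > 0"
    show "?g j x > 0" using Gamma_real_pos[OF pos[OF x(2)]] Gamma_real_pos[OF pos'[OF x(2,1)]] by simp
    have eq: "x + 1 + \<gamma> * real j = x + \<gamma> * real j + 1" "x + 1 + e j = x + e j + 1" by simp_all
    show "?g j (x + 1) = (x + \<gamma> * real j) / (x + e j) * ?g j x"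
      unfolding eq Gamma_plus1_pos[OF pos[OF x(2)]] Gamma_plus1_pos[OF pos'[OF x(2,1)]] by simp
  next
    fix j :: nat and s :: real assume j: "j < n" and s: "0 \<le> s" "s \<le> 1"
    have lim: "((\<lambda>x. (Gamma (x + \<gamma> * real j + s) / (Gamma (x + \<gamma> * real j) * (x + \<gamma> * real j) powr s)) /
       (Gamma (x + e j + s) / (Gamma (x + e j) * (x + e j) powr s))) \<longlongrightarrow> 1 / 1) at_top"
      by (intro tendsto_divide Gamma_shift_asymptotics s) simp
    show "((\<lambda>x. ?g j (x + s) / (?g j x * ((x + \<gamma> * real j) / (x + e j)) powr s)) \<longlongrightarrow> 1) at_top"
    proof (rule Lim_transform_eventually[OF lim[unfolded div_by_1]])
      show "\<forall>\<^sub>F x in at_top. (Gamma (x + \<gamma> * real j + s) / (Gamma (x + \<gamma> * real j) * (x + \<gamma> * real j) powr s)) /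
       (Gamma (x + e j + s) / (Gamma (x + e j) * (x + e j) powr s))
        = ?g j (x + s) / (?g j x * ((x + \<gamma> * real j) / (x + e j)) powr s)"
        using eventually_gt_at_top[of 0]
      proof eventually_elim
        case (elim x)
        have eq: "x + s + \<gamma> * real j = x + \<gamma> * real j + s" "x + s + e j = x + e j + s" by simp_all
        show ?case unfolding eq using pos[OF elim, of j] pos'[OF elim j] by (simp add: powr_divide)
      qed
    qed
  qed (use assms in auto)
  also have "\<dots> = (\<Prod>j<n. (Gamma (a + \<gamma> * real j + s) / Gamma (a + \<gamma> * real j)) /
         (Gamma (a + e j + s) / Gamma (a + e j)))"
    by (intro prod.cong refl) (simp add: add_ac)
  finally show ?thesis .
qed

section \<open>Mellin transforms of the determinants\<close>

lemma repulsion_eq_vandermonde: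
  "vandermonde_abs n x powr (2 * \<gamma>) = repulsion \<gamma> 0 {1..n} x"
proof -
  let ?h = "\<lambda>k j. \<bar>x k - x j\<bar> powr \<gamma>"
  have h: "(0 + (x k - x j)\<^sup>2) powr (\<gamma> / 2) = ?h k j" for k j
  proof (cases "x k = x j")
    case False
    then have "(x k - x j)\<^sup>2 = \<bar>x k - x j\<bar> powr 2" by (simp add: powr_numeral)
    then have "(x k - x j)\<^sup>2 powr (\<gamma> / 2) = \<bar>x k - x j\<bar> powr (2 * (\<gamma> / 2))"
      by (simp only: powr_powr)
    then show ?thesis by simp
  qed simp
  have "repulsion \<gamma> 0 {1..n} x = (\<Prod>k\<in>{1..n}. \<Prod>j\<in>{1..n} - {k}. ?h k j)"
    unfolding repulsion_def h ..
  also have "\<dots> = (\<Prod>k\<in>{1..n}. (\<Prod>j\<in>{1..<k}. ?h k j) * (\<Prod>j\<in>{k<..n}. ?h k j))"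
  proof (rule prod.cong[OF refl])
    fix k assume "k \<in> {1..n}"
    then have eq: "{1..n} - {k} = {1..<k} \<union> {k<..n}" by auto
    show "(\<Prod>j\<in>{1..n} - {k}. ?h k j) = (\<Prod>j\<in>{1..<k}. ?h k j) * (\<Prod>j\<in>{k<..n}. ?h k j)"
      unfolding eq by (rule prod.union_disjoint) auto
  qed
  also have "\<dots> = (\<Prod>k\<in>{1..n}. \<Prod>j\<in>{1..<k}. ?h k j) * (\<Prod>k\<in>{1..n}. \<Prod>j\<in>{k<..n}. ?h k j)"
    by (rule prod.distrib)
  also have "(\<Prod>k\<in>{1..n}. \<Prod>j\<in>{k<..n}. ?h k j) = (\<Prod>k\<in>{1..n}. \<Prod>j\<in>{j. j \<in> {1..n} \<and> k < j}. ?h k j)"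
    by (intro prod.cong refl) auto
  also have "\<dots> = (\<Prod>j\<in>{1..n}. \<Prod>k\<in>{k. k \<in> {1..n} \<and> k < j}. ?h k j)"
    by (rule prod.swap_restrict) auto
  also have "\<dots> = (\<Prod>j\<in>{1..n}. \<Prod>k\<in>{1..<j}. ?h j k)"
    by (intro prod.cong refl) (auto simp: abs_minus_commute)
  also have "(\<Prod>k\<in>{1..n}. \<Prod>j\<in>{1..<k}. ?h k j) * (\<Prod>j\<in>{1..n}. \<Prod>k\<in>{1..<j}. ?h j k)
      = (\<Prod>k\<in>{1..n}. \<Prod>j\<in>{1..<k}. \<bar>x k - x j\<bar> powr (2 * \<gamma>))"
    by (simp flip: prod.distrib powr_add)
  also have "\<dots> = vandermonde_abs n x powr (2 * \<gamma>)"
    unfolding vandermonde_abs_def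
    by (simp add: powr_prod_eq prod_nonneg)
  finally show ?thesis ..
qed

definition gamma_quotient :: "'a :: Gamma \<Rightarrow> 'a \<Rightarrow> 'a" where
  "gamma_quotient w z = Gamma (w + z) / Gamma w"

text \<open>The Mellin transforms are defined for real and for complex arguments at once: the real values are moments,
the complex ones are needed for characteristic functions. The factor with \<open>k = n\<close> in the Gram case
equals 1 and makes its shape uniform with the other two.\<close>

fun det_mellin :: "ensemble \<Rightarrow> real \<Rightarrow> real \<Rightarrow> real \<Rightarrow> nat \<Rightarrow> 'a :: Gamma \<Rightarrow> 'a" where
  "det_mellin Laguerre \<gamma> \<tau>\<^sub>1 \<tau>\<^sub>2 n z =
     (\<Prod>k\<in>{1..n}. exp (z * of_real (ln 2)) * gamma_quotient (of_real (\<gamma> * real k)) z)"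
| "det_mellin Gram \<gamma> \<tau>\<^sub>1 \<tau>\<^sub>2 n z =
     (\<Prod>k\<in>{1..n}. gamma_quotient (of_real (\<gamma> * real k)) z / gamma_quotient (of_real (\<gamma> * real n)) z)"
| "det_mellin Jacobi \<gamma> \<tau>\<^sub>1 \<tau>\<^sub>2 n z =
     (let n\<^sub>1 = nat \<lfloor>real n * \<tau>\<^sub>1\<rfloor>; n\<^sub>2 = nat \<lfloor>real n * \<tau>\<^sub>2\<rfloor>; m = min n\<^sub>1 n\<^sub>2; M = max n\<^sub>1 n\<^sub>2
      in \<Prod>k\<in>{1..m}. gamma_quotient (of_real (\<gamma> * real k)) z
           / gamma_quotient (of_real (\<gamma> * (real M + real k))) z)"

lemma prod_atLeast1: "(\<Prod>k\<in>{1..n}. f k) = (\<Prod>j<n. f (Suc j))" for f :: "nat \<Rightarrow> 'a :: comm_monoid_mult"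
  by (rule prod.reindex_bij_witness[of _ Suc "\<lambda>k. k - 1"]) auto

lemma laguerre_moments:
  assumes "\<gamma> > 0" "\<bar>s\<bar> < \<gamma>" "\<bar>s\<bar> \<le> 1"
  shows "(\<integral>\<^sup>+y. ennreal (y powr s) \<partial>det_law Laguerre (2 * \<gamma>) \<tau>\<^sub>1 \<tau>\<^sub>2 n) = ennreal (det_mellin Laguerre \<gamma> \<tau>\<^sub>1 \<tau>\<^sub>2 n s)"
    and "AE y in det_law Laguerre (2 * \<gamma>) \<tau>\<^sub>1 \<tau>\<^sub>2 n. y > 0"
proof -
  interpret selberg_family laguerre_weight \<gamma> "1 / 2" 0 by (rule selberg_family_laguerre) fact
  have f: "vandermonde_abs n x powr (2 * \<gamma>) *
     (\<Prod>k\<in>{1..n}. x k powr (2 * \<gamma> / 2 - 1) * exp (- x k / 2) * indicator {0<..} (x k))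
     = selberg_weight n x * (\<Prod>k\<in>{1..n}. x k) powr (\<gamma> - 1)" for x
    unfolding selberg_weight_times_powr repulsion_eq_vandermonde by (simp add: laguerre_weight_def mult.assoc)
  have a: "\<gamma> > 0" "\<gamma> + s > 0" using assms by auto
  note m = moments_det[OF a f, folded laguerre_ensemble_def]
  have "selberg n (\<gamma> + s) / selberg n \<gamma> = det_mellin Laguerre \<gamma> \<tau>\<^sub>1 \<tau>\<^sub>2 n s"
    unfolding laguerre_quotient[OF a(1) a assms(3)] det_mellin.simps prod_atLeast1
    by (intro prod.cong refl) (simp add: gamma_quotient_def powr_def algebra_simps)
  then show "(\<integral>\<^sup>+y. ennreal (y powr s) \<partial>det_law Laguerre (2 * \<gamma>) \<tau>\<^sub>1 \<tau>\<^sub>2 n) = ennreal (det_mellin Laguerre \<gamma> \<tau>\<^sub>1 \<tau>\<^sub>2 n s)"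
    using m(1) by simp
  show "AE y in det_law Laguerre (2 * \<gamma>) \<tau>\<^sub>1 \<tau>\<^sub>2 n. y > 0"
    unfolding det_law.simps by (rule m(2))
qed

lemma jacobi_moments:
  assumes "\<gamma> > 0" "\<bar>s\<bar> < \<gamma>" "\<bar>s\<bar> \<le> 1"
  shows "(\<integral>\<^sup>+y. ennreal (y powr s) \<partial>det_law Jacobi (2 * \<gamma>) \<tau>\<^sub>1 \<tau>\<^sub>2 n) = ennreal (det_mellin Jacobi \<gamma> \<tau>\<^sub>1 \<tau>\<^sub>2 n s)"
    and "AE y in det_law Jacobi (2 * \<gamma>) \<tau>\<^sub>1 \<tau>\<^sub>2 n. y > 0"
proof -
  define m where "m = min (nat \<lfloor>real n * \<tau>\<^sub>1\<rfloor>) (nat \<lfloor>real n * \<tau>\<^sub>2\<rfloor>)"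
  define M where "M = max (nat \<lfloor>real n * \<tau>\<^sub>1\<rfloor>) (nat \<lfloor>real n * \<tau>\<^sub>2\<rfloor>)"
  have law: "det_law Jacobi (2 * \<gamma>) \<tau>\<^sub>1 \<tau>\<^sub>2 n = distr (jacobi_ensemble (2 * \<gamma>) m M) borel (\<lambda>x. \<Prod>k\<in>{1..m}. x k)"
    by (simp add: m_def M_def Let_def)
  have mel: "det_mellin Jacobi \<gamma> \<tau>\<^sub>1 \<tau>\<^sub>2 n s = (\<Prod>k\<in>{1..m}. gamma_quotient (\<gamma> * real k) s
           / gamma_quotient (\<gamma> * (real M + real k)) s)"
    by (simp add: m_def M_def Let_def)
  have mM: "m \<le> M" by (simp add: m_def M_def)
  define b where "b = \<gamma> * (real M - real m + 1)"
  have b: "b > 0" using assms mM by (simp add: b_def)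
  interpret selberg_family "jacobi_weight b" \<gamma> b 1 by (rule selberg_family_jacobi) fact+
  have f: "vandermonde_abs m x powr (2 * \<gamma>) *
     (\<Prod>k\<in>{1..m}. x k powr (2 * \<gamma> / 2 - 1) * (1 - x k) powr (2 * \<gamma> / 2 * (real M - real m + 1) - 1) * indicator {0<..<1} (x k))
     = selberg_weight m x * (\<Prod>k\<in>{1..m}. x k) powr (\<gamma> - 1)" for x
    unfolding selberg_weight_times_powr repulsion_eq_vandermonde by (simp add: jacobi_weight_def b_def mult.assoc)
  have a: "\<gamma> > 0" "\<gamma> + s > 0" using assms by auto
  note mom = moments_det[OF a f, folded jacobi_ensemble_def]
  have "selberg m (\<gamma> + s) / selberg m \<gamma> = det_mellin Jacobi \<gamma> \<tau>\<^sub>1 \<tau>\<^sub>2 n s"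
    unfolding jacobi_quotient[OF a(1) a assms(3) b] mel prod_atLeast1
  proof (intro prod.cong refl)
    fix j assume "j \<in> {..<m}"
    have "\<gamma> + \<gamma> * real j = \<gamma> * real (Suc j)" "\<gamma> + (b + \<gamma> * (real m - 1 + real j)) = \<gamma> * (real M + real (Suc j))"
      by (simp_all add: b_def algebra_simps)
    then show "Gamma (\<gamma> + \<gamma> * real j + s) / Gamma (\<gamma> + \<gamma> * real j) /
         (Gamma (\<gamma> + (b + \<gamma> * (real m - 1 + real j)) + s) / Gamma (\<gamma> + (b + \<gamma> * (real m - 1 + real j))))
         = gamma_quotient (\<gamma> * real (Suc j)) s / gamma_quotient (\<gamma> * (real M + real (Suc j))) s"
      by (simp only: gamma_quotient_def)
  qed
  then show "(\<integral>\<^sup>+y. ennreal (y powr s) \<partial>det_law Jacobi (2 * \<gamma>) \<tau>\<^sub>1 \<tau>\<^sub>2 n) = ennreal (det_mellin Jacobi \<gamma> \<tau>\<^sub>1 \<tau>\<^sub>2 n s)"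
    using mom(1) by (simp only: law)
  show "AE y in det_law Jacobi (2 * \<gamma>) \<tau>\<^sub>1 \<tau>\<^sub>2 n. y > 0"
    using mom(2) by (simp only: law)
qed

lemma beta_distribution_moments:
  assumes "a > 0" "b > 0" "a + s > 0"
  shows "(\<integral>\<^sup>+x. ennreal (x powr s) \<partial>beta_distribution a b) = ennreal (Beta (a + s) b / Beta a b)"
proof -
  have B: "Beta a b > 0" using assms by (simp add: Beta_def Gamma_real_pos)
  have int: "((\<lambda>x. x powr (a + s - 1) * (1 - x) powr (b - 1) / Beta a b) has_integral Beta (a + s) b / Beta a b) {0<..<1}"
    using has_integral_divide[OF has_integral_Beta_real[OF assms(3,2)]] by (simp add: has_integral_Icc_iff_Ioo)
  have "(\<integral>\<^sup>+x. ennreal (x powr s) \<partial>beta_distribution a b)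
     = (\<integral>\<^sup>+x. ennreal (x powr (a - 1) * (1 - x) powr (b - 1) / Beta a b * indicator {0<..<1} x) * ennreal (x powr s) \<partial>lborel)"
    unfolding beta_distribution_def by (intro nn_integral_density) auto
  also have "\<dots> = (\<integral>\<^sup>+x. ennreal (indicator {0<..<1} x * (x powr (a + s - 1) * (1 - x) powr (b - 1) / Beta a b)) \<partial>lborel)"
  proof (intro nn_integral_cong)
    fix x :: real
    have e: "a + s - 1 = (a - 1) + s" by simp
    show "ennreal (x powr (a - 1) * (1 - x) powr (b - 1) / Beta a b * indicator {0<..<1} x) * ennreal (x powr s)
      = ennreal (indicator {0<..<1} x * (x powr (a + s - 1) * (1 - x) powr (b - 1) / Beta a b))"
      unfolding e powr_add using B by (simp add: ennreal_mult'[symmetric] mult_ac indicator_def)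
  qed
  also have "\<dots> = ennreal (Beta (a + s) b / Beta a b)"
    using B by (intro nn_integral_has_integral_lebesgue int) simp
  finally show ?thesis .
qed

lemma prob_space_beta_distribution:
  assumes "a > 0" "b > 0"
  shows "prob_space (beta_distribution a b)"
proof
  have B: "Beta a b > 0" using assms by (simp add: Beta_def Gamma_real_pos)
  have "emeasure (beta_distribution a b) (space (beta_distribution a b)) = (\<integral>\<^sup>+x. 1 \<partial>beta_distribution a b)"
    by simp
  also have "\<dots> = (\<integral>\<^sup>+x. ennreal (x powr 0) \<partial>beta_distribution a b)"
  proof (rule nn_integral_cong_AE)
    have "AE x in lborel. x \<noteq> (0 :: real)" by (rule AE_lborel_singleton)
    then show "AE x in beta_distribution a b. 1 = ennreal (x powr 0)"
      unfolding beta_distribution_def by (subst AE_density) (auto elim!: eventually_mono)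
  qed
  also have "\<dots> = 1" using beta_distribution_moments[of a b 0] assms B by simp
  finally show "emeasure (beta_distribution a b) (space (beta_distribution a b)) = 1" .
qed

lemma AE_beta_distribution: "AE x in beta_distribution a b. x > 0"
  unfolding beta_distribution_def by (subst AE_density) (auto simp: indicator_def intro!: AE_I2)

text \<open>The moments of \<open>\<rho>\<^sub>k\<close> are \<open>\<Gamma> (a + s) * \<Gamma> (a + b) / (\<Gamma> a * \<Gamma> (a + b + s))\<close>, where \<open>a + b = \<gamma> * n\<close> does not depend
on \<open>k\<close> and \<open>a = \<gamma> * (n + 1 - k)\<close> runs through all multiples of \<open>\<gamma>\<close> below \<open>\<gamma> * n\<close>.\<close>

lemma gram_moments:
  assumes "\<gamma> > 0" "\<bar>s\<bar> < \<gamma>"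
  shows "(\<integral>\<^sup>+y. ennreal (y powr s) \<partial>det_law Gram (2 * \<gamma>) \<tau>\<^sub>1 \<tau>\<^sub>2 n) = ennreal (det_mellin Gram \<gamma> \<tau>\<^sub>1 \<tau>\<^sub>2 n s)"
    and "AE y in det_law Gram (2 * \<gamma>) \<tau>\<^sub>1 \<tau>\<^sub>2 n. y > 0"
proof -
  define a where "a k = \<gamma> * (real n - real k + 1)" for k
  define b where "b k = \<gamma> * (real k - 1)" for k
  \<comment> \<open>Outside of the index set the parameters would not be positive; there any probability measure serves.\<close>
  define B where "B k = (if k \<in> {2..n} then beta_distribution (a k) (b k) else beta_distribution 1 1)" for k
  have ab: "a k > 0" "b k > 0" if "k \<in> {2..n}" for k
    using that assms by (auto simp: a_def b_def intro!: mult_pos_pos)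
  have prob: "prob_space (B k)" for k
    using ab[of k] by (auto simp: B_def intro: prob_space_beta_distribution)
  then interpret product_prob_space B UNIV
    by (simp add: product_prob_space_def product_prob_space_axioms_def product_sigma_finite_def prob_space_imp_sigma_finite)
  have sB [measurable_cong]: "sets (B k) = sets borel" for k by (simp add: B_def beta_distribution_def)
  have law: "det_law Gram (2 * \<gamma>) \<tau>\<^sub>1 \<tau>\<^sub>2 n = distr (Pi\<^sub>M {2..n} B) borel (\<lambda>\<rho>. \<Prod>k\<in>{2..n}. \<rho> k)"
  proof -
    have "gram_factors (2 * \<gamma>) n = Pi\<^sub>M {2..n} B"
      unfolding gram_factors_def by (rule PiM_cong) (auto simp: B_def a_def b_def)
    then show ?thesis by simp
  qed
  have m1: "(\<lambda>\<rho>. \<rho> k) \<in> borel_measurable (Pi\<^sub>M {2..n} B)" if "k \<in> {2..n}" for k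
    using measurable_component_singleton[OF that, of B] by (simp add: measurable_cong_sets[OF refl sB])
  have m [measurable]: "(\<lambda>\<rho>. \<Prod>k\<in>{2..n}. \<rho> k) \<in> borel_measurable (Pi\<^sub>M {2..n} B)"
    by (intro borel_measurable_prod m1)
  have "AE x in B k. x > 0" for k
    by (cases "k \<in> {2..n}") (simp_all only: B_def if_True if_False AE_beta_distribution)
  then have "AE \<rho> in Pi\<^sub>M {2..n} B. \<rho> k > 0" if "k \<in> {2..n}" for k
    using that prob by (intro AE_PiM_component) auto
  then have AE: "AE \<rho> in Pi\<^sub>M {2..n} B. \<forall>k\<in>{2..n}. \<rho> k > 0"
    by (intro AE_finite_allI) auto
  show "AE y in det_law Gram (2 * \<gamma>) \<tau>\<^sub>1 \<tau>\<^sub>2 n. y > 0"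
    unfolding law using AE by (subst AE_distr_iff) (auto elim!: eventually_mono intro!: prod_pos)
  have "(\<integral>\<^sup>+y. ennreal (y powr s) \<partial>det_law Gram (2 * \<gamma>) \<tau>\<^sub>1 \<tau>\<^sub>2 n)
      = (\<integral>\<^sup>+\<rho>. ennreal ((\<Prod>k\<in>{2..n}. \<rho> k) powr s) \<partial>Pi\<^sub>M {2..n} B)"
    unfolding law by (rule nn_integral_distr) auto
  also have "\<dots> = (\<integral>\<^sup>+\<rho>. (\<Prod>k\<in>{2..n}. ennreal (\<rho> k powr s)) \<partial>Pi\<^sub>M {2..n} B)"
  proof (rule nn_integral_cong_AE)
    show "AE \<rho> in Pi\<^sub>M {2..n} B. ennreal ((\<Prod>k\<in>{2..n}. \<rho> k) powr s) = (\<Prod>k\<in>{2..n}. ennreal (\<rho> k powr s))"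
      using AE
    proof eventually_elim
      case (elim \<rho>)
      then have "(\<Prod>k\<in>{2..n}. \<rho> k) powr s = (\<Prod>k\<in>{2..n}. \<rho> k powr s)"
        by (intro powr_prod_eq) (auto intro: less_imp_le)
      then show ?case by (simp add: prod_ennreal)
    qed
  qed
  also have "\<dots> = (\<Prod>k\<in>{2..n}. \<integral>\<^sup>+x. ennreal (x powr s) \<partial>B k)"
    by (rule product_nn_integral_prod) auto
  also have "\<dots> = (\<Prod>k\<in>{2..n}. ennreal (Beta (a k + s) (b k) / Beta (a k) (b k)))"
  proof (rule prod.cong[OF refl])
    fix k assume k: "k \<in> {2..n}"
    have "\<gamma> * 1 \<le> a k" unfolding a_def using k assms by (intro mult_left_mono) auto
    then show "(\<integral>\<^sup>+x. ennreal (x powr s) \<partial>B k) = ennreal (Beta (a k + s) (b k) / Beta (a k) (b k))"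
      using k ab[OF k] assms by (simp add: B_def beta_distribution_moments)
  qed
  also have "\<dots> = (\<Prod>k\<in>{2..n}. ennreal (gamma_quotient (\<gamma> * real (n + 1 - k)) s / gamma_quotient (\<gamma> * real n) s))"
  proof (rule prod.cong[OF refl])
    fix k assume k: "k \<in> {2..n}"
    have eq: "a k + b k = \<gamma> * real n" "a k = \<gamma> * real (n + 1 - k)" "a k + s + b k = \<gamma> * real n + s"
      using k by (auto simp: a_def b_def of_nat_diff algebra_simps)
    have "Gamma (b k) \<noteq> 0" using Gamma_real_pos[OF ab(2)[OF k]] by (metis less_irrefl)
    then show "ennreal (Beta (a k + s) (b k) / Beta (a k) (b k)) = ennreal (gamma_quotient (\<gamma> * real (n + 1 - k)) s / gamma_quotient (\<gamma> * real n) s)"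
      unfolding Beta_def gamma_quotient_def eq(1) eq(3) eq(2)[symmetric] by (simp add: mult.commute)
  qed
  also have "\<dots> = (\<Prod>j\<in>{1..<n}. ennreal (gamma_quotient (\<gamma> * real j) s / gamma_quotient (\<gamma> * real n) s))"
    by (rule prod.reindex_bij_witness[of _ "\<lambda>j. n + 1 - j" "\<lambda>j. n + 1 - j"]) auto
  also have "\<dots> = ennreal (\<Prod>j\<in>{1..<n}. gamma_quotient (\<gamma> * real j) s / gamma_quotient (\<gamma> * real n) s)"
  proof (rule prod_ennreal)
    fix j assume j: "j \<in> {1..<n}"
    have "\<gamma> * 1 \<le> \<gamma> * real j" "\<gamma> * 1 \<le> \<gamma> * real n" using j assms by (auto intro!: mult_left_mono)
    then have "0 < \<gamma> * real j" "0 < \<gamma> * real j + s" "0 < \<gamma> * real n" "0 < \<gamma> * real n + s" using assms by linarith+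
    then show "0 \<le> gamma_quotient (\<gamma> * real j) s / gamma_quotient (\<gamma> * real n) s"
      unfolding gamma_quotient_def by (intro divide_nonneg_nonneg) (auto intro: less_imp_le Gamma_real_pos)
  qed
  also have "(\<Prod>j\<in>{1..<n}. gamma_quotient (\<gamma> * real j) s / gamma_quotient (\<gamma> * real n) s) = det_mellin Gram \<gamma> \<tau>\<^sub>1 \<tau>\<^sub>2 n s"
  proof (cases "n = 0")
    case False
    have "\<gamma> * 1 \<le> \<gamma> * real n" using False assms by (intro mult_left_mono) auto
    then have "0 < \<gamma> * real n" "0 < \<gamma> * real n + s" using assms by linarith+
    then have "Gamma (\<gamma> * real n) \<noteq> 0" "Gamma (\<gamma> * real n + s) \<noteq> 0"
      using Gamma_real_pos by (metis less_irrefl)+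
    then have "gamma_quotient (\<gamma> * real n) s \<noteq> 0" by (simp add: gamma_quotient_def)
    moreover have "{1..n} = insert n {1..<n}" using False by auto
    ultimately show ?thesis by simp
  qed simp
  finally show "(\<integral>\<^sup>+y. ennreal (y powr s) \<partial>det_law Gram (2 * \<gamma>) \<tau>\<^sub>1 \<tau>\<^sub>2 n) = ennreal (det_mellin Gram \<gamma> \<tau>\<^sub>1 \<tau>\<^sub>2 n s)" .
qed

lemma sets_det_law [simp]: "sets (det_law i \<beta> \<tau>\<^sub>1 \<tau>\<^sub>2 n) = sets borel"
  by (cases i) (simp_all add: Let_def)

lemma det_law_moments:
  assumes "\<gamma> > 0" "\<bar>s\<bar> < \<gamma>" "\<bar>s\<bar> \<le> 1"
  shows "(\<integral>\<^sup>+y. ennreal (y powr s) \<partial>det_law i (2 * \<gamma>) \<tau>\<^sub>1 \<tau>\<^sub>2 n) = ennreal (det_mellin i \<gamma> \<tau>\<^sub>1 \<tau>\<^sub>2 n s)"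
    and "AE y in det_law i (2 * \<gamma>) \<tau>\<^sub>1 \<tau>\<^sub>2 n. y > 0"
  by (cases i; simp only: laguerre_moments[OF assms] gram_moments[OF assms(1,2)] jacobi_moments[OF assms])+

lemma X_law_mgf:
  assumes "\<gamma> > 0" "\<bar>s\<bar> < \<gamma>" "\<bar>s\<bar> \<le> 1"
  shows "(\<integral>\<^sup>+x. ennreal (exp (s * x)) \<partial>X_law i (2 * \<gamma>) \<tau>\<^sub>1 \<tau>\<^sub>2 n)
    = ennreal (det_mellin i \<gamma> \<tau>\<^sub>1 \<tau>\<^sub>2 n s * exp (- s * centering i (2 * \<gamma>) \<tau>\<^sub>1 \<tau>\<^sub>2 n))"
proof -
  let ?c = "centering i (2 * \<gamma>) \<tau>\<^sub>1 \<tau>\<^sub>2 n" and ?D = "det_law i (2 * \<gamma>) \<tau>\<^sub>1 \<tau>\<^sub>2 n"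
  note [measurable_cong] = sets_det_law
  have "(\<integral>\<^sup>+x. ennreal (exp (s * x)) \<partial>X_law i (2 * \<gamma>) \<tau>\<^sub>1 \<tau>\<^sub>2 n) = (\<integral>\<^sup>+y. ennreal (exp (s * (ln y - ?c))) \<partial>?D)"
    unfolding X_law_def by (rule nn_integral_distr) measurable
  also have "\<dots> = (\<integral>\<^sup>+y. ennreal (exp (- s * ?c)) * ennreal (y powr s) \<partial>?D)"
  proof (rule nn_integral_cong_AE)
    show "AE y in ?D. ennreal (exp (s * (ln y - ?c))) = ennreal (exp (- s * ?c)) * ennreal (y powr s)"
      using det_law_moments(2)[OF assms, of i \<tau>\<^sub>1 \<tau>\<^sub>2 n]
    proof eventually_elim
      case (elim y)
      then show ?case
        by (simp add: powr_def ennreal_mult'[symmetric] algebra_simps flip: exp_add)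
    qed
  qed
  also have "\<dots> = ennreal (exp (- s * ?c)) * ennreal (det_mellin i \<gamma> \<tau>\<^sub>1 \<tau>\<^sub>2 n s)"
    by (subst nn_integral_cmult) (auto simp: det_law_moments(1)[OF assms])
  finally show ?thesis by (simp add: ennreal_mult'' mult.commute)
qed

section \<open>Expansion of Gamma quotients\<close>

lemma Ln_one_plus_third_order:
  fixes u :: complex
  assumes "norm u \<le> 1 / 2"
  shows "norm (Ln (1 + u) - (u - u\<^sup>2 / 2)) \<le> 2 * norm u ^ 3"
proof -
  define f where "f n = - ((-u) ^ n) / of_nat n" for n
  have "f sums Ln (1 + u)" unfolding f_def using assms by (intro Ln_series') auto
  from sums_split_initial_segment[OF this, of 3]
  have s: "(\<lambda>n. f (n + 3)) sums (Ln (1 + u) - (\<Sum>i<3. f i))" .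
  have "(\<Sum>i<3. f i) = u - u\<^sup>2 / 2" 
    by (simp add: f_def numeral_3_eq_3 lessThan_Suc power2_eq_square)
  with s have s: "(\<lambda>n. f (n + 3)) sums (Ln (1 + u) - (u - u\<^sup>2 / 2))" by (simp only:)
  have b: "norm (f (n + 3)) \<le> norm u ^ 3 * norm u ^ n" for n
  proof -
    have "norm (f (n + 3)) = norm u ^ (n + 3) / real (n + 3)"
      unfolding f_def norm_divide norm_minus_cancel norm_power norm_of_nat ..
    also have "\<dots> \<le> norm u ^ (n + 3) / 1" by (intro divide_left_mono) auto
    finally show ?thesis by (simp add: power_add mult.commute)
  qed
  have g: "(\<lambda>n. norm u ^ 3 * norm u ^ n) sums (norm u ^ 3 * (1 / (1 - norm u)))"
    using assms by (intro sums_mult geometric_sums) auto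
  have "norm (Ln (1 + u) - (u - u\<^sup>2 / 2)) = norm (\<Sum>n. f (n + 3))" using s by (simp add: sums_iff)
  also have "\<dots> \<le> (\<Sum>n. norm u ^ 3 * norm u ^ n)"
    using g b by (intro norm_suminf_le) (auto simp: sums_iff)
  also have "\<dots> = norm u ^ 3 * (1 / (1 - norm u))" using g by (simp add: sums_iff)
  also have "\<dots> \<le> norm u ^ 3 * 2" using assms by (intro mult_left_mono) (auto simp: field_simps)
  finally show ?thesis by simp
qed

lemma ln_one_plus_third_order:
  fixes x :: real
  assumes "x \<ge> 0"
  shows "\<bar>ln (1 + x) - (x - x\<^sup>2 / 2)\<bar> \<le> x ^ 3"
proof -
  let ?g = "\<lambda>x::real. ln (1 + x) - (x - x\<^sup>2 / 2)"
  have d: "(?g has_real_derivative t\<^sup>2 / (1 + t)) (at t)" if "t \<ge> 0" for t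
  proof -
    have "(?g has_real_derivative 1 / (1 + t) - (1 - t)) (at t)"
      using that by (auto intro!: derivative_eq_intros)
    moreover have "1 / (1 + t) - (1 - t) = t\<^sup>2 / (1 + t)"
      using that by (simp add: field_simps power2_eq_square)
    ultimately show ?thesis by simp
  qed
  have "?g 0 \<le> ?g x"
    by (rule DERIV_nonneg_imp_nondecreasing[OF assms]) (use d in force)
  moreover have "x ^ 3 - ?g x \<ge> 0 ^ 3 - ?g 0"
  proof (rule DERIV_nonneg_imp_nondecreasing[OF assms])
    fix t :: real assume t: "0 \<le> t" "t \<le> x"
    have "((\<lambda>x. x ^ 3 - ?g x) has_real_derivative (3 * t\<^sup>2 - t\<^sup>2 / (1 + t))) (at t)"
      by (rule DERIV_diff[OF _ d[OF t(1)]]) (auto intro!: derivative_eq_intros)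
    moreover have "t\<^sup>2 / (1 + t) \<le> t\<^sup>2 / 1" using t by (intro divide_left_mono) auto
    then have "3 * t\<^sup>2 - t\<^sup>2 / (1 + t) \<ge> 0" using zero_le_power2[of t] by linarith
    ultimately show "\<exists>y. ((\<lambda>x. x ^ 3 - ?g x) has_real_derivative y) (at t) \<and> 0 \<le> y" by blast
  qed
  ultimately show ?thesis by simp
qed

text \<open>The first two terms of Stirling's expansion of \<open>log (\<Gamma> (w + z) / \<Gamma> w)\<close>.\<close>

definition log_gamma_main :: "complex \<Rightarrow> real \<Rightarrow> complex" where
  "log_gamma_main z w = z * of_real (ln w) + (z\<^sup>2 - z) / (2 * of_real w)"

text \<open>How far these terms are from satisfying the functional equation, under which \<open>w \<mapsto> w + 1\<close> adds
\<open>log (1 + z / w)\<close>.\<close>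

definition log_gamma_defect :: "complex \<Rightarrow> real \<Rightarrow> complex" where
  "log_gamma_defect z w = log_gamma_main z (w + 1) - log_gamma_main z w - Ln (1 + z / of_real w)"

lemma norm_square_diff_le: "norm (z\<^sup>2 - z) \<le> 2 * norm z" if "norm z \<le> 1" for z :: complex
proof -
  have "norm (z\<^sup>2 - z) \<le> norm z * norm z + norm z"
    by (intro order_trans[OF norm_triangle_ineq4]) (simp add: power2_eq_square norm_mult)
  also have "\<dots> \<le> norm z * 1 + norm z" using that by (intro add_mono mult_left_mono) auto
  finally show ?thesis by simp
qed

text \<open>All terms up to order \<open>1 / w\<^sup>2\<close> cancel. Every remaining one contains a factor \<open>z\<close>, which is kept, as the final
error has to vanish with \<open>z\<close>.\<close>

lemma log_gamma_defect_bound: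
  assumes w: "w > 0" and z: "norm z \<le> 1" "norm z \<le> w / 2"
  shows "norm (log_gamma_defect z w) \<le> 4 * norm z / w ^ 3"
proof -
  define r1 where "r1 = ln (1 + 1 / w) - (1 / w - (1 / w)\<^sup>2 / 2)"
  define u where "u = z / of_real w"
  define r2 where "r2 = Ln (1 + u) - (u - u\<^sup>2 / 2)"
  have u: "norm u \<le> 1 / 2" using z(2) w by (simp add: u_def norm_divide field_simps)
  have b1: "\<bar>r1\<bar> \<le> (1 / w) ^ 3" unfolding r1_def using w by (intro ln_one_plus_third_order) auto
  have b2: "norm r2 \<le> 2 * norm u ^ 3" unfolding r2_def by (rule Ln_one_plus_third_order) fact
  have ln: "ln (w + 1) - ln w = 1 / w - (1 / w)\<^sup>2 / 2 + r1"
  proof -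
    have "ln (w + 1) - ln w = ln ((w + 1) / w)" using w by (simp add: ln_div)
    also have "(w + 1) / w = 1 + 1 / w" using w by (simp add: field_simps)
    finally show ?thesis by (simp add: r1_def)
  qed
  have "log_gamma_defect z w = z * of_real (ln (w + 1) - ln w) + (z\<^sup>2 - z) / 2 * of_real (1 / (w + 1) - 1 / w)
      - (u - u\<^sup>2 / 2 + r2)"
    unfolding log_gamma_defect_def log_gamma_main_def r2_def u_def
    by (simp add: algebra_simps diff_divide_distrib add_divide_distrib)
  also have "\<dots> = z * of_real r1 + (z\<^sup>2 - z) * of_real (1 / (2 * w\<^sup>2 * (w + 1))) - r2"
  proof -
    define i where "i = 1 / w"
    define c where "c = 1 / (w\<^sup>2 * (w + 1))"
    have e: "1 / (w + 1) - i = - i\<^sup>2 + c"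
      using w by (simp add: i_def c_def divide_simps power2_eq_square)
    have u': "u = z * of_real i" by (simp add: u_def i_def)
    have c': "1 / (2 * w\<^sup>2 * (w + 1)) = c / 2" by (simp add: c_def)
    show ?thesis unfolding ln i_def[symmetric] e u' c'
      by (simp add: field_simps power2_eq_square)
  qed
  finally have eq: "log_gamma_defect z w = z * of_real r1 + (z\<^sup>2 - z) * of_real (1 / (2 * w\<^sup>2 * (w + 1))) - r2" .
  have n1: "norm (z * of_real r1) \<le> norm z / w ^ 3"
    using mult_left_mono[OF b1, of "norm z"] by (simp add: norm_mult power_divide)
  have n2: "norm ((z\<^sup>2 - z) * of_real (1 / (2 * w\<^sup>2 * (w + 1)))) \<le> norm z / w ^ 3"
  proof -
    have n: "norm (z\<^sup>2 - z) \<le> 2 * norm z" by (rule norm_square_diff_le[OF z(1)])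
    have "norm ((z\<^sup>2 - z) * of_real (1 / (2 * w\<^sup>2 * (w + 1)))) = norm (z\<^sup>2 - z) * (1 / (2 * w\<^sup>2 * (w + 1)))"
      unfolding norm_mult norm_of_real using w by simp
    also have "\<dots> \<le> (2 * norm z) * (1 / (2 * w\<^sup>2 * w))"
      using n w by (intro mult_mono divide_left_mono) (auto intro!: mult_pos_pos)
    also have "\<dots> = norm z / w ^ 3" by (simp add: power3_eq_cube power2_eq_square)
    finally show ?thesis .
  qed
  have n3: "norm r2 \<le> 2 * norm z / w ^ 3"
  proof -
    have "norm z ^ 3 \<le> norm z"
      using power_decreasing[of 1 3 "norm z"] z by simp
    then have "norm u ^ 3 \<le> norm z / w ^ 3"
      using w by (simp add: u_def norm_divide power_divide divide_right_mono)
    with b2 show ?thesis by simp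
  qed
  have "norm (log_gamma_defect z w) \<le> norm z / w ^ 3 + norm z / w ^ 3 + 2 * norm z / w ^ 3"
    unfolding eq by (intro order_trans[OF norm_triangle_ineq4] add_mono order_trans[OF norm_triangle_ineq] n1 n2 n3)
  then show ?thesis by simp
qed

lemma sum_inverse_cubes_le:
  fixes w :: real
  assumes "w > 0"
  shows "(\<Sum>j<N. 1 / (w + real j) ^ 3) \<le> (1 + 1 / w) / w\<^sup>2"
proof -
  have "(\<Sum>j<N. 1 / (w + real j) ^ 3) \<le> (1 + 1 / w) / w\<^sup>2 - 1 / (w * (w + real N - 1))" if "N \<ge> 1"
    using that
  proof (induction N rule: nat_induct_at_least)
    case base
    show ?case using assms by (simp add: field_simps power3_eq_cube power2_eq_square)
  next
    case (Suc N)
    define v where "v = w + real N"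
    have v: "v \<ge> w" "v - 1 > 0 \<or> v - 1 = w + real N - 1" "v - 1 \<ge> w" using assms Suc(1) by (auto simp: v_def)
    have "1 / v ^ 3 \<le> 1 / (w * (v - 1)) - 1 / (w * v)"
    proof -
      have "w * (v - 1) \<le> v * v" using v assms by (intro mult_mono) auto
      then have "w * (v * (v - 1)) \<le> v ^ 3"
        using v assms mult_left_mono[of "w * (v - 1)" "v * v" v] by (simp add: power3_eq_cube mult_ac)
      then have "1 / v ^ 3 \<le> 1 / (w * (v * (v - 1)))"
        using v assms by (intro divide_left_mono) (auto intro!: mult_pos_pos)
      also have "\<dots> = 1 / (w * (v - 1)) - 1 / (w * v)" using v assms by (simp add: field_simps)
      finally show ?thesis .
    qed
    then show ?case using Suc.IH by (simp add: v_def algebra_simps)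
  qed
  moreover have "1 / (w * (w + real N - 1)) \<ge> 0" if "N \<ge> 1"
    using that assms by simp
  ultimately show ?thesis
  proof (cases "N \<ge> 1")
    case False
    then have "N = 0" by simp
    then show ?thesis using assms by simp
  qed (smt (verit))
qed

text \<open>The expansion is asymptotically correct along \<open>w + N\<close>, by the limit formula that expresses \<open>\<Gamma>\<close>
through Pochhammer symbols.\<close>

lemma gamma_quotient_ratio_tendsto:
  fixes w :: real and z :: complex
  assumes w: "w > 0" "Re z > - w"
  shows "(\<lambda>N. gamma_quotient (of_real (w + real N)) z / exp (log_gamma_main z (w + real N))) \<longlonglongrightarrow> 1"
proof -
  let ?w = "complex_of_real w"
  have not: "?w \<notin> \<int>\<^sub>\<le>\<^sub>0" "?w + z \<notin> \<int>\<^sub>\<le>\<^sub>0"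
    using w by (auto elim!: nonpos_Ints_cases simp: complex_eq_iff)
  have G: "Gamma ?w \<noteq> 0" "Gamma (?w + z) \<noteq> 0" using not by (auto simp: Gamma_eq_zero_iff)
  have poch: "Gamma (a + of_nat N) = Gamma a * pochhammer a N" if "a \<notin> \<int>\<^sub>\<le>\<^sub>0" for a :: complex and N
    using pochhammer_Gamma[OF that, of N] that by (simp add: Gamma_eq_zero_iff)
  have poch0: "pochhammer a N \<noteq> 0" if "a \<notin> \<int>\<^sub>\<le>\<^sub>0" for a :: complex and N
    using that by (auto simp: pochhammer_eq_0_iff)
  have "(\<lambda>N. (Gamma_series' ?w N / Gamma_series' (?w + z) N) * (Gamma (?w + z) / Gamma ?w)
      * exp (of_real (ln (real N) - ln (w + real N)) * z - (z\<^sup>2 - z) / 2 * of_real (1 / (w + real N))))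
     \<longlonglongrightarrow> (Gamma ?w / Gamma (?w + z)) * (Gamma (?w + z) / Gamma ?w) * exp (of_real 0 * z - (z\<^sup>2 - z) / 2 * of_real 0)"
  proof (intro tendsto_intros Gamma_series'_LIMSEQ G)
    show "(\<lambda>N. ln (real N) - ln (w + real N)) \<longlonglongrightarrow> 0" by real_asymp
    show "(\<lambda>N. 1 / (w + real N)) \<longlonglongrightarrow> 0" by real_asymp
  qed
  also have "(Gamma ?w / Gamma (?w + z)) * (Gamma (?w + z) / Gamma ?w) * exp (of_real 0 * z - (z\<^sup>2 - z) / 2 * of_real 0) = 1"
    using G by simp
  finally show ?thesis
  proof (rule Lim_transform_eventually)
    show "\<forall>\<^sub>F N in sequentially. (Gamma_series' ?w N / Gamma_series' (?w + z) N) * (Gamma (?w + z) / Gamma ?w)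
      * exp (of_real (ln (real N) - ln (w + real N)) * z - (z\<^sup>2 - z) / 2 * of_real (1 / (w + real N)))
      = gamma_quotient (of_real (w + real N)) z / exp (log_gamma_main z (w + real N))"
      using eventually_gt_at_top[of 0]
    proof eventually_elim
      case (elim N)
      have gq: "gamma_quotient (of_real (w + real N)) z
          = (Gamma (?w + z) * pochhammer (?w + z) N) / (Gamma ?w * pochhammer ?w N)"
        unfolding gamma_quotient_def using poch[OF not(1), of N] poch[OF not(2), of N] by (simp add: add_ac)
      have gs: "Gamma_series' ?w N / Gamma_series' (?w + z) N
          = pochhammer (?w + z) N / pochhammer ?w N * exp (- (of_real (ln (real N)) * z))"
        using poch0[OF not(1), of N] poch0[OF not(2), of N]
        by (simp add: Gamma_series'_def field_simps exp_minus flip: exp_add)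
      have ex: "exp (- (of_real (ln (real N)) * z))
        * exp (of_real (ln (real N) - ln (w + real N)) * z - (z\<^sup>2 - z) / 2 * of_real (1 / (w + real N)))
        = inverse (exp (log_gamma_main z (w + real N)))"
        unfolding exp_add[symmetric] exp_minus[symmetric] log_gamma_main_def by (simp add: algebra_simps)
      have "(Gamma_series' ?w N / Gamma_series' (?w + z) N) * (Gamma (?w + z) / Gamma ?w)
        * exp (of_real (ln (real N) - ln (w + real N)) * z - (z\<^sup>2 - z) / 2 * of_real (1 / (w + real N)))
        = (pochhammer (?w + z) N / pochhammer ?w N * (Gamma (?w + z) / Gamma ?w)) * (exp (- (of_real (ln (real N)) * z))
        * exp (of_real (ln (real N) - ln (w + real N)) * z - (z\<^sup>2 - z) / 2 * of_real (1 / (w + real N))))"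
        unfolding gs by (simp only: mult_ac)
      also have "\<dots> = gamma_quotient (of_real (w + real N)) z / exp (log_gamma_main z (w + real N))"
        unfolding ex gq by (simp add: divide_inverse mult_ac)
      finally show ?case .
    qed
  qed
qed

text \<open>Telescoping: the error of the expansion at \<open>w\<close> is the sum of the defects at \<open>w + j\<close>, since it vanishes at
infinity. Summing the cubic bound on the defects leaves \<open>1 / w\<^sup>2\<close>, which is summable over multiples of \<open>\<gamma>\<close>.\<close>

lemma gamma_quotient_expansion:
  fixes w :: real and z :: complex
  assumes w: "w \<ge> \<gamma>" and \<gamma>: "\<gamma> > 0" and z: "norm z \<le> 1" "norm z \<le> \<gamma> / 2"
  obtains D where "gamma_quotient (of_real w) z = exp (log_gamma_main z w + D)"
    and "norm D \<le> 4 * (1 + 1 / \<gamma>) * norm z / w\<^sup>2"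
proof -
  define d where "d j = log_gamma_defect z (w + real j)" for j
  define Q where "Q N = gamma_quotient (of_real (w + real N)) z / exp (log_gamma_main z (w + real N))" for N
  have wp: "w > 0" using w \<gamma> by simp
  have d: "norm (d j) \<le> 4 * norm z * (1 / (w + real j) ^ 3)" for j
    unfolding d_def using log_gamma_defect_bound[of "w + real j" z] w wp z by simp
  have sum_d: "(\<Sum>j<N. norm (d j)) \<le> 4 * (1 + 1 / \<gamma>) * norm z / w\<^sup>2" for N
  proof -
    have "(\<Sum>j<N. norm (d j)) \<le> (\<Sum>j<N. 4 * norm z * (1 / (w + real j) ^ 3))"
      by (intro sum_mono d)
    also have "\<dots> = 4 * norm z * (\<Sum>j<N. 1 / (w + real j) ^ 3)" by (simp add: sum_distrib_left)
    also have "\<dots> \<le> 4 * norm z * ((1 + 1 / w) / w\<^sup>2)"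
      by (intro mult_left_mono sum_inverse_cubes_le wp) simp
    also have "\<dots> \<le> 4 * norm z * ((1 + 1 / \<gamma>) / w\<^sup>2)"
      using w \<gamma> by (intro mult_left_mono divide_right_mono add_left_mono) (auto intro!: divide_left_mono)
    finally show ?thesis by (simp add: mult_ac)
  qed
  have summ: "summable (\<lambda>j. norm (d j))"
    by (rule bounded_imp_summable[of _ "4 * (1 + 1 / \<gamma>) * norm z / w\<^sup>2"])
       (use sum_d[of "Suc _"] in \<open>auto simp: lessThan_Suc_atMost\<close>)
  have Qstep: "Q N = Q (Suc N) * exp (d N)" for N
  proof -
    define v where "v = w + real N"
    have v: "v > 0" "v \<ge> w" using wp by (auto simp: v_def)
    have zv: "norm z < v" using z w \<gamma> v by simp
    have "Re z > - v" using zv abs_Re_le_cmod[of z] by linarith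
    then have not: "complex_of_real v \<notin> \<int>\<^sub>\<le>\<^sub>0" "complex_of_real v + z \<notin> \<int>\<^sub>\<le>\<^sub>0"
      using v by (auto elim!: nonpos_Ints_cases simp: complex_eq_iff)
    then have nz: "complex_of_real v + z \<noteq> 0" by auto
    have G0: "Gamma (complex_of_real v) \<noteq> 0" by (simp add: Gamma_eq_zero_iff not)
    have eq: "complex_of_real (v + 1) = of_real v + 1" "complex_of_real v + 1 + z = of_real v + z + 1" by simp_all
    have "gamma_quotient (of_real (v + 1)) z = (of_real v + z) * Gamma (of_real v + z) / (of_real v * Gamma (of_real v))"
      unfolding gamma_quotient_def eq Gamma_plus1[OF not(1)] Gamma_plus1[OF not(2)] ..
    also have "\<dots> = gamma_quotient (of_real v) z * (1 + z / of_real v)"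
      using v G0 by (simp add: gamma_quotient_def field_simps)
    also have "1 + z / of_real v = exp (Ln (1 + z / of_real v))"
      using nz v by (subst exp_Ln) (auto simp: field_simps)
    finally have g: "gamma_quotient (of_real (v + 1)) z = gamma_quotient (of_real v) z * exp (Ln (1 + z / of_real v))" .
    have v1: "w + real (Suc N) = v + 1" by (simp add: v_def)
    have "Q (Suc N) * exp (d N) = gamma_quotient (of_real v) z *
      (exp (Ln (1 + z / of_real v)) / exp (log_gamma_main z (v + 1)) * exp (log_gamma_defect z v))"
      unfolding Q_def d_def v1 g v_def[symmetric] by simp
    also have "exp (Ln (1 + z / of_real v)) / exp (log_gamma_main z (v + 1)) * exp (log_gamma_defect z v)
      = inverse (exp (log_gamma_main z v))"
      unfolding exp_diff[symmetric] exp_add[symmetric] exp_minus[symmetric] log_gamma_defect_def by simp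
    finally show ?thesis by (simp add: Q_def v_def divide_inverse)
  qed
  have Qsum: "Q 0 = Q N * exp (\<Sum>j<N. d j)" for N
  proof (induction N)
    case (Suc N)
    then show ?case using Qstep[of N] by (simp add: exp_add mult_ac)
  qed simp
  have rez: "Re z > - w" using z w \<gamma> abs_Re_le_cmod[of z] by linarith
  have "(\<lambda>N. Q N * exp (\<Sum>j<N. d j)) \<longlonglongrightarrow> 1 * exp (\<Sum>j. d j)"
    using gamma_quotient_ratio_tendsto[OF wp rez] summable_LIMSEQ[OF summable_norm_cancel[OF summ]]
    by (intro tendsto_intros) (auto simp: Q_def)
  then have "Q 0 = exp (\<Sum>j. d j)" unfolding Qsum[symmetric] by (simp add: LIMSEQ_const_iff)
  then have "gamma_quotient (of_real w) z = exp (log_gamma_main z w + (\<Sum>j. d j))"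
    by (simp add: Q_def exp_add field_simps)
  moreover have "norm (\<Sum>j. d j) \<le> 4 * (1 + 1 / \<gamma>) * norm z / w\<^sup>2"
    by (intro order_trans[OF summable_norm[OF summ]] suminf_le_const[OF summ] sum_d)
  ultimately show thesis by (rule that)
qed

lemma sum_inverse_squares_le: "(\<Sum>k\<in>{1..N}. 1 / (real k)\<^sup>2) \<le> 2"
proof -
  have "(\<Sum>k\<in>{1..N}. 1 / (real k)\<^sup>2) \<le> 2 - 1 / real N" if "N \<ge> 1"
    using that
  proof (induction N rule: nat_induct_at_least)
    case (Suc N)
    have "1 / (real (Suc N))\<^sup>2 \<le> 1 / (real N * real (Suc N))"
      using Suc(1) by (intro divide_left_mono) (auto simp: power2_eq_square)
    also have "\<dots> = 1 / real N - 1 / real (Suc N)" using Suc(1) by (simp add: field_simps)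
    finally show ?case using Suc.IH Suc(1) by (simp add: atLeastAtMostSuc_conv)
  qed simp
  then show ?thesis by (cases "N \<ge> 1") (smt (verit) of_nat_0_le_iff divide_nonneg_nonneg, simp)
qed

lemma ln_fact_bound:
  assumes "N \<ge> 1"
  shows "\<bar>ln (fact N) - (real N * ln (real N) - real N + ln (real N) / 2)\<bar> \<le> 5"
proof -
  define a where "a N = ln (fact N) - (real N * ln (real N) - real N + ln (real N) / 2)" for N :: nat
  have step: "\<bar>a (Suc N) - a N\<bar> \<le> 2 * (1 / (real N)\<^sup>2)" if "N \<ge> 1" for N
  proof -
    define x where "x = 1 / real N"
    have x: "x > 0" "x \<le> 1" "real N * x = 1" using that by (auto simp: x_def)
    define r where "r = ln (1 + x) - (x - x\<^sup>2 / 2)"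
    have r: "\<bar>r\<bar> \<le> x ^ 3" unfolding r_def using x by (intro ln_one_plus_third_order) auto
    have "ln (real (Suc N)) = ln (real N * (1 + x))" using x by (simp add: algebra_simps)
    also have "\<dots> = ln (real N) + ln (1 + x)" using that x by (simp add: ln_mult)
    finally have l: "ln (real (Suc N)) = ln (real N) + (x - x\<^sup>2 / 2 + r)" by (simp add: r_def)
    have f: "ln (fact (Suc N)) = ln (real (Suc N)) + ln (fact N)" using that by (simp add: ln_mult)
    have "a (Suc N) - a N = 1 - (real N + 1 / 2) * (x - x\<^sup>2 / 2 + r)"
      unfolding a_def f l by (simp add: algebra_simps add_divide_distrib diff_divide_distrib)
    also have "\<dots> = 1 - real N * x + x * (real N * x) / 2 - x / 2 + x\<^sup>2 / 4 - (real N + 1 / 2) * r"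
      by (simp add: algebra_simps power2_eq_square)
    also have "\<dots> = x\<^sup>2 / 4 - (real N + 1 / 2) * r" unfolding x(3) by simp
    finally have eq: "a (Suc N) - a N = x\<^sup>2 / 4 - (real N + 1 / 2) * r" .
    have "\<bar>(real N + 1 / 2) * r\<bar> \<le> (3 / 2 * real N) * x ^ 3"
      unfolding abs_mult using that r by (intro mult_mono) auto
    also have "\<dots> = 3 / 2 * x\<^sup>2 * (real N * x)" by (simp add: power3_eq_cube power2_eq_square)
    finally have "\<bar>(real N + 1 / 2) * r\<bar> \<le> 3 / 2 * x\<^sup>2" unfolding x(3) by simp
    then have "\<bar>a (Suc N) - a N\<bar> \<le> x\<^sup>2 / 4 + 3 / 2 * x\<^sup>2"
      unfolding eq by (intro order_trans[OF abs_triangle_ineq4]) auto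
    also have "\<dots> \<le> 2 * x\<^sup>2" by simp
    finally show ?thesis by (simp add: x_def power_divide)
  qed
  have "\<bar>a N\<bar> \<le> 1 + 2 * (\<Sum>k\<in>{1..<N}. 1 / (real k)\<^sup>2)"
    using assms
  proof (induction N rule: nat_induct_at_least)
    case base
    show ?case by (simp add: a_def)
  next
    case (Suc N)
    have "(\<Sum>k\<in>{1..<Suc N}. 1 / (real k)\<^sup>2) = (\<Sum>k\<in>{1..<N}. 1 / (real k)\<^sup>2) + 1 / (real N)\<^sup>2"
      using Suc(1) by simp
    then show ?case using Suc.IH step[OF Suc(1)] by linarith
  qed
  moreover have "(\<Sum>k\<in>{1..<N}. 1 / (real k)\<^sup>2) \<le> (\<Sum>k\<in>{1..N}. 1 / (real k)\<^sup>2)"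
    by (intro sum_mono2) auto
  ultimately show ?thesis using sum_inverse_squares_le[of N] unfolding a_def by linarith
qed

text \<open>The sum of the main terms at \<open>\<gamma>, \<dots>, \<gamma> * N\<close>, with the factorial and the harmonic number replaced by their
leading asymptotics.\<close>

definition log_gamma_sum :: "real \<Rightarrow> nat \<Rightarrow> complex \<Rightarrow> complex" where
  "log_gamma_sum \<gamma> N z = z * of_real (real N * ln (\<gamma> * real N) - real N + ln (real N) / 2)
     + (z\<^sup>2 - z) * of_real (ln (real N) / (2 * \<gamma>))"

text \<open>The three sources of error are Stirling's formula for \<open>N!\<close>, the convergence of \<open>harm N - ln N\<close>, and
the sum of the individual remainders; each is a bounded multiple of \<open>z\<close> or \<open>z\<^sup>2 - z\<close>.\<close>

lemma gamma_product_expansion: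
  assumes \<gamma>: "\<gamma> > 0"
  obtains C where "C \<ge> 0" and "\<And>N z. N \<ge> 1 \<Longrightarrow> norm z \<le> 1 \<Longrightarrow> norm z \<le> \<gamma> / 2 \<Longrightarrow>
    \<exists>E. norm E \<le> C * norm z \<and>
      (\<Prod>k\<in>{1..N}. gamma_quotient (of_real (\<gamma> * real k)) z) = exp (log_gamma_sum \<gamma> N z + E)"
proof -
  have "Bseq (\<lambda>n. harm n - ln (real n) :: real)"
    using euler_mascheroni_LIMSEQ by (intro convergent_imp_Bseq) (auto simp: convergent_def)
  then obtain H where H: "H > 0" "\<And>n. norm (harm n - ln (real n) :: real) \<le> H" by (rule BseqE) blast
  define K where "K = 4 * (1 + 1 / \<gamma>) / \<gamma>\<^sup>2"
  have K: "K \<ge> 0" using \<gamma> by (simp add: K_def)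
  define C where "C = 5 + H / \<gamma> + K * 2"
  show thesis
  proof (rule that[of C])
    show "C \<ge> 0" using H \<gamma> K by (simp add: C_def)
    fix N :: nat and z :: complex
    assume N: "N \<ge> 1" and z: "norm z \<le> 1" "norm z \<le> \<gamma> / 2"
    have "\<exists>D. \<forall>k\<in>{1..N}. gamma_quotient (of_real (\<gamma> * real k)) z = exp (log_gamma_main z (\<gamma> * real k) + D k)
        \<and> norm (D k) \<le> K * norm z * (1 / (real k)\<^sup>2)"
    proof (rule bchoice, intro ballI)
      fix k assume k: "k \<in> {1..N}"
      have "\<gamma> * 1 \<le> \<gamma> * real k" using k \<gamma> by (intro mult_left_mono) auto
      then obtain D where "gamma_quotient (of_real (\<gamma> * real k)) z = exp (log_gamma_main z (\<gamma> * real k) + D)"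
        "norm D \<le> 4 * (1 + 1 / \<gamma>) * norm z / (\<gamma> * real k)\<^sup>2"
        using gamma_quotient_expansion[of \<gamma> "\<gamma> * real k" z] \<gamma> z by auto
      then show "\<exists>D. gamma_quotient (of_real (\<gamma> * real k)) z = exp (log_gamma_main z (\<gamma> * real k) + D)
        \<and> norm D \<le> K * norm z * (1 / (real k)\<^sup>2)"
        by (intro exI[of _ D]) (simp add: K_def power_mult_distrib mult_ac)
    qed
    then obtain D where D: "\<And>k. k \<in> {1..N} \<Longrightarrow> gamma_quotient (of_real (\<gamma> * real k)) z = exp (log_gamma_main z (\<gamma> * real k) + D k)"
        "\<And>k. k \<in> {1..N} \<Longrightarrow> norm (D k) \<le> K * norm z * (1 / (real k)\<^sup>2)" by blast
    define e1 where "e1 = ln (fact N) - (real N * ln (real N) - real N + ln (real N) / 2)"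
    define e2 where "e2 = harm N - ln (real N)"
    define E where "E = z * of_real e1 + (z\<^sup>2 - z) * of_real (e2 / (2 * \<gamma>)) + (\<Sum>k\<in>{1..N}. D k)"
    have main: "(\<Sum>k\<in>{1..N}. log_gamma_main z (\<gamma> * real k))
       = z * of_real (real N * ln \<gamma> + ln (fact N)) + (z\<^sup>2 - z) * of_real (harm N / (2 * \<gamma>))"
    proof -
      have "(\<Sum>k\<in>{1..N}. ln (\<gamma> * real k)) = (\<Sum>k\<in>{1..N}. ln \<gamma> + ln (real k))"
        using \<gamma> by (intro sum.cong) (auto simp: ln_mult)
      also have "\<dots> = real N * ln \<gamma> + ln (fact N)"
      proof -
        have "(\<Sum>k\<in>{1..N}. ln (real k)) = ln (fact N)"
          by (induction N) (simp_all add: ln_mult)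
        then show ?thesis by (simp add: sum.distrib)
      qed
      finally have 1: "(\<Sum>k\<in>{1..N}. ln (\<gamma> * real k)) = real N * ln \<gamma> + ln (fact N)" .
      have 2: "(\<Sum>k\<in>{1..N}. 1 / (2 * (\<gamma> * real k))) = harm N / (2 * \<gamma>)"
        by (simp add: harm_def sum_divide_distrib field_simps)
      have "(\<Sum>k\<in>{1..N}. log_gamma_main z (\<gamma> * real k))
        = (\<Sum>k\<in>{1..N}. z * of_real (ln (\<gamma> * real k)) + (z\<^sup>2 - z) * of_real (1 / (2 * (\<gamma> * real k))))"
        by (intro sum.cong refl) (simp add: log_gamma_main_def)
      also have "\<dots> = z * of_real (\<Sum>k\<in>{1..N}. ln (\<gamma> * real k)) + (z\<^sup>2 - z) * of_real (\<Sum>k\<in>{1..N}. 1 / (2 * (\<gamma> * real k)))"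
        by (simp only: sum.distrib sum_distrib_left of_real_sum)
      finally show ?thesis unfolding 1 2 .
    qed
    have "(\<Prod>k\<in>{1..N}. gamma_quotient (of_real (\<gamma> * real k)) z) = (\<Prod>k\<in>{1..N}. exp (log_gamma_main z (\<gamma> * real k) + D k))"
      by (intro prod.cong refl D)
    also have "\<dots> = exp ((\<Sum>k\<in>{1..N}. log_gamma_main z (\<gamma> * real k)) + (\<Sum>k\<in>{1..N}. D k))"
      unfolding sum.distrib[symmetric] by (rule exp_sum[symmetric]) simp
    also have "(\<Sum>k\<in>{1..N}. log_gamma_main z (\<gamma> * real k)) + (\<Sum>k\<in>{1..N}. D k) = log_gamma_sum \<gamma> N z + E"
    proof -
      have f: "ln (fact N) = e1 + (real N * ln (real N) - real N + ln (real N) / 2)" by (simp add: e1_def)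
      have h: "harm N = e2 + ln (real N)" by (simp add: e2_def)
      have l: "ln (\<gamma> * real N) = ln \<gamma> + ln (real N)" using N \<gamma> by (simp add: ln_mult)
      show ?thesis unfolding main E_def log_gamma_sum_def f h l
        by (simp add: algebra_simps add_divide_distrib)
    qed
    finally have eq: "(\<Prod>k\<in>{1..N}. gamma_quotient (of_real (\<gamma> * real k)) z) = exp (log_gamma_sum \<gamma> N z + E)" .
    have n1: "norm (z * of_real e1) \<le> 5 * norm z"
      using mult_left_mono[OF ln_fact_bound[OF N, folded e1_def], of "norm z"] by (simp add: norm_mult mult.commute)
    have n2: "norm ((z\<^sup>2 - z) * of_real (e2 / (2 * \<gamma>))) \<le> H / \<gamma> * norm z"
    proof -
      have "norm ((z\<^sup>2 - z) * of_real (e2 / (2 * \<gamma>))) \<le> (2 * norm z) * (H / (2 * \<gamma>))"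
        unfolding norm_mult norm_of_real using \<gamma> H norm_square_diff_le[OF z(1)]
        by (intro mult_mono) (auto simp: e2_def abs_divide intro!: divide_right_mono)
      then show ?thesis using \<gamma> by (simp add: field_simps)
    qed
    have n3: "norm (\<Sum>k\<in>{1..N}. D k) \<le> K * 2 * norm z"
    proof -
      have "norm (\<Sum>k\<in>{1..N}. D k) \<le> (\<Sum>k\<in>{1..N}. K * norm z * (1 / (real k)\<^sup>2))"
        by (intro order_trans[OF norm_sum] sum_mono D)
      also have "\<dots> = K * norm z * (\<Sum>k\<in>{1..N}. 1 / (real k)\<^sup>2)" by (simp add: sum_distrib_left)
      also have "\<dots> \<le> K * norm z * 2" using K by (intro mult_left_mono sum_inverse_squares_le) auto
      finally show ?thesis by (simp add: mult_ac)
    qed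
    have "norm E \<le> 5 * norm z + H / \<gamma> * norm z + K * 2 * norm z"
      unfolding E_def by (intro order_trans[OF norm_triangle_ineq] add_mono n1 n2 n3)
    also have "\<dots> = C * norm z" by (simp add: C_def algebra_simps)
    finally show "\<exists>E. norm E \<le> C * norm z \<and>
      (\<Prod>k\<in>{1..N}. gamma_quotient (of_real (\<gamma> * real k)) z) = exp (log_gamma_sum \<gamma> N z + E)"
      using eq by blast
  qed
qed

text \<open>The estimate that the moment generating function has to satisfy, stated for its explicit formula. The disc
keeps all Gamma quotients away from their zeros and poles.\<close>

definition cumulant_bound :: "ensemble \<Rightarrow> real \<Rightarrow> real \<Rightarrow> real \<Rightarrow> real \<Rightarrow> nat \<Rightarrow> bool" where
  "cumulant_bound i \<gamma> \<tau>\<^sub>1 \<tau>\<^sub>2 C n \<longleftrightarrow> (\<forall>z :: complex. norm z \<le> 1 \<longrightarrow> norm z \<le> \<gamma> / 2 \<longrightarrow>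
     (\<exists>h. norm h \<le> C * norm z \<and>
       det_mellin i \<gamma> \<tau>\<^sub>1 \<tau>\<^sub>2 n z * exp (- z * of_real (centering i (2 * \<gamma>) \<tau>\<^sub>1 \<tau>\<^sub>2 n))
         = exp (of_real (ln (real n) / (2 * \<gamma>)) * z\<^sup>2 + h)))"

lemma laguerre_cumulant_bound:
  assumes \<gamma>: "\<gamma> > 0"
  shows "\<exists>C. \<forall>\<^sub>F n in sequentially. cumulant_bound Laguerre \<gamma> \<tau>\<^sub>1 \<tau>\<^sub>2 C n"
proof -
  obtain C where C: "C \<ge> 0" "\<And>N z. N \<ge> 1 \<Longrightarrow> norm z \<le> 1 \<Longrightarrow> norm z \<le> \<gamma> / 2 \<Longrightarrow>
    \<exists>E. norm E \<le> C * norm z \<and>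
      (\<Prod>k\<in>{1..N}. gamma_quotient (of_real (\<gamma> * real k)) z) = exp (log_gamma_sum \<gamma> N z + E)"
    by (rule gamma_product_expansion[OF \<gamma>]) blast
  have "cumulant_bound Laguerre \<gamma> \<tau>\<^sub>1 \<tau>\<^sub>2 C n" if n: "n \<ge> 1" for n
    unfolding cumulant_bound_def
  proof (intro allI impI)
    fix z :: complex assume z: "norm z \<le> 1" "norm z \<le> \<gamma> / 2"
    obtain E where E: "norm E \<le> C * norm z"
      "(\<Prod>k\<in>{1..n}. gamma_quotient (of_real (\<gamma> * real k)) z) = exp (log_gamma_sum \<gamma> n z + E)"
      using C(2)[OF n z] by blast
    have l: "ln (2 * \<gamma> * real n) = ln 2 + ln (\<gamma> * real n)"
      using \<gamma> n by (simp add: ln_mult)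
    have "det_mellin Laguerre \<gamma> \<tau>\<^sub>1 \<tau>\<^sub>2 n z * exp (- z * of_real (centering Laguerre (2 * \<gamma>) \<tau>\<^sub>1 \<tau>\<^sub>2 n))
      = exp (of_nat n * (z * of_real (ln 2)) + (log_gamma_sum \<gamma> n z + E) + - z * of_real (centering Laguerre (2 * \<gamma>) \<tau>\<^sub>1 \<tau>\<^sub>2 n))"
    proof -
      have "(\<Prod>k\<in>{1..n}. exp (z * of_real (ln 2))) = exp (of_nat n * (z * of_real (ln 2)))"
        by (simp add: exp_of_nat_mult)
      then show ?thesis unfolding det_mellin.simps prod.distrib E(2) by (simp only: exp_add)
    qed
    also have "of_nat n * (z * of_real (ln 2)) + (log_gamma_sum \<gamma> n z + E) + - z * of_real (centering Laguerre (2 * \<gamma>) \<tau>\<^sub>1 \<tau>\<^sub>2 n)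
      = of_real (ln (real n) / (2 * \<gamma>)) * z\<^sup>2 + E"
      unfolding centering.simps l log_gamma_sum_def by (simp add: algebra_simps diff_divide_distrib)
    finally show "\<exists>h. norm h \<le> C * norm z \<and>
       det_mellin Laguerre \<gamma> \<tau>\<^sub>1 \<tau>\<^sub>2 n z * exp (- z * of_real (centering Laguerre (2 * \<gamma>) \<tau>\<^sub>1 \<tau>\<^sub>2 n))
         = exp (of_real (ln (real n) / (2 * \<gamma>)) * z\<^sup>2 + h)" using E(1) by blast
  qed
  then show ?thesis using eventually_mono[OF eventually_ge_at_top[of 1]] by metis
qed

text \<open>The denominator, a power with exponent \<open>n\<close> of a single Gamma quotient at \<open>\<gamma> * n\<close>, contributes the linear term
\<open>- n * z * ln (\<gamma> * n)\<close> and the bounded term \<open>- (z\<^sup>2 - z) / (2 * \<gamma>)\<close>, the linear part of which is the summand \<open>1 / \<beta>\<close> of the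
centering.\<close>

lemma gram_cumulant_bound:
  assumes \<gamma>: "\<gamma> > 0"
  shows "\<exists>C. \<forall>\<^sub>F n in sequentially. cumulant_bound Gram \<gamma> \<tau>\<^sub>1 \<tau>\<^sub>2 C n"
proof -
  obtain C where C: "C \<ge> 0" "\<And>N z. N \<ge> 1 \<Longrightarrow> norm z \<le> 1 \<Longrightarrow> norm z \<le> \<gamma> / 2 \<Longrightarrow>
    \<exists>E. norm E \<le> C * norm z \<and>
      (\<Prod>k\<in>{1..N}. gamma_quotient (of_real (\<gamma> * real k)) z) = exp (log_gamma_sum \<gamma> N z + E)"
    by (rule gamma_product_expansion[OF \<gamma>]) blast
  define K where "K = 4 * (1 + 1 / \<gamma>) / \<gamma>\<^sup>2"
  have "cumulant_bound Gram \<gamma> \<tau>\<^sub>1 \<tau>\<^sub>2 (C + 1 / (2 * \<gamma>) + K) n" if n: "n \<ge> 1" for n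
    unfolding cumulant_bound_def
  proof (intro allI impI)
    fix z :: complex assume z: "norm z \<le> 1" "norm z \<le> \<gamma> / 2"
    obtain E where E: "norm E \<le> C * norm z"
      "(\<Prod>k\<in>{1..n}. gamma_quotient (of_real (\<gamma> * real k)) z) = exp (log_gamma_sum \<gamma> n z + E)"
      using C(2)[OF n z] by blast
    have "\<gamma> * 1 \<le> \<gamma> * real n" using n \<gamma> by (intro mult_left_mono) auto
    then obtain D where D: "gamma_quotient (of_real (\<gamma> * real n)) z = exp (log_gamma_main z (\<gamma> * real n) + D)"
        "norm D \<le> 4 * (1 + 1 / \<gamma>) * norm z / (\<gamma> * real n)\<^sup>2"
      using gamma_quotient_expansion[of \<gamma> "\<gamma> * real n" z] \<gamma> z by auto
    define h where "h = E - z\<^sup>2 * of_real (1 / (2 * \<gamma>)) - of_nat n * D"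
    have nD: "norm (of_nat n * D) \<le> K * norm z"
    proof -
      have "norm (of_nat n * D) \<le> real n * (4 * (1 + 1 / \<gamma>) * norm z / (\<gamma> * real n)\<^sup>2)"
        unfolding norm_mult norm_of_nat using D(2) by (intro mult_left_mono) auto
      also have "\<dots> = K * norm z * (1 / real n)" using n by (simp add: K_def power2_eq_square)
      also have "\<dots> \<le> K * norm z * 1" using n \<gamma> by (intro mult_left_mono) (auto simp: K_def)
      finally show ?thesis by simp
    qed
    have nz: "norm (z\<^sup>2 * of_real (1 / (2 * \<gamma>))) \<le> 1 / (2 * \<gamma>) * norm z"
    proof -
      have "norm (z\<^sup>2) \<le> norm z * 1"
        unfolding power2_eq_square norm_mult using z by (intro mult_left_mono) auto
      then have "norm (z\<^sup>2) * (1 / (2 * \<gamma>)) \<le> norm z * (1 / (2 * \<gamma>))"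
        using \<gamma> by (intro mult_right_mono) auto
      then show ?thesis using \<gamma> by (simp add: norm_mult norm_divide mult.commute)
    qed
    have h: "norm h \<le> (C + 1 / (2 * \<gamma>) + K) * norm z"
    proof -
      have "norm h \<le> C * norm z + 1 / (2 * \<gamma>) * norm z + K * norm z"
        unfolding h_def by (intro order_trans[OF norm_triangle_ineq4] add_mono E(1) nz nD)
      then show ?thesis by (simp add: algebra_simps)
    qed
    have "det_mellin Gram \<gamma> \<tau>\<^sub>1 \<tau>\<^sub>2 n z * exp (- z * of_real (centering Gram (2 * \<gamma>) \<tau>\<^sub>1 \<tau>\<^sub>2 n))
      = exp (log_gamma_sum \<gamma> n z + E - of_nat n * (log_gamma_main z (\<gamma> * real n) + D) + - z * of_real (centering Gram (2 * \<gamma>) \<tau>\<^sub>1 \<tau>\<^sub>2 n))"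
    proof -
      have "(\<Prod>k\<in>{1..n}. exp (log_gamma_main z (\<gamma> * real n) + D)) = exp (of_nat n * (log_gamma_main z (\<gamma> * real n) + D))"
        by (simp add: exp_of_nat_mult)
      then show ?thesis unfolding det_mellin.simps prod_dividef E(2) D(1) by (simp only: exp_add exp_diff)
    qed
    also have "log_gamma_sum \<gamma> n z + E - of_nat n * (log_gamma_main z (\<gamma> * real n) + D) + - z * of_real (centering Gram (2 * \<gamma>) \<tau>\<^sub>1 \<tau>\<^sub>2 n)
      = of_real (ln (real n) / (2 * \<gamma>)) * z\<^sup>2 + h"
      unfolding centering.simps log_gamma_sum_def log_gamma_main_def h_def using \<gamma> n
      by (simp add: field_simps)
    finally show "\<exists>h. norm h \<le> (C + 1 / (2 * \<gamma>) + K) * norm z \<and>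
       det_mellin Gram \<gamma> \<tau>\<^sub>1 \<tau>\<^sub>2 n z * exp (- z * of_real (centering Gram (2 * \<gamma>) \<tau>\<^sub>1 \<tau>\<^sub>2 n))
         = exp (of_real (ln (real n) / (2 * \<gamma>)) * z\<^sup>2 + h)" using h by blast
  qed
  then show ?thesis using eventually_mono[OF eventually_ge_at_top[of 1]] by metis
qed

text \<open>With \<open>P N\<close> the product over the first \<open>N\<close> multiples of \<open>\<gamma>\<close>, the Mellin transform is
\<open>P n\<^sub>1 * P n\<^sub>2 / P (n\<^sub>1 + n\<^sub>2)\<close>, symmetric in both sizes. The logarithms combine to
\<open>ln n\<^sub>1 + ln n\<^sub>2 - ln (n\<^sub>1 + n\<^sub>2) = ln n + O 1\<close>, and the terms \<open>N * ln N\<close> give the function \<open>eps\<close>.\<close>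

lemma jacobi_cumulant_bound:
  assumes \<gamma>: "\<gamma> > 0" and \<tau>: "\<tau>\<^sub>1 > 0" "\<tau>\<^sub>2 > 0"
  shows "\<exists>C. \<forall>\<^sub>F n in sequentially. cumulant_bound Jacobi \<gamma> \<tau>\<^sub>1 \<tau>\<^sub>2 C n"
proof -
  obtain C where C: "C \<ge> 0" "\<And>N z. N \<ge> 1 \<Longrightarrow> norm z \<le> 1 \<Longrightarrow> norm z \<le> \<gamma> / 2 \<Longrightarrow>
    \<exists>E. norm E \<le> C * norm z \<and>
      (\<Prod>k\<in>{1..N}. gamma_quotient (of_real (\<gamma> * real k)) z) = exp (log_gamma_sum \<gamma> N z + E)"
    by (rule gamma_product_expansion[OF \<gamma>]) blast
  define a where "a n = nat \<lfloor>real n * \<tau>\<^sub>1\<rfloor>" for n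
  define b where "b n = nat \<lfloor>real n * \<tau>\<^sub>2\<rfloor>" for n
  define t where "t n = ln (real (a n)) + ln (real (b n)) - ln (real (a n + b n)) - ln (real n)" for n
  have ra: "real (a n) = of_int \<lfloor>real n * \<tau>\<^sub>1\<rfloor>" "real (b n) = of_int \<lfloor>real n * \<tau>\<^sub>2\<rfloor>" for n
    using \<tau> by (auto simp: a_def b_def)
  have la: "(\<lambda>n. real (a n) / real n) \<longlonglongrightarrow> \<tau>\<^sub>1" "(\<lambda>n. real (b n) / real n) \<longlonglongrightarrow> \<tau>\<^sub>2"
    unfolding ra by real_asymp+
  have ev: "\<forall>\<^sub>F n in sequentially. a n \<ge> 1 \<and> b n \<ge> 1 \<and> n \<ge> 1"
  proof -
    have "filterlim (\<lambda>n. real n * \<tau>\<^sub>1) at_top sequentially" "filterlim (\<lambda>n. real n * \<tau>\<^sub>2) at_top sequentially"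
      using \<tau> by real_asymp+
    then have "\<forall>\<^sub>F n in sequentially. real n * \<tau>\<^sub>1 \<ge> 1" "\<forall>\<^sub>F n in sequentially. real n * \<tau>\<^sub>2 \<ge> 1"
      by (auto simp: filterlim_at_top)
    then show ?thesis using eventually_ge_at_top[of 1]
      by eventually_elim (auto simp: a_def b_def le_nat_iff le_floor_iff)
  qed
  have "(\<lambda>n. ln (real (a n) / real n) + ln (real (b n) / real n) - ln (real (a n) / real n + real (b n) / real n))
     \<longlonglongrightarrow> ln \<tau>\<^sub>1 + ln \<tau>\<^sub>2 - ln (\<tau>\<^sub>1 + \<tau>\<^sub>2)"
    using \<tau> by (intro tendsto_intros la) auto
  then have "t \<longlonglongrightarrow> ln \<tau>\<^sub>1 + ln \<tau>\<^sub>2 - ln (\<tau>\<^sub>1 + \<tau>\<^sub>2)"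
  proof (rule Lim_transform_eventually)
    show "\<forall>\<^sub>F n in sequentially. ln (real (a n) / real n) + ln (real (b n) / real n)
       - ln (real (a n) / real n + real (b n) / real n) = t n"
      using ev
      by eventually_elim (auto simp: t_def ln_div simp flip: add_divide_distrib)
  qed
  then have "Bseq t" by (intro convergent_imp_Bseq) (auto simp: convergent_def)
  then obtain T where T: "T > 0" "\<And>n. \<bar>t n\<bar> \<le> T" by (rule BseqE) auto
  define k where "k = 1 / 2 - 1 / (2 * \<gamma>)"
  define l where "l = ln (\<tau>\<^sub>1 * \<tau>\<^sub>2 / (\<tau>\<^sub>1 + \<tau>\<^sub>2))"
  define C' where "C' = 3 * C + \<bar>k\<bar> * (T + \<bar>l\<bar>) + T / (2 * \<gamma>)"
  have "cumulant_bound Jacobi \<gamma> \<tau>\<^sub>1 \<tau>\<^sub>2 C' n" if ab: "a n \<ge> 1" "b n \<ge> 1" "n \<ge> 1" for n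
    unfolding cumulant_bound_def
  proof (intro allI impI)
    fix z :: complex assume z: "norm z \<le> 1" "norm z \<le> \<gamma> / 2"
    define P where "P N = (\<Prod>k\<in>{1..N}. gamma_quotient (complex_of_real (\<gamma> * real k)) z)" for N
    have P: "\<exists>E. norm E \<le> C * norm z \<and> P N = exp (log_gamma_sum \<gamma> N z + E)" if "N \<ge> 1" for N
      unfolding P_def by (rule C(2)[OF that z])
    obtain E1 where E1: "norm E1 \<le> C * norm z" "P (a n) = exp (log_gamma_sum \<gamma> (a n) z + E1)"
      using P[OF ab(1)] by blast
    obtain E2 where E2: "norm E2 \<le> C * norm z" "P (b n) = exp (log_gamma_sum \<gamma> (b n) z + E2)"
      using P[OF ab(2)] by blast
    obtain E3 where E3: "norm E3 \<le> C * norm z" "P (a n + b n) = exp (log_gamma_sum \<gamma> (a n + b n) z + E3)"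
      using P[of "a n + b n"] ab by auto
    have split: "P (M + m) = P M * (\<Prod>k\<in>{1..m}. gamma_quotient (complex_of_real (\<gamma> * (real M + real k))) z)" for M m
    proof (induction m)
      case (Suc m)
      have "P (Suc N) = P N * gamma_quotient (complex_of_real (\<gamma> * real (Suc N))) z" for N
        by (simp add: P_def)
      then have "P (M + Suc m) = P (M + m) * gamma_quotient (complex_of_real (\<gamma> * (real M + real (Suc m)))) z"
        by (simp add: add.assoc add.left_commute)
      then show ?case unfolding Suc.IH by simp
    qed simp
    have P0: "P N \<noteq> 0" if "N \<ge> 1" for N using P[OF that] by auto
    have mel: "det_mellin Jacobi \<gamma> \<tau>\<^sub>1 \<tau>\<^sub>2 n z = P (a n) * P (b n) / P (a n + b n)"
    proof -
      define m where "m = min (a n) (b n)"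
      define M where "M = max (a n) (b n)"
      have "M \<ge> 1" "M + m = a n + b n" "P m * P M = P (a n) * P (b n)"
        using ab by (auto simp: m_def M_def min_def max_def mult.commute)
      moreover have "det_mellin Jacobi \<gamma> \<tau>\<^sub>1 \<tau>\<^sub>2 n z
         = P m / (\<Prod>k\<in>{1..m}. gamma_quotient (complex_of_real (\<gamma> * (real M + real k))) z)"
        by (simp only: det_mellin.simps Let_def m_def M_def a_def b_def P_def prod_dividef)
      moreover have "P m / Q = P m * P M / (P M * Q)" for Q using P0[OF \<open>M \<ge> 1\<close>] by simp
      ultimately show ?thesis using split[of M m] by metis
    qed
    define h where "h = E1 + E2 - E3 + z * of_real (k * (t n - l)) + z\<^sup>2 * of_real (t n / (2 * \<gamma>))"
    have nz2: "norm (z\<^sup>2) \<le> norm z * 1"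
      unfolding power2_eq_square norm_mult using z by (intro mult_left_mono) auto
    have h: "norm h \<le> C' * norm z"
    proof -
      have 1: "norm (z * of_real (k * (t n - l))) \<le> (\<bar>k\<bar> * (T + \<bar>l\<bar>)) * norm z"
        unfolding norm_mult norm_of_real abs_mult using T(2)[of n] T(1)
        by (subst mult.commute) (intro mult_mono mult_left_mono order_trans[OF abs_triangle_ineq4]; auto)
      have 2: "norm (z\<^sup>2 * of_real (t n / (2 * \<gamma>))) \<le> T / (2 * \<gamma>) * norm z"
        unfolding norm_mult norm_of_real using T(2)[of n] T(1) \<gamma> nz2
        by (subst mult.commute) (intro mult_mono; auto simp: abs_divide intro!: divide_right_mono)
      have "norm h \<le> (C * norm z + C * norm z + C * norm z) + (\<bar>k\<bar> * (T + \<bar>l\<bar>)) * norm z + T / (2 * \<gamma>) * norm z"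
        unfolding h_def
        by (intro order_trans[OF norm_triangle_ineq] add_mono 1 2 order_trans[OF norm_triangle_ineq4] E1(1) E2(1) E3(1))
      then show ?thesis by (simp add: C'_def algebra_simps)
    qed
    have cen: "centering Jacobi (2 * \<gamma>) \<tau>\<^sub>1 \<tau>\<^sub>2 n = k * ln (real n) + k * l
       - real (a n) * (ln (real (a n + b n)) - ln (real (a n))) - real (b n) * (ln (real (a n + b n)) - ln (real (b n)))"
    proof -
      have "eps x y = x * (ln (x + y) - ln x)" if "x > 0" "y > 0" for x y
      proof -
        have "1 + y / x = (x + y) / x" using that by (simp add: field_simps)
        then show ?thesis using that by (simp add: eps_def ln_div)
      qed
      then show ?thesis unfolding centering.simps ra[symmetric] using ab
        by (simp add: k_def l_def add.commute)
    qed
    have "det_mellin Jacobi \<gamma> \<tau>\<^sub>1 \<tau>\<^sub>2 n z * exp (- z * of_real (centering Jacobi (2 * \<gamma>) \<tau>\<^sub>1 \<tau>\<^sub>2 n))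
      = exp ((log_gamma_sum \<gamma> (a n) z + E1) + (log_gamma_sum \<gamma> (b n) z + E2) - (log_gamma_sum \<gamma> (a n + b n) z + E3)
          + - z * of_real (centering Jacobi (2 * \<gamma>) \<tau>\<^sub>1 \<tau>\<^sub>2 n))"
      unfolding mel E1(2) E2(2) E3(2) by (simp only: exp_add exp_diff)
    also have "(log_gamma_sum \<gamma> (a n) z + E1) + (log_gamma_sum \<gamma> (b n) z + E2) - (log_gamma_sum \<gamma> (a n + b n) z + E3)
          + - z * of_real (centering Jacobi (2 * \<gamma>) \<tau>\<^sub>1 \<tau>\<^sub>2 n)
      = of_real (ln (real n) / (2 * \<gamma>)) * z\<^sup>2 + h"
    proof -
      define A B S L where "A = ln (real (a n))" "B = ln (real (b n))" "S = ln (real (a n + b n))" "L = ln (real n)"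
      have l: "ln (\<gamma> * real (a n)) = ln \<gamma> + A" "ln (\<gamma> * real (b n)) = ln \<gamma> + B"
         "ln (\<gamma> * real (a n + b n)) = ln \<gamma> + S"
        using \<gamma> ab by (simp_all add: A_B_S_L_def ln_mult)
      show ?thesis
        unfolding h_def log_gamma_sum_def cen t_def k_def l A_B_S_L_def[symmetric]
        by (simp add: algebra_simps diff_divide_distrib add_divide_distrib)
    qed
    finally show "\<exists>h. norm h \<le> C' * norm z \<and>
       det_mellin Jacobi \<gamma> \<tau>\<^sub>1 \<tau>\<^sub>2 n z * exp (- z * of_real (centering Jacobi (2 * \<gamma>) \<tau>\<^sub>1 \<tau>\<^sub>2 n))
         = exp (of_real (ln (real n) / (2 * \<gamma>)) * z\<^sup>2 + h)" using h by blast
  qed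
  then show ?thesis using eventually_mono[OF ev] by metis
qed

section \<open>From real moments to moderate deviations\<close>

text \<open>Exponential moments on a real interval make the moment generating function a convergent power series on the
disc, and so holomorphic; it coincides with \<open>F\<close> on a set with a limit point.\<close>

lemma mgf_analytic_extension:
  fixes F :: "complex \<Rightarrow> complex" and f :: "real \<Rightarrow> real"
  assumes N: "real_distribution N"
    and hol: "F holomorphic_on ball 0 \<delta>"
    and real: "\<And>s. \<bar>s\<bar> < \<delta> \<Longrightarrow> (\<integral>\<^sup>+x. ennreal (exp (s * x)) \<partial>N) = ennreal (f s)"
      "\<And>s. \<bar>s\<bar> < \<delta> \<Longrightarrow> F (of_real s) = of_real (f s)" "\<And>s. \<bar>s\<bar> < \<delta> \<Longrightarrow> 0 \<le> f s"
    and z: "norm z < \<delta>"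
  shows "integrable N (\<lambda>x. exp (z * of_real x))" "(\<integral>x. exp (z * of_real x) \<partial>N) = F z"
proof -
  interpret real_distribution N by fact
  have int: "integrable N (\<lambda>x. exp (s * x))" if "\<bar>s\<bar> < \<delta>" for s
    by (rule integrableI_nonneg) (auto simp: real(1)[OF that])
  have val: "(\<integral>x. exp (s * x) \<partial>N) = f s" if "\<bar>s\<bar> < \<delta>" for s
  proof -
    have "ennreal (\<integral>x. exp (s * x) \<partial>N) = ennreal (f s)"
      using nn_integral_eq_integral[OF int[OF that]] real(1)[OF that] by simp
    moreover have "0 \<le> (\<integral>x. exp (s * x) \<partial>N)" by (intro integral_nonneg_AE) simp
    ultimately show ?thesis using real(3)[OF that] by (subst (asm) ennreal_inj) auto
  qed
  have int_abs: "integrable N (\<lambda>x. exp (t * \<bar>x\<bar>))" if t: "0 \<le> t" "t < \<delta>" for t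
  proof (rule Bochner_Integration.integrable_bound)
    show "integrable N (\<lambda>x. exp (t * x) + exp (- t * x))"
      using t by (intro Bochner_Integration.integrable_add int) auto
    show "AE x in N. norm (exp (t * \<bar>x\<bar>)) \<le> norm (exp (t * x) + exp (- t * x))"
    proof (intro AE_I2)
      fix x
      have "exp (t * \<bar>x\<bar>) \<le> exp (t * x) + exp (- t * x)"
        by (cases "x \<ge> 0") (simp_all add: abs_if)
      then show "norm (exp (t * \<bar>x\<bar>)) \<le> norm (exp (t * x) + exp (- t * x))"
        by (simp add: abs_of_nonneg[OF add_nonneg_nonneg[OF exp_ge_zero exp_ge_zero]])
    qed
    show "(\<lambda>x. exp (t * \<bar>x\<bar>)) \<in> borel_measurable N" by measurable
  qed
  have int_z: "integrable N (\<lambda>x. exp (w * of_real x))" if "norm w < \<delta>" for w :: complex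
  proof (rule Bochner_Integration.integrable_bound[OF int_abs[of "norm w"]])
    show "AE x in N. norm (exp (w * of_real x)) \<le> norm (exp (norm w * \<bar>x\<bar>))"
    proof (intro AE_I2)
      fix x
      have "Re w * x \<le> \<bar>Re w\<bar> * \<bar>x\<bar>" using abs_ge_self[of "Re w * x"] by (simp add: abs_mult)
      also have "\<dots> \<le> norm w * \<bar>x\<bar>" by (intro mult_right_mono abs_Re_le_cmod) simp
      finally show "norm (exp (w * of_real x)) \<le> norm (exp (norm w * \<bar>x\<bar>))" by simp
    qed
    show "(\<lambda>x. exp (w * complex_of_real x)) \<in> borel_measurable N" by measurable
    show "norm w < \<delta>" by fact
  qed simp
  define a where "a k = (\<integral>x. (of_real x :: complex) ^ k / fact k \<partial>N)" for k
  have series: "(\<lambda>k. a k * w ^ k) sums (\<integral>x. exp (w * of_real x) \<partial>N)" if w: "norm w < \<delta>" for w :: complex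
  proof -
    define g where "g k x = (w * complex_of_real x) ^ k / fact k" for k x
    have ng: "norm (g k x) = (norm w * \<bar>x\<bar>) ^ k / fact k" for k x
      by (simp add: g_def norm_divide norm_power norm_mult)
    have exp_sums: "(\<lambda>k. (norm w * \<bar>x\<bar>) ^ k / fact k) sums exp (norm w * \<bar>x\<bar>)" for x
    proof -
      have "(\<lambda>k. (norm w * \<bar>x\<bar>) ^ k / fact k) = (\<lambda>k. (norm w * \<bar>x\<bar>) ^ k /\<^sub>R fact k)"
        by (simp add: field_simps)
      then show ?thesis using exp_converges[of "norm w * \<bar>x\<bar>"] by (simp only:)
    qed
    have partial: "(\<Sum>k<n. norm (g k x)) \<le> exp (norm w * \<bar>x\<bar>)" for n x
    proof -
      have "(\<Sum>k<n. norm (g k x)) \<le> (\<Sum>k. (norm w * \<bar>x\<bar>) ^ k / fact k)"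
        unfolding ng using exp_sums[of x] by (intro sum_le_suminf) (auto simp: sums_iff)
      then show ?thesis using exp_sums[of x] by (simp add: sums_iff)
    qed
    have intg: "integrable N (g k)" for k
    proof (rule Bochner_Integration.integrable_bound[OF int_abs[of "norm w"]])
      show "AE x in N. norm (g k x) \<le> norm (exp (norm w * \<bar>x\<bar>))"
      proof (intro AE_I2)
        fix x
        have "norm (g k x) \<le> (\<Sum>j<Suc k. norm (g j x))" by (simp add: sum_nonneg)
        also have "\<dots> \<le> exp (norm w * \<bar>x\<bar>)" by (rule partial)
        finally show "norm (g k x) \<le> norm (exp (norm w * \<bar>x\<bar>))" by simp
      qed
      show "g k \<in> borel_measurable N" unfolding g_def by measurable
      show "norm w < \<delta>" by fact
    qed simp
    have "summable (\<lambda>k. \<integral>x. norm (g k x) \<partial>N)"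
    proof (rule bounded_imp_summable)
      fix n
      have "(\<Sum>k\<le>n. \<integral>x. norm (g k x) \<partial>N) = (\<integral>x. (\<Sum>k<Suc n. norm (g k x)) \<partial>N)"
        using intg by (subst Bochner_Integration.integral_sum) (auto simp: lessThan_Suc_atMost)
      also have "\<dots> \<le> (\<integral>x. exp (norm w * \<bar>x\<bar>) \<partial>N)"
        using intg w by (intro integral_mono partial int_abs integrable_sum integrable_norm) auto
      finally show "(\<Sum>k\<le>n. \<integral>x. norm (g k x) \<partial>N) \<le> (\<integral>x. exp (norm w * \<bar>x\<bar>) \<partial>N)" .
    qed (auto intro: integral_nonneg_AE)
    moreover have "AE x in N. summable (\<lambda>k. norm (g k x))"
      unfolding ng using exp_sums by (auto simp: sums_iff)
    ultimately have "(\<lambda>k. \<integral>x. g k x \<partial>N) sums (\<integral>x. (\<Sum>k. g k x) \<partial>N)"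
      using intg by (intro sums_integral)
    also have "(\<lambda>x. \<Sum>k. g k x) = (\<lambda>x. exp (w * of_real x))"
    proof
      fix x
      have "(\<lambda>k. g k x) = (\<lambda>k. (w * complex_of_real x) ^ k /\<^sub>R fact k)"
        by (simp add: g_def scaleR_conv_of_real field_simps)
      then show "(\<Sum>k. g k x) = exp (w * of_real x)"
        using exp_converges[of "w * complex_of_real x"] by (simp only: sums_iff)
    qed
    also have "(\<lambda>k. \<integral>x. g k x \<partial>N) = (\<lambda>k. a k * w ^ k)"
    proof
      fix k
      have "(\<integral>x. g k x \<partial>N) = (\<integral>x. w ^ k * ((of_real x :: complex) ^ k / fact k) \<partial>N)"
        by (simp add: g_def power_mult_distrib)
      then show "(\<integral>x. g k x \<partial>N) = a k * w ^ k" by (simp add: a_def mult.commute)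
    qed
    finally show ?thesis .
  qed
  define G where "G w = (\<integral>x. exp (w * of_real x) \<partial>N)" for w :: complex
  have "G holomorphic_on ball 0 \<delta>"
    unfolding G_def using series by (intro power_series_holomorphic[of 0 \<delta> a]) simp
  then have hol': "(\<lambda>w. G w - F w) holomorphic_on ball 0 \<delta>" using hol by (intro holomorphic_intros)
  have \<delta>: "\<delta> > 0" using z norm_ge_zero[of z] by linarith
  have "G z - F z = 0"
  proof (rule analytic_continuation[OF hol' open_ball connected_ball, where U = "of_real ` {-\<delta><..<\<delta>}" and \<xi> = 0])
    show "complex_of_real ` {-\<delta><..<\<delta>} \<subseteq> ball 0 \<delta>" by auto
    show "(0::complex) islimpt complex_of_real ` {-\<delta><..<\<delta>}"
      unfolding islimpt_approachable
    proof (intro allI impI)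
      fix e :: real assume "e > 0"
      then show "\<exists>x'\<in>complex_of_real ` {-\<delta><..<\<delta>}. x' \<noteq> 0 \<and> dist x' 0 < e"
        using \<delta> by (intro bexI[of _ "of_real (min e \<delta> / 2)"] imageI) (auto simp: dist_norm)
    qed
    fix w assume "w \<in> complex_of_real ` {-\<delta><..<\<delta>}"
    then obtain s where s: "w = of_real s" "\<bar>s\<bar> < \<delta>" by auto
    have "G w = (\<integral>x. complex_of_real (exp (s * x)) \<partial>N)"
      unfolding G_def s(1) by (intro Bochner_Integration.integral_cong) (simp_all flip: exp_of_real)
    also have "\<dots> = of_real (f s)" using val[OF s(2)] by (simp add: integral_complex_of_real)
    finally show "G w - F w = 0" using real(2)[OF s(2)] s(1) by simp
  qed (use z \<delta> in auto)
  then show "(\<integral>x. exp (z * of_real x) \<partial>N) = F z" by (simp add: G_def)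
  show "integrable N (\<lambda>x. exp (z * of_real x))" by (rule int_z[OF z])
qed

lemma gamma_quotient_real:
  fixes w s :: real
  assumes "\<gamma> > 0" "w \<ge> \<gamma>" "\<bar>s\<bar> < \<gamma>"
  shows gamma_quotient_pos: "gamma_quotient w s > 0"
    and gamma_quotient_of_real: "gamma_quotient (complex_of_real w) (of_real s) = of_real (gamma_quotient w s)"
proof -
  have "w > 0" "w + s > 0" using assms by linarith+
  then show "gamma_quotient w s > 0" by (simp add: gamma_quotient_def Gamma_real_pos)
  show "gamma_quotient (complex_of_real w) (of_real s) = of_real (gamma_quotient w s)"
    unfolding gamma_quotient_def of_real_add[symmetric] Gamma_complex_of_real of_real_divide ..
qed

lemma gamma_quotient_holomorphic:
  assumes "\<gamma> > 0" "w \<ge> \<gamma>"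
  shows "gamma_quotient (complex_of_real w) holomorphic_on ball 0 \<gamma>"
    and "\<And>z. z \<in> ball 0 \<gamma> \<Longrightarrow> gamma_quotient (complex_of_real w) z \<noteq> 0"
proof -
  have not: "complex_of_real w + z \<notin> \<int>\<^sub>\<le>\<^sub>0" if "z \<in> ball 0 \<gamma>" for z
  proof -
    have "norm z < \<gamma>" using that by simp
    then have "Re z > - w" using abs_Re_le_cmod[of z] assms by linarith
    then show ?thesis by (auto elim!: nonpos_Ints_cases simp: complex_eq_iff)
  qed
  have G0: "Gamma (complex_of_real w) \<noteq> 0" using not[of 0] assms by (simp add: Gamma_eq_zero_iff)
  show "gamma_quotient (complex_of_real w) holomorphic_on ball 0 \<gamma>"
    unfolding gamma_quotient_def using not G0 by (intro holomorphic_intros) auto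
  show "\<And>z. z \<in> ball 0 \<gamma> \<Longrightarrow> gamma_quotient (complex_of_real w) z \<noteq> 0"
    using not G0 by (simp add: gamma_quotient_def Gamma_eq_zero_iff)
qed

lemma multiple_ge: "\<gamma> \<le> \<gamma> * real k" if "\<gamma> > 0" "k \<ge> 1" for k
  using mult_left_mono[of 1 "real k" \<gamma>] that by simp

lemma det_mellin_real:
  fixes s :: real
  assumes "\<gamma> > 0" "\<bar>s\<bar> < \<gamma>"
  shows det_mellin_pos: "det_mellin i \<gamma> \<tau>\<^sub>1 \<tau>\<^sub>2 n s > 0"
    and det_mellin_of_real: "det_mellin i \<gamma> \<tau>\<^sub>1 \<tau>\<^sub>2 n (complex_of_real s) = of_real (det_mellin i \<gamma> \<tau>\<^sub>1 \<tau>\<^sub>2 n s)"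
proof -
  have ge: "\<gamma> \<le> \<gamma> * real k" "\<gamma> \<le> \<gamma> * (real M + real k)" if "k \<ge> 1" for k M
    using multiple_ge[OF assms(1), of k] multiple_ge[OF assms(1), of "M + k"] that by auto
  define q where "q w = gamma_quotient w s" for w :: real
  have pos: "q w > 0" if "w \<ge> \<gamma>" for w
    unfolding q_def by (rule gamma_quotient_pos[OF assms(1) that assms(2)])
  have cpx: "gamma_quotient (complex_of_real w) (of_real s) = of_real (q w)" if "w \<ge> \<gamma>" for w
    unfolding q_def by (rule gamma_quotient_of_real[OF assms(1) that assms(2)])
  have ex: "exp (complex_of_real s * of_real (ln 2)) = of_real (exp (s * ln 2))"
    by (simp flip: exp_of_real)
  have "det_mellin i \<gamma> \<tau>\<^sub>1 \<tau>\<^sub>2 n s > 0 \<and>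
    det_mellin i \<gamma> \<tau>\<^sub>1 \<tau>\<^sub>2 n (complex_of_real s) = of_real (det_mellin i \<gamma> \<tau>\<^sub>1 \<tau>\<^sub>2 n s)"
  proof (cases i)
    case Laguerre
    show ?thesis
      unfolding Laguerre det_mellin.simps of_real_prod of_real_eq_id id_apply q_def[symmetric]
      by (intro conjI prod_pos prod.cong refl ballI mult_pos_pos)
         (simp_all add: pos cpx ex ge del: of_real_mult of_real_add, simp)
  next
    case Gram
    show ?thesis
      unfolding Gram det_mellin.simps of_real_prod of_real_eq_id id_apply q_def[symmetric]
      by (intro conjI prod_pos prod.cong refl ballI divide_pos_pos)
         (simp_all add: pos cpx ge del: of_real_mult of_real_add)
  next
    case Jacobi
    show ?thesis
      unfolding Jacobi det_mellin.simps Let_def of_real_prod of_real_eq_id id_apply q_def[symmetric]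
      by (intro conjI prod_pos prod.cong refl ballI divide_pos_pos)
         (simp_all add: pos cpx ge del: of_real_mult of_real_add)
  qed
  then show "det_mellin i \<gamma> \<tau>\<^sub>1 \<tau>\<^sub>2 n s > 0"
    "det_mellin i \<gamma> \<tau>\<^sub>1 \<tau>\<^sub>2 n (complex_of_real s) = of_real (det_mellin i \<gamma> \<tau>\<^sub>1 \<tau>\<^sub>2 n s)"
    by blast+
qed

lemma det_mellin_0:
  assumes "\<gamma> > 0"
  shows "det_mellin i \<gamma> \<tau>\<^sub>1 \<tau>\<^sub>2 n (0 :: real) = 1"
proof -
  have q: "gamma_quotient w (0::real) = 1" if "w > 0" for w
  proof -
    have "Gamma w \<noteq> 0" using Gamma_real_pos[OF that] by (metis less_irrefl)
    then show ?thesis by (simp add: gamma_quotient_def)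
  qed
  show ?thesis using assms by (cases i) (auto simp: Let_def q intro!: prod.neutral)
qed

lemma det_mellin_holomorphic:
  assumes "\<gamma> > 0"
  shows "det_mellin i \<gamma> \<tau>\<^sub>1 \<tau>\<^sub>2 n holomorphic_on ball (0::complex) \<gamma>"
proof -
  have ge: "\<gamma> \<le> \<gamma> * real k" "\<gamma> \<le> \<gamma> * (real M + real k)" if "k \<ge> 1" for k M
    using multiple_ge[OF assms(1), of k] multiple_ge[OF assms(1), of "M + k"] that by auto
  note h = gamma_quotient_holomorphic[OF assms]
  show ?thesis
  proof (cases i)
    case Laguerre
    show ?thesis unfolding Laguerre det_mellin.simps
      by (intro holomorphic_on_prod holomorphic_on_mult holomorphic_intros h(1)) (auto intro: ge)
  next
    case Gram
    show ?thesis unfolding Gram det_mellin.simps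
      by (intro holomorphic_on_prod holomorphic_on_divide h) (auto intro: ge)
  next
    case Jacobi
    show ?thesis unfolding Jacobi det_mellin.simps Let_def
      by (intro holomorphic_on_prod holomorphic_on_divide h) (auto intro: ge)
  qed
qed

text \<open>The total mass is the moment of order 0.\<close>

lemma real_distribution_X_law:
  assumes "\<gamma> > 0"
  shows "real_distribution (X_law i (2 * \<gamma>) \<tau>\<^sub>1 \<tau>\<^sub>2 n)"
proof -
  let ?N = "X_law i (2 * \<gamma>) \<tau>\<^sub>1 \<tau>\<^sub>2 n"
  have "emeasure ?N (space ?N) = (\<integral>\<^sup>+x. ennreal (exp (0 * x)) \<partial>?N)" by simp
  also have "\<dots> = 1" using X_law_mgf[OF assms, of 0 i \<tau>\<^sub>1 \<tau>\<^sub>2 n] assms by (simp add: det_mellin_0)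
  finally have "prob_space ?N" by (rule prob_spaceI)
  then show ?thesis by (simp add: real_distribution_def real_distribution_axioms_def X_law_def)
qed

lemma cumulant_bound_ensembles:
  assumes "\<gamma> > 0" "\<tau>\<^sub>1 > 0" "\<tau>\<^sub>2 > 0"
  shows "\<exists>C. \<forall>\<^sub>F n in sequentially. cumulant_bound i \<gamma> \<tau>\<^sub>1 \<tau>\<^sub>2 C n"
  using laguerre_cumulant_bound[OF assms(1)] gram_cumulant_bound[OF assms(1)] jacobi_cumulant_bound[OF assms]
  by (cases i) metis+

text \<open>The moments are known on the interval of radius \<open>min 1 \<gamma>\<close>, and half of this radius is within the disc of the
cumulant bound.\<close>

lemma X_law_near_gaussian:
  assumes \<gamma>: "\<gamma> > 0" and cb: "cumulant_bound i \<gamma> \<tau>\<^sub>1 \<tau>\<^sub>2 C n" and n: "n \<ge> 1"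
  shows "mgf_near_gaussian (X_law i (2 * \<gamma>) \<tau>\<^sub>1 \<tau>\<^sub>2 n) (sqrt (2 * ln (real n) / (2 * \<gamma>))) (min 1 \<gamma> / 2) \<bar>C\<bar>"
  unfolding mgf_near_gaussian_def
proof (intro conjI allI impI)
  let ?N = "X_law i (2 * \<gamma>) \<tau>\<^sub>1 \<tau>\<^sub>2 n" and ?\<delta> = "min 1 \<gamma>" and ?c = "centering i (2 * \<gamma>) \<tau>\<^sub>1 \<tau>\<^sub>2 n"
  show N: "real_distribution ?N" by (rule real_distribution_X_law) fact
  fix z :: complex assume z: "norm z \<le> min 1 \<gamma> / 2"
  let ?F = "\<lambda>z. det_mellin i \<gamma> \<tau>\<^sub>1 \<tau>\<^sub>2 n z * exp (- z * complex_of_real ?c)"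
  let ?f = "\<lambda>s. det_mellin i \<gamma> \<tau>\<^sub>1 \<tau>\<^sub>2 n s * exp (- s * ?c)"
  have hol: "?F holomorphic_on ball 0 ?\<delta>"
    by (intro holomorphic_on_mult holomorphic_intros holomorphic_on_subset[OF det_mellin_holomorphic[OF \<gamma>]]) auto
  have real: "(\<integral>\<^sup>+x. ennreal (exp (s * x)) \<partial>?N) = ennreal (?f s)" "?F (of_real s) = of_real (?f s)" "0 \<le> ?f s"
    if "\<bar>s\<bar> < ?\<delta>" for s
  proof -
    have s: "\<bar>s\<bar> < \<gamma>" "\<bar>s\<bar> \<le> 1" using that by auto
    show "(\<integral>\<^sup>+x. ennreal (exp (s * x)) \<partial>?N) = ennreal (?f s)" by (rule X_law_mgf[OF \<gamma> s])
    show "0 \<le> ?f s" using det_mellin_pos[OF \<gamma> s(1), of i \<tau>\<^sub>1 \<tau>\<^sub>2 n] by simp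
    show "?F (of_real s) = of_real (?f s)"
      unfolding det_mellin_of_real[OF \<gamma> s(1)] by (simp flip: exp_of_real)
  qed
  have z': "norm z < ?\<delta>" using z \<gamma> by auto
  note ext = mgf_analytic_extension[OF N hol real z']
  show "integrable ?N (\<lambda>x. exp (z * of_real x))" by (rule ext(1))
  have z1: "norm z \<le> 1" and z2: "norm z \<le> \<gamma> / 2" using z by auto
  obtain h where h: "norm h \<le> C * norm z" "?F z = exp (of_real (ln (real n) / (2 * \<gamma>)) * z\<^sup>2 + h)"
    using cb[unfolded cumulant_bound_def, rule_format, OF z1 z2] by (elim exE conjE)
  have var: "(sqrt (2 * ln (real n) / (2 * \<gamma>)))\<^sup>2 / 2 = ln (real n) / (2 * \<gamma>)"
    using n \<gamma> by simp
  have "norm h \<le> \<bar>C\<bar> * norm z"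
    using h(1) mult_right_mono[OF abs_ge_self[of C] norm_ge_zero[of z]] by linarith
  then show "\<exists>h. norm h \<le> \<bar>C\<bar> * norm z \<and>
     (\<integral>x. exp (z * of_real x) \<partial>?N) = exp (of_real ((sqrt (2 * ln (real n) / (2 * \<gamma>)))\<^sup>2 / 2) * z\<^sup>2 + h)"
    unfolding var using trans[OF ext(2) h(2)] by (intro exI[of _ h] conjI)
qed

theorem theorem4p7:
  fixes \<beta> \<tau>\<^sub>1 \<tau>\<^sub>2 :: real and i :: ensemble and y :: "nat \<Rightarrow> real"
  assumes "\<beta> > 0" and "\<tau>\<^sub>1 > 0" and "\<tau>\<^sub>2 > 0"
    and "y \<in> o[sequentially](\<lambda>n. sqrt (ln (real n)))"
  shows "(\<lambda>n. \<P>(x in X_law i \<beta> \<tau>\<^sub>1 \<tau>\<^sub>2 n. x \<ge> y n * sqrt (2 * ln (real n) / \<beta>)))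
    \<sim>[sequentially] (\<lambda>n. \<P>(x in std_normal_law. x \<ge> y n))"
proof (rule asymp_equivI')
  define \<gamma> where "\<gamma> = \<beta> / 2"
  have \<gamma>: "\<gamma> > 0" and \<beta>: "\<beta> = 2 * \<gamma>" using assms(1) by (auto simp: \<gamma>_def)
  define \<sigma> where "\<sigma> n = sqrt (2 * ln (real n) / \<beta>)" for n
  obtain C where C: "\<forall>\<^sub>F n in sequentially. cumulant_bound i \<gamma> \<tau>\<^sub>1 \<tau>\<^sub>2 C n"
    using cumulant_bound_ensembles[OF \<gamma> assms(2,3)] by blast
  have "(\<lambda>n. measure (X_law i \<beta> \<tau>\<^sub>1 \<tau>\<^sub>2 n) {y n * \<sigma> n..} / measure std_normal_law {y n..}) \<longlonglongrightarrow> 1"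
  proof (rule moderate_deviations[where \<delta> = "min 1 \<gamma> / 2" and C = "\<bar>C\<bar>"])
    show "\<forall>\<^sub>F n in sequentially. mgf_near_gaussian (X_law i \<beta> \<tau>\<^sub>1 \<tau>\<^sub>2 n) (\<sigma> n) (min 1 \<gamma> / 2) \<bar>C\<bar>"
      using C eventually_ge_at_top[of 1]
      by eventually_elim (simp only: \<beta> \<sigma>_def X_law_near_gaussian[OF \<gamma>])
    show "filterlim \<sigma> at_top sequentially" unfolding \<sigma>_def using assms(1) by real_asymp
    have "(\<lambda>n. y n / sqrt (ln (real n)) / sqrt (2 / \<beta>)) \<longlonglongrightarrow> 0 / sqrt (2 / \<beta>)"
      using assms(1) by (intro tendsto_divide tendsto_const smalloD_tendsto[OF assms(4)]) auto
    moreover have "y n / sqrt (ln (real n)) / sqrt (2 / \<beta>) = y n / \<sigma> n" for n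
      unfolding \<sigma>_def by (simp add: real_sqrt_mult real_sqrt_divide)
    ultimately show "(\<lambda>n. y n / \<sigma> n) \<longlonglongrightarrow> 0" by (simp only: div_0)
  qed (use \<gamma> in auto)
  moreover have "\<P>(x in X_law i \<beta> \<tau>\<^sub>1 \<tau>\<^sub>2 n. x \<ge> y n * sqrt (2 * ln (real n) / \<beta>)) = measure (X_law i \<beta> \<tau>\<^sub>1 \<tau>\<^sub>2 n) {y n * \<sigma> n..}" for n
  proof -
    interpret real_distribution "X_law i \<beta> \<tau>\<^sub>1 \<tau>\<^sub>2 n" unfolding \<beta> by (rule real_distribution_X_law[OF \<gamma>])
    show ?thesis by (simp add: \<sigma>_def atLeast_def)
  qed
  moreover have "\<P>(x in std_normal_law. x \<ge> y n) = measure std_normal_law {y n..}" for n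
    by (simp add: atLeast_def)
  ultimately show "(\<lambda>n. \<P>(x in X_law i \<beta> \<tau>\<^sub>1 \<tau>\<^sub>2 n. x \<ge> y n * sqrt (2 * ln (real n) / \<beta>)) / \<P>(x in std_normal_law. x \<ge> y n)) \<longlonglongrightarrow> 1"
    by simp
qed

end
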